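(* Let $k$ be an algebraically closed field of characteristic zero, $x=(x_1,\dots,x_{r+1})$, $t=(t_1,\dots,t_l)$, $\tau=(\tau_1,\dots,\tau_s)$. Suppose that $f(x,t,\tau)\in k(\tau)[[x,t]]$ is uniformly rational in $\tau$, that $f(0,t)\equiv0$, and that $f$ is regular in $x_{r+1}$ (i.e. $f(0,\dots,0,x_{r+1},0)\not\equiv 0$). Denote by $\pi$ the projection $(x_1,\dots,x_r,x_{r+1},t)\mapsto(x_1,\dots,x_r,t)$. Then the following conditions are equivalent: (1) $V=V(f)$, understood as an algebroid hypersurface over $k(\tau)$, is Zariski equisingular with respect to the parameter $t\in(k^l,0)$ (and the projection $\pi$). (2) There is a non-empty Zariski open subset $U\subset k^s$ such that for every $\tau\in U$ the family $V_\tau=\{f(x,t,\tau)=0\}$ is Zariski equisingular with respect to the parameter $t\in(k^l,0)$ (and the projection $\pi$). (3) There exists $\tau_0\in k^s$ such that $V$, understood as an algebroid hypersurface of $(k^{r+1+l+s},(0,0,\tau_0))$, is Zariski equisingular with respect to the local parameters $(t,\tau-\tau_0)\in(k^l\times k^s,0)$ (and the projection $(x_1,\dots,x_r,x_{r+1},t,\tau)\mapsto(x_1,\dots,x_r,t,\tau)$).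
   Context: Uniform rationality: a power series $\sum_\alpha a_\alpha(\tau)w^\alpha\in k(\tau)[[w]]$, $w=(w_1,\dots,w_m)$, is uniformly rational in $\tau$ if its coefficients have the form $a_\alpha=b_\alpha/c^{|\alpha|}$ with $b_\alpha,c\in k[\tau]$ and $c\neq0$ ($c$ independent of $\alpha$). Here $w=(x,t)$. Specializing $\tau$ to an element of $k^s$ (as in (2)), and expanding in $\tau-\tau_0$ (as in (3)), are understood at points where $c\ne0$. Zariski equisingular family (over $k$ or over $k(\tau)$). Write $x^i=(x_1,\dots,x_i)$. A local system of pseudopolynomials with parameter $t$ is a family of power series $F_i(x^i,t)=x_i^{d_i}+\sum_{j=1}^{d_i}a_{i-1,j}(x^{i-1},t)x_i^{d_i-j}$, $i=0,\dots,r+1$, whose coefficients $a_{i-1,j}$ vanish identically for $x^{i-1}=0$; $d_i=0$ is allowed and means $F_i\equiv1$. For $F$ a power series in $(x,t)$, $V(F)$ is Zariski equisingular with respect to the parameter $t$ if there are $k_0\ge0$ and such a system with: (a) $F_{r+1}$ is the Weierstrass polynomial (in $x_{r+1}$) associated to $F$; (b) for every $i$, $k_0\le i\le r$, $(F_{i+1})_{red}$ vanishes identically on $\{x^{i+1}=0\}$, and the discriminant of $(F_{i+1})_{red}$ (with respect to $x_{i+1}$) divides $F_i$; (c) $F_{k_0}\equiv1$ (and then $F_i\equiv1$ for $0\le i<k_0$). The coordinates $x_1,\dots,x_{r+1}$ are the given ones; in (3) the parameter is $(t,\tau-\tau_0)$. *)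

theory Defs
  imports
    "Subresultants.Resultant_Prelim"
    "HOL-Computational_Algebra.Polynomial"
    "HOL-Computational_Algebra.Fraction_Field"
    "HOL-Library.FuncSet"
    "HOL-Library.Poly_Mapping"
begin

abbreviation keys :: "('v \<Rightarrow>\<^sub>0 'a::zero) \<Rightarrow> 'v set" where "keys \<equiv> Poly_Mapping.keys"
abbreviation lookup :: "('v \<Rightarrow>\<^sub>0 'a::zero) \<Rightarrow> 'v \<Rightarrow> 'a" where "lookup \<equiv> Poly_Mapping.lookup"


section \<open>Formal power series in several variables\<close>

text \<open>
  A monomial with variables in \<open>'v\<close> is a finitely supported exponent vector. Since a monomial
  has only finitely many decompositions as a product of two monomials, the Cauchy product makes
  sense for arbitrary families of coefficients. Power series rings in finitely many variables
  over a subfield are the subsets \<open>series_over\<close> below.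
\<close>

typedef ('v, 'a) mps = "UNIV :: (('v \<Rightarrow>\<^sub>0 nat) \<Rightarrow> 'a) set"
  morphisms mcoeff Abs_mps ..

lemma mcoeff_Abs_mps [simp]: "mcoeff (Abs_mps f) = f"
  by (simp add: Abs_mps_inverse)

lemma mps_eqI: "(\<And>m. mcoeff f m = mcoeff g m) \<Longrightarrow> f = g"
  by (metis ext mcoeff_inject)

definition splits :: "('v \<Rightarrow>\<^sub>0 nat) \<Rightarrow> (('v \<Rightarrow>\<^sub>0 nat) \<times> ('v \<Rightarrow>\<^sub>0 nat)) set" where
  "splits m = {(a, b). a + b = m}"

lemma splits_iff [simp]: "(a, b) \<in> splits m \<longleftrightarrow> a + b = m"
  by (simp add: splits_def)

lemma keys_subset_add_left: "keys a \<subseteq> keys (a + b :: 'v \<Rightarrow>\<^sub>0 nat)"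
  by (auto simp: in_keys_iff lookup_add)

lemma keys_subset_add_right: "keys b \<subseteq> keys (a + b :: 'v \<Rightarrow>\<^sub>0 nat)"
  by (auto simp: in_keys_iff lookup_add)

lemma finite_bounded_monomials:
  assumes "finite V"
  shows "finite {a :: 'v \<Rightarrow>\<^sub>0 nat. keys a \<subseteq> V \<and> (\<forall>v. lookup a v \<le> N)}"
proof (rule finite_imageD)
  show "finite (lookup ` {a :: 'v \<Rightarrow>\<^sub>0 nat. keys a \<subseteq> V \<and> (\<forall>v. lookup a v \<le> N)})"
  proof (rule finite_subset)
    show "lookup ` {a :: 'v \<Rightarrow>\<^sub>0 nat. keys a \<subseteq> V \<and> (\<forall>v. lookup a v \<le> N)}
        \<subseteq> {f. \<forall>v. (v \<in> V \<longrightarrow> f v \<in> {..N}) \<and> (v \<notin> V \<longrightarrow> f v = 0)}"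
      by (auto simp: in_keys_iff)
    show "finite {f :: 'v \<Rightarrow> nat. \<forall>v. (v \<in> V \<longrightarrow> f v \<in> {..N}) \<and> (v \<notin> V \<longrightarrow> f v = 0)}"
      using assms by (rule finite_set_of_finite_funs) simp
  qed
  show "inj_on lookup {a :: 'v \<Rightarrow>\<^sub>0 nat. keys a \<subseteq> V \<and> (\<forall>v. lookup a v \<le> N)}"
    by (auto intro!: inj_onI poly_mapping_eqI)
qed

lemma lookup_le_sum: "lookup (m :: 'v \<Rightarrow>\<^sub>0 nat) v \<le> (\<Sum>u\<in>keys m. lookup m u)"
proof (cases "v \<in> keys m")
  case True
  then show ?thesis by (intro member_le_sum) auto
qed (simp add: in_keys_iff)

lemma finite_splits [simp, intro]: "finite (splits (m :: 'v \<Rightarrow>\<^sub>0 nat))"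
proof -
  let ?N = "\<Sum>u\<in>keys m. lookup m u"
  let ?A = "{a :: 'v \<Rightarrow>\<^sub>0 nat. keys a \<subseteq> keys m \<and> (\<forall>v. lookup a v \<le> ?N)}"
  have "lookup a v \<le> ?N \<and> lookup b v \<le> ?N" if "a + b = m" for a b v
    using lookup_le_sum[of m v] that by (auto simp: lookup_add)
  then have "splits m \<subseteq> ?A \<times> ?A"
    using keys_subset_add_left keys_subset_add_right by (fastforce simp: splits_def)
  then show ?thesis
    by (rule finite_subset) (intro finite_cartesian_product finite_bounded_monomials finite_keys)
qed

instantiation mps :: (type, comm_ring_1) comm_ring_1
begin

definition zero_mps where "0 = Abs_mps (\<lambda>m. 0)"
definition one_mps where "1 = Abs_mps (\<lambda>m. if m = 0 then 1 else 0)"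
definition plus_mps where "f + g = Abs_mps (\<lambda>m. mcoeff f m + mcoeff g m)"
definition uminus_mps where "- f = Abs_mps (\<lambda>m. - mcoeff f m)"
definition minus_mps where "f - g = Abs_mps (\<lambda>m. mcoeff f m - mcoeff g m)"
definition times_mps where
  "f * g = Abs_mps (\<lambda>m. \<Sum>(a, b)\<in>splits m. mcoeff f a * mcoeff g b)"

instance
proof
  fix f g h :: "('a, 'b) mps"
  show "f + g + h = f + (g + h)" "f + g = g + f" "0 + f = f" "- f + f = 0" "f - g = f + - g"
    by (auto intro!: mps_eqI simp: plus_mps_def zero_mps_def uminus_mps_def minus_mps_def)
  show "(f + g) * h = f * h + g * h"
    by (auto intro!: mps_eqI
        simp: plus_mps_def times_mps_def sum.distrib[symmetric] case_prod_unfold distrib_right)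
  have "mcoeff (0 :: ('a, 'b) mps) 0 \<noteq> mcoeff 1 0"
    by (simp add: one_mps_def zero_mps_def)
  then show "(0 :: ('a, 'b) mps) \<noteq> 1"
    by auto
  show "f * g = g * f"
  proof (rule mps_eqI)
    fix m
    have "(\<Sum>(a, b)\<in>splits m. mcoeff f a * mcoeff g b)
        = (\<Sum>(a, b)\<in>splits m. mcoeff g a * mcoeff f b)"
      by (rule sum.reindex_bij_witness[of _ prod.swap prod.swap])
        (auto simp: add.commute mult.commute)
    then show "mcoeff (f * g) m = mcoeff (g * f) m"
      by (simp add: times_mps_def)
  qed
  show "1 * f = f"
  proof (rule mps_eqI)
    fix m
    have "(\<Sum>(a, b)\<in>splits m. (if a = 0 then 1 else 0) * mcoeff f b)
        = (\<Sum>(a, b)\<in>{(0 :: 'a \<Rightarrow>\<^sub>0 nat, m)}. (if a = 0 then 1 else 0) * mcoeff f b)"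
      by (intro sum.mono_neutral_right) (auto split: if_splits)
    then show "mcoeff (1 * f) m = mcoeff f m"
      by (simp add: times_mps_def one_mps_def)
  qed
  show "f * g * h = f * (g * h)"
  proof (rule mps_eqI)
    fix m
    have "mcoeff (f * g * h) m
        = (\<Sum>p\<in>splits m. \<Sum>q\<in>splits (fst p). mcoeff f (fst q) * mcoeff g (snd q) * mcoeff h (snd p))"
      by (simp add: times_mps_def case_prod_unfold sum_distrib_right)
    also have "\<dots> = (\<Sum>(p, q)\<in>Sigma (splits m) (\<lambda>p. splits (fst p)).
        mcoeff f (fst q) * mcoeff g (snd q) * mcoeff h (snd p))"
      by (rule sum.Sigma) auto
    also have "\<dots> = (\<Sum>(p, q)\<in>Sigma (splits m) (\<lambda>p. splits (snd p)).
        mcoeff f (fst p) * (mcoeff g (fst q) * mcoeff h (snd q)))"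
      by (rule sum.reindex_bij_witness[of _
            "\<lambda>(p, q). ((fst p + fst q, snd q), (fst p, fst q))"
            "\<lambda>(p, q). ((fst q, snd q + snd p), (snd q, snd p))"])
        (auto simp: add.assoc mult.assoc)
    also have "\<dots> = (\<Sum>p\<in>splits m. \<Sum>q\<in>splits (snd p).
        mcoeff f (fst p) * (mcoeff g (fst q) * mcoeff h (snd q)))"
      by (rule sum.Sigma[symmetric]) auto
    also have "\<dots> = mcoeff (f * (g * h)) m"
      by (simp add: times_mps_def case_prod_unfold sum_distrib_left)
    finally show "mcoeff (f * g * h) m = mcoeff (f * (g * h)) m" .
  qed
qed

end

lemma mcoeff_zero [simp]: "mcoeff 0 m = 0"
  by (simp add: zero_mps_def)

lemma mcoeff_one: "mcoeff 1 m = (if m = 0 then 1 else 0)"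
  by (simp add: one_mps_def)

lemma mcoeff_mult: "mcoeff (f * g) m = (\<Sum>(a, b)\<in>splits m. mcoeff f a * mcoeff g b)"
  by (simp add: times_mps_def)

definition mdeg :: "('v \<Rightarrow>\<^sub>0 nat) \<Rightarrow> nat" where
  "mdeg m = (\<Sum>v\<in>keys m. lookup m v)"

lemma mdeg_superset: "finite V \<Longrightarrow> keys m \<subseteq> V \<Longrightarrow> mdeg m = (\<Sum>v\<in>V. lookup m v)"
  unfolding mdeg_def by (rule sum.mono_neutral_left) (auto simp: in_keys_iff)

lemma mdeg_add: "mdeg (a + b) = mdeg a + mdeg b"
proof -
  have "mdeg (a + b) = (\<Sum>v\<in>keys a \<union> keys b. lookup (a + b) v)"
    by (rule mdeg_superset) (use keys_add[of a b] in auto)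
  moreover have "mdeg a = (\<Sum>v\<in>keys a \<union> keys b. lookup a v)"
    by (rule mdeg_superset) auto
  moreover have "mdeg b = (\<Sum>v\<in>keys a \<union> keys b. lookup b v)"
    by (rule mdeg_superset) auto
  ultimately show ?thesis
    by (simp add: lookup_add sum.distrib)
qed

instance mps :: (linorder, idom) idom
proof
  fix f g :: "('a, 'b) mps"
  assume "f \<noteq> 0" "g \<noteq> 0"
  then obtain m n where m: "mcoeff f m \<noteq> 0" and n: "mcoeff g n \<noteq> 0"
    by (metis mcoeff_zero mps_eqI)
  define V where "V = keys m \<union> keys n"
  have fin: "finite {a :: 'a \<Rightarrow>\<^sub>0 nat. keys a \<subseteq> V \<and> mdeg a = d}" for d
  proof (rule finite_subset)
    show "{a :: 'a \<Rightarrow>\<^sub>0 nat. keys a \<subseteq> V \<and> mdeg a = d} \<subseteq> {a. keys a \<subseteq> V \<and> (\<forall>v. lookup a v \<le> d)}"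
      using lookup_le_sum by (auto simp: mdeg_def)
    show "finite {a :: 'a \<Rightarrow>\<^sub>0 nat. keys a \<subseteq> V \<and> (\<forall>v. lookup a v \<le> d)}"
      by (rule finite_bounded_monomials) (simp add: V_def)
  qed
  have ex_min: "\<exists>a. mcoeff h a \<noteq> 0 \<and> keys a \<subseteq> V \<and>
      (\<forall>p. mcoeff h p \<noteq> 0 \<and> keys p \<subseteq> V \<longrightarrow> mdeg a < mdeg p \<or> mdeg a = mdeg p \<and> a \<le> p)"
    if "mcoeff h k \<noteq> 0" "keys k \<subseteq> V" for h :: "('a, 'b) mps" and k
  proof -
    define d where "d = (LEAST d. \<exists>p. mcoeff h p \<noteq> 0 \<and> keys p \<subseteq> V \<and> mdeg p = d)"
    have ex: "\<exists>p. mcoeff h p \<noteq> 0 \<and> keys p \<subseteq> V \<and> mdeg p = d"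
      unfolding d_def by (rule LeastI_ex) (use that in auto)
    have le: "d \<le> mdeg p" if "mcoeff h p \<noteq> 0" "keys p \<subseteq> V" for p
      unfolding d_def by (rule Least_le) (use that in auto)
    define A where "A = {p. mcoeff h p \<noteq> 0 \<and> keys p \<subseteq> V \<and> mdeg p = d}"
    have "finite A"
      by (rule finite_subset[OF _ fin[of d]]) (auto simp: A_def)
    moreover have "A \<noteq> {}"
      using ex by (auto simp: A_def)
    ultimately have minA: "Min A \<in> A" and min_le: "\<forall>p\<in>A. Min A \<le> p"
      by auto
    show ?thesis
    proof (intro exI[of _ "Min A"] conjI allI impI)
      show "mcoeff h (Min A) \<noteq> 0" "keys (Min A) \<subseteq> V"
        using minA by (simp_all add: A_def)
      fix p
      assume p: "mcoeff h p \<noteq> 0 \<and> keys p \<subseteq> V"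
      have d: "mdeg (Min A) = d"
        using minA by (simp add: A_def)
      show "mdeg (Min A) < mdeg p \<or> mdeg (Min A) = mdeg p \<and> Min A \<le> p"
      proof (cases "mdeg p = d")
        case True
        then have "p \<in> A" using p by (simp add: A_def)
        then show ?thesis using min_le d True by simp
      next
        case False
        have "d \<le> mdeg p" using le p by blast
        then show ?thesis using d False by simp
      qed
    qed
  qed
  obtain a where a: "mcoeff f a \<noteq> 0" "keys a \<subseteq> V" and
    amin: "\<And>p. mcoeff f p \<noteq> 0 \<Longrightarrow> keys p \<subseteq> V \<Longrightarrow> mdeg a < mdeg p \<or> mdeg a = mdeg p \<and> a \<le> p"
    using ex_min[OF m] V_def by blast
  obtain b where b: "mcoeff g b \<noteq> 0" "keys b \<subseteq> V" and
    bmin: "\<And>p. mcoeff g p \<noteq> 0 \<Longrightarrow> keys p \<subseteq> V \<Longrightarrow> mdeg b < mdeg p \<or> mdeg b = mdeg p \<and> b \<le> p"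
    using ex_min[OF n] V_def by blast
  have other: "mcoeff f p * mcoeff g q = 0" if pq: "p + q = a + b" and ne: "(p, q) \<noteq> (a, b)" for p q
  proof (rule ccontr)
    assume "\<not> ?thesis"
    then have nz: "mcoeff f p \<noteq> 0" "mcoeff g q \<noteq> 0" by auto
    have "keys (p + q) \<subseteq> V"
      using pq keys_add[of a b] a(2) b(2) by auto
    then have "keys p \<subseteq> V" "keys q \<subseteq> V"
      using keys_subset_add_left[of p q] keys_subset_add_right[of q p] by auto
    then have "mdeg a < mdeg p \<or> mdeg a = mdeg p \<and> a \<le> p"
      and "mdeg b < mdeg q \<or> mdeg b = mdeg q \<and> b \<le> q"
      using nz amin bmin by auto
    moreover have "mdeg p + mdeg q = mdeg a + mdeg b"
      using pq by (metis mdeg_add)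
    ultimately have "a \<le> p" "b \<le> q" by auto
    moreover have "p \<noteq> a"
      using ne pq by auto
    ultimately have "a + b < p + q"
      by (intro add_less_le_mono) auto
    then show False using pq by simp
  qed
  have "\<forall>i\<in>splits (a + b) - {(a, b)}. (case i of (p, q) \<Rightarrow> mcoeff f p * mcoeff g q) = 0"
  proof
    fix i
    assume i: "i \<in> splits (a + b) - {(a, b)}"
    obtain p q where "i = (p, q)" by (cases i)
    then show "(case i of (p, q) \<Rightarrow> mcoeff f p * mcoeff g q) = 0"
      using i other[of p q] by simp
  qed
  then have "mcoeff (f * g) (a + b) = (\<Sum>(p, q)\<in>{(a, b)}. mcoeff f p * mcoeff g q)"
    unfolding mcoeff_mult by (intro sum.mono_neutral_right) simp_all
  then have "mcoeff (f * g) (a + b) \<noteq> 0"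
    using a b by simp
  then show "f * g \<noteq> 0" by auto
qed

definition mconst :: "'a \<Rightarrow> ('v, 'a::comm_ring_1) mps" where
  "mconst a = Abs_mps (\<lambda>m. if m = 0 then a else 0)"

definition mvar :: "'v \<Rightarrow> ('v, 'a::comm_ring_1) mps" where
  "mvar v = Abs_mps (\<lambda>m. if m = Poly_Mapping.single v 1 then 1 else 0)"

text \<open>\<open>series_over K V\<close> is the ring \<open>K[[V]]\<close> for a subfield \<open>K\<close> and a set \<open>V\<close> of variables.\<close>

definition series_over :: "'a set \<Rightarrow> 'v set \<Rightarrow> ('v, 'a::comm_ring_1) mps set" where
  "series_over K V = {f. \<forall>m. mcoeff f m \<in> K \<and> (mcoeff f m \<noteq> 0 \<longrightarrow> keys m \<subseteq> V)}"

definition vanishes_on_zero :: "'v set \<Rightarrow> ('v, 'a::comm_ring_1) mps \<Rightarrow> bool" where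
  \<comment> \<open>the series obtained from \<open>f\<close> by setting all variables in \<open>W\<close> to zero is zero\<close>
  "vanishes_on_zero W f \<longleftrightarrow> (\<forall>m. keys m \<inter> W = {} \<longrightarrow> mcoeff f m = 0)"

definition poly_over :: "'a::zero set \<Rightarrow> 'a poly set" where
  "poly_over R = {p. set (coeffs p) \<subseteq> R}"


section \<open>Zariski equisingularity\<close>

text \<open>
  \<open>X i\<close> stands for $x_i$, \<open>T i\<close> for $t_i$ and \<open>S i\<close> for the local parameter
  $\tau_i - \tau_{0,i}$; all indices start at 1.
\<close>

datatype var = X nat | T nat | S nat

text \<open>The order on variables has no meaning; it serves the class instances above.\<close>

fun var_code :: "var \<Rightarrow> nat" where
  "var_code (X i) = 3 * i"
| "var_code (T i) = 3 * i + 1"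
| "var_code (S i) = 3 * i + 2"

lemma var_code_inject: "var_code a = var_code b \<Longrightarrow> a = b"
  by (cases a; cases b) (auto, presburger+)

instantiation var :: linorder
begin

definition less_eq_var where "a \<le> b \<longleftrightarrow> var_code a \<le> var_code b"
definition less_var where "a < b \<longleftrightarrow> var_code a < var_code b"

instance
  by standard (auto simp: less_eq_var_def less_var_def intro: var_code_inject)

end

definition xvars :: "nat \<Rightarrow> var set" where "xvars i = X ` {1..i}"
definition tvars :: "nat \<Rightarrow> var set" where "tvars l = T ` {1..l}"
definition svars :: "nat \<Rightarrow> var set" where "svars s = S ` {1..s}"

text \<open>Only used for monic polynomials.\<close>

definition discriminant :: "'a::idom poly \<Rightarrow> 'a" where
  "discriminant p = (- 1) ^ (degree p * (degree p - 1) div 2) * resultant p (pderiv p)"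

text \<open>
  \<open>G\<close> is $P_{red}$ for a monic polynomial \<open>P\<close> over the ring \<open>R\<close>: it is the monic generator of the
  radical of the ideal \<open>(P)\<close> of \<open>R[x]\<close>.
\<close>

definition reduced_of :: "'a::comm_ring_1 set \<Rightarrow> 'a poly \<Rightarrow> 'a poly \<Rightarrow> bool" where
  "reduced_of R P G \<longleftrightarrow> G \<in> poly_over R \<and> lead_coeff G = 1 \<and>
     (\<forall>H\<in>poly_over R.
        (\<exists>Q\<in>poly_over R. H = G * Q) \<longleftrightarrow> (\<exists>n. \<exists>Q\<in>poly_over R. H ^ n = P * Q))"

text \<open>
  A pseudopolynomial in $x_i$ with parameters \<open>Ps\<close>, given as a polynomial in one variable over
  power series in $x^{i-1}$ and the parameters. The corresponding power series in $x^i$ and the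
  parameters is \<open>poly P (mvar (X i))\<close>.
\<close>

definition pseudopolynomial ::
    "'a::field set \<Rightarrow> var set \<Rightarrow> nat \<Rightarrow> (var, 'a) mps poly \<Rightarrow> bool" where
  "pseudopolynomial K Ps i P \<longleftrightarrow>
     P \<in> poly_over (series_over K (xvars (i - 1) \<union> Ps)) \<and> lead_coeff P = 1 \<and>
     (\<forall>j<degree P. vanishes_on_zero (xvars (i - 1)) (coeff P j))"

definition weierstrass_polynomial_of ::
    "'a::field set \<Rightarrow> var set \<Rightarrow> nat \<Rightarrow> (var, 'a) mps \<Rightarrow> (var, 'a) mps poly \<Rightarrow> bool" where
  "weierstrass_polynomial_of K Ps n F P \<longleftrightarrow>
     P \<in> poly_over (series_over K (xvars (n - 1) \<union> Ps)) \<and> lead_coeff P = 1 \<and>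
     (\<forall>j<degree P. mcoeff (coeff P j) 0 = 0) \<and>
     (\<exists>u\<in>series_over K (xvars n \<union> Ps). mcoeff u 0 \<noteq> 0 \<and> F = u * poly P (mvar (X n)))"

text \<open>
  Zariski equisingularity of $V(F)$, for \<open>F\<close> a power series over the field \<open>K\<close> in
  $x_1, \dots, x_{r+1}$ and the parameters \<open>Ps\<close>. There is no variable $x_0$; the member $F_0$ of
  the system is 1 by the last condition.
\<close>

definition zariski_equisingular ::
    "'a::field set \<Rightarrow> nat \<Rightarrow> var set \<Rightarrow> (var, 'a) mps \<Rightarrow> bool" where
  "zariski_equisingular K r Ps F \<longleftrightarrow>
     (\<exists>k0 P. k0 \<le> r + 1 \<and>
        (\<forall>i\<le>r + 1. pseudopolynomial K Ps i (P i)) \<and>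
        weierstrass_polynomial_of K Ps (r + 1) F (P (r + 1)) \<and>
        (\<forall>i. k0 \<le> i \<and> i \<le> r \<longrightarrow>
           (\<exists>G. reduced_of (series_over K (xvars i \<union> Ps)) (P (i + 1)) G \<and>
                vanishes_on_zero (xvars (i + 1)) (poly G (mvar (X (i + 1)))) \<and>
                (\<exists>h\<in>series_over K (xvars i \<union> Ps).
                   poly (P i) (mvar (X i)) = discriminant G * h))) \<and>
        (\<forall>i\<le>k0. P i = 1))"


section \<open>Rational functions in the parameters \<open>\<tau>\<close>\<close>

type_synonym 'k taupoly = "(nat \<Rightarrow>\<^sub>0 nat) \<Rightarrow>\<^sub>0 'k"

text \<open>The ring $k[\tau_1,\dots,\tau_s]$ and its field of fractions $k(\tau_1,\dots,\tau_s)$.\<close>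

definition tau_polys :: "nat \<Rightarrow> 'k::zero taupoly set" where
  "tau_polys s = {p. \<forall>m\<in>keys p. keys m \<subseteq> {1..s}}"

definition tau_ratfuns :: "nat \<Rightarrow> 'k::idom taupoly fract set" where
  "tau_ratfuns s = {Fract p q | p q. p \<in> tau_polys s \<and> q \<in> tau_polys s \<and> q \<noteq> 0}"

text \<open>Evaluation of a polynomial at \<open>v\<close>, after mapping its coefficients by \<open>h\<close>.\<close>

definition eval_hom :: "('k::zero \<Rightarrow> 'b::comm_ring_1) \<Rightarrow> (nat \<Rightarrow> 'b) \<Rightarrow> 'k taupoly \<Rightarrow> 'b" where
  "eval_hom h v p = (\<Sum>m\<in>keys p. h (lookup p m) * (\<Prod>i\<in>keys m. v i ^ lookup m i))"

definition peval :: "(nat \<Rightarrow> 'k::comm_ring_1) \<Rightarrow> 'k taupoly \<Rightarrow> 'k" where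
  "peval = eval_hom (\<lambda>a. a)"

definition taylor :: "(nat \<Rightarrow> 'k::comm_ring_1) \<Rightarrow> 'k taupoly \<Rightarrow> (var, 'k) mps" where
  "taylor \<tau>0 = eval_hom mconst (\<lambda>i. mconst (\<tau>0 i) + mvar (S i))"

definition affine_space :: "nat \<Rightarrow> (nat \<Rightarrow> 'k) set" where
  "affine_space s = ({1..s} \<rightarrow>\<^sub>E UNIV)"

definition zariski_open :: "nat \<Rightarrow> (nat \<Rightarrow> 'k::comm_ring_1) set \<Rightarrow> bool" where
  "zariski_open s U \<longleftrightarrow>
     (\<exists>A\<subseteq>tau_polys s. U = {\<tau>\<in>affine_space s. \<exists>p\<in>A. peval \<tau> p \<noteq> 0})"

text \<open>
  \<open>f\<close> is uniformly rational with \<open>b\<close> and \<open>c\<close> as a witness. Specialization and expansion of \<open>f\<close> are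
  then defined at the points where \<open>c\<close> does not vanish.
\<close>

definition uniformly_rational_by ::
    "nat \<Rightarrow> (var, 'k::idom taupoly fract) mps \<Rightarrow> ((var \<Rightarrow>\<^sub>0 nat) \<Rightarrow> 'k taupoly) \<Rightarrow> 'k taupoly \<Rightarrow> bool"
  where
  "uniformly_rational_by s f b c \<longleftrightarrow>
     c \<in> tau_polys s \<and> c \<noteq> 0 \<and>
     (\<forall>\<alpha>. b \<alpha> \<in> tau_polys s \<and> mcoeff f \<alpha> = Fract (b \<alpha>) (c ^ mdeg \<alpha>))"

definition specialize ::
    "((var \<Rightarrow>\<^sub>0 nat) \<Rightarrow> 'k::field taupoly) \<Rightarrow> 'k taupoly \<Rightarrow> (nat \<Rightarrow> 'k) \<Rightarrow> (var, 'k) mps" where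
  "specialize b c \<tau> = Abs_mps (\<lambda>\<alpha>. peval \<tau> (b \<alpha>) / peval \<tau> c ^ mdeg \<alpha>)"

text \<open>
  For a monomial \<open>\<alpha>\<close> in the variables \<open>X\<close> and \<open>T\<close>, the coefficient of \<open>\<alpha>\<close> in \<open>g\<close>, as a power
  series in the variables \<open>S\<close>.
\<close>

definition s_coeff :: "(var, 'k::comm_ring_1) mps \<Rightarrow> (var \<Rightarrow>\<^sub>0 nat) \<Rightarrow> (var, 'k) mps" where
  "s_coeff g \<alpha> = Abs_mps (\<lambda>\<beta>. if keys \<beta> \<subseteq> range S then mcoeff g (\<alpha> + \<beta>) else 0)"

text \<open>
  \<open>g\<close> is the expansion at \<open>\<tau>0\<close> of the series with coefficients $b_\alpha / c^{|\alpha|}$. When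
  $c(\tau_0) \neq 0$ the series \<open>taylor \<tau>0 c\<close> is a unit, so that \<open>g\<close> exists and is unique.
\<close>

definition expansion_at ::
    "nat \<Rightarrow> nat \<Rightarrow> nat \<Rightarrow> ((var \<Rightarrow>\<^sub>0 nat) \<Rightarrow> 'k::field taupoly) \<Rightarrow> 'k taupoly \<Rightarrow> (nat \<Rightarrow> 'k) \<Rightarrow>
     (var, 'k) mps \<Rightarrow> bool" where
  "expansion_at r l s b c \<tau>0 g \<longleftrightarrow>
     g \<in> series_over UNIV (xvars (r + 1) \<union> tvars l \<union> svars s) \<and>
     (\<forall>\<alpha>. keys \<alpha> \<subseteq> xvars (r + 1) \<union> tvars l \<longrightarrow>
        s_coeff g \<alpha> * taylor \<tau>0 c ^ mdeg \<alpha> = taylor \<tau>0 (b \<alpha>))"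

end

theory Submission
  imports
    "HOL-Algebra.Algebraic_Closure_Type"
    "Subresultants.Subresultant"
    Defs
begin

text \<open>
  In an equisingular system every $F_i$ may be replaced by the Weierstrass polynomial of the
  discriminant of $(F_{i+1})_{red}$: by uniqueness of Weierstrass polynomials and of radicals the
  resulting chain of iterated discriminants depends on \<open>f\<close> only, and \<open>f\<close> is equisingular if and only
  if at each step the discriminant, restricted to $x^{i-1}=0$, is a power of $x_i$ times a unit,
  the last discriminant being a unit. Passing from $F_{i+1}$ to the discriminant of its reduction
  stays inside the power series because $K[[x,t]]$ is completely integrally closed.

  A chain over $k(\tau)$ involves only finitely many nonzero elements that have to be inverted or
  have to stay nonzero. So it lives over a localization $k[\tau]_c$ and is carried to a chain by
  specialization and by Taylor expansion wherever \<open>c\<close> does not vanish. Conversely, the orders in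
  $x_i$ along a chain over $k(\tau)$ are those at a general \<open>\<tau>\<close>, and the injectivity of the Taylor
  expansion allows one to read off the chain over $k(\tau)$ from the expanded one.
\<close>

(* In HOL-Algebra X is notation for a polynomial; here it is a constructor. *)
no_notation var (\<open>X\<index>\<close>)


section \<open>Subrings and partial homomorphisms\<close>

text \<open>Two obstacles shape the proof. The radical of a monic polynomial need not have
  coefficients in the given ring, so a discriminant could leave the power series. Complete integral
  closedness takes the place of unique factorization here: it follows from comparing leading
  monomials and speaks about elements only, which suits an argument with resultants. The other
  obstacle is that a series over \<open>k(\<tau>)\<close> has infinitely many coefficients, with
  possibly unbounded denominators. They stay bounded because Weierstrass preparation inverts a
  single coefficient, and because the radical is a squarefree part divided by its leading
  coefficient \<open>l\<close>, where again only one coefficient of the series \<open>l\<close> has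
  to be inverted. For (3) even this is too much to ask, as that coefficient may become a nonunit in
  the expansion at the given point. All these rings lie in one type, so rings are sets, and
  homomorphisms are constrained on a set only.\<close>

locale unital_subring =
  fixes R :: "'a::idom set"
  assumes zero_closed [simp, intro]: "0 \<in> R"
    and one_closed [simp, intro]: "1 \<in> R"
    and add_closed [intro]: "a \<in> R \<Longrightarrow> b \<in> R \<Longrightarrow> a + b \<in> R"
    and uminus_closed [intro]: "a \<in> R \<Longrightarrow> - a \<in> R"
    and mult_closed [intro]: "a \<in> R \<Longrightarrow> b \<in> R \<Longrightarrow> a * b \<in> R"
begin

lemma diff_closed [intro]: "a \<in> R \<Longrightarrow> b \<in> R \<Longrightarrow> a - b \<in> R"
  using add_closed[of a "- b"] by auto

lemma sum_closed: "(\<And>i. i \<in> I \<Longrightarrow> f i \<in> R) \<Longrightarrow> sum f I \<in> R"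
  by (induction I rule: infinite_finite_induct) auto

lemma prod_closed: "(\<And>i. i \<in> I \<Longrightarrow> f i \<in> R) \<Longrightarrow> prod f I \<in> R"
  by (induction I rule: infinite_finite_induct) auto

lemma power_closed [intro]: "a \<in> R \<Longrightarrow> a ^ n \<in> R"
  by (induction n) auto

lemma of_nat_closed [simp, intro]: "of_nat n \<in> R"
  by (induction n) auto

lemma of_int_closed [simp, intro]: "of_int n \<in> R"
  by (cases n) (auto simp del: of_nat_Suc)

lemma poly_over_iff: "p \<in> poly_over R \<longleftrightarrow> (\<forall>i. coeff p i \<in> R)"
proof
  assume "p \<in> poly_over R"
  then show "\<forall>i. coeff p i \<in> R"
    by (metis (no_types, lifting) coeff_eq_0 coeff_in_coeffs coeffs_0_eq_Nil degree_0 le_0_eq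
        mem_Collect_eq not_le_imp_less poly_over_def subset_eq zero_closed coeff_0)
qed (auto simp: poly_over_def coeffs_def)

lemma coeff_closed [intro]: "p \<in> poly_over R \<Longrightarrow> coeff p i \<in> R"
  by (simp add: poly_over_iff)

lemma unital_subring_poly_over: "unital_subring (poly_over R)"
  by standard (auto simp: poly_over_iff coeff_mult coeff_1 intro!: sum_closed)

lemma pderiv_closed [intro]: "p \<in> poly_over R \<Longrightarrow> pderiv p \<in> poly_over R"
  by (auto simp: poly_over_iff coeff_pderiv simp del: of_nat_Suc)

lemma smult_closed [intro]: "a \<in> R \<Longrightarrow> p \<in> poly_over R \<Longrightarrow> smult a p \<in> poly_over R"
  by (auto simp: poly_over_iff)

lemma monom_closed [intro]: "a \<in> R \<Longrightarrow> monom a n \<in> poly_over R"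
  by (auto simp: poly_over_iff)

lemma pCons_closed [intro]: "a \<in> R \<Longrightarrow> p \<in> poly_over R \<Longrightarrow> pCons a p \<in> poly_over R"
  by (auto simp: poly_over_iff coeff_pCons split: nat.splits)

lemma poly_closed [intro]: "p \<in> poly_over R \<Longrightarrow> x \<in> R \<Longrightarrow> poly p x \<in> R"
  by (auto simp: poly_altdef intro!: sum_closed)

lemma det_closed:
  assumes "\<And>i j. i < dim_row M \<Longrightarrow> j < dim_col M \<Longrightarrow> M $$ (i, j) \<in> R"
  shows "det M \<in> R"
proof (cases "dim_row M = dim_col M")
  case True
  have "(\<Prod>i = 0..<dim_row M. M $$ (i, p i)) \<in> R" if "p permutes {0..<dim_row M}" for p
    by (rule prod_closed) (use that True assms in \<open>auto simp: permutes_in_image\<close>)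
  then show ?thesis
    unfolding det_def using True by (auto intro!: sum_closed mult_closed)
qed (simp add: det_def)

lemma resultant_closed [intro]:
  assumes "p \<in> poly_over R" "q \<in> poly_over R"
  shows "resultant p q \<in> R"
  unfolding resultant_def
  by (rule det_closed) (use assms in \<open>auto simp: sylvester_index_mat\<close>)

text \<open>Each step multiplies \<open>F\<close> by the leading coefficient of \<open>G\<close>
  instead of dividing by it, which keeps all coefficients in \<open>R\<close>; \<open>k\<close>
  counts the steps. For monic \<open>G\<close> the scalar disappears and genuine division
  remains.\<close>

lemma monic_pseudo_division:
  assumes G: "G \<in> poly_over R" "G \<noteq> 0" and F: "F \<in> poly_over R"
  shows "\<exists>k. \<exists>S\<in>poly_over R. \<exists>T\<in>poly_over R.
    smult (lead_coeff G ^ k) F = G * S + T \<and> (T = 0 \<or> degree T < degree G)"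
  using F
proof (induction "degree F" arbitrary: F rule: less_induct)
  case (less F)
  interpret PR: unital_subring "poly_over R" by (rule unital_subring_poly_over)
  show ?case
  proof (cases "F = 0 \<or> degree F < degree G")
    case True
    show ?thesis
      by (rule exI[of _ 0], rule bexI[of _ 0], rule bexI[of _ F]) (use True less.prems in auto)
  next
    case False
    let ?c = "lead_coeff F" and ?n = "degree F - degree G"
    define H where "H = smult (lead_coeff G) F - monom ?c ?n * G"
    have HR: "H \<in> poly_over R"
      unfolding H_def by (intro PR.diff_closed PR.mult_closed smult_closed monom_closed coeff_closed less.prems G)
    have c0: "coeff H (degree F) = 0"
      using False by (simp add: H_def coeff_monom_mult)
    have dH: "degree H \<le> degree F"
      unfolding H_def
    proof (rule degree_diff_le)
      have "degree (monom ?c ?n * G) \<le> degree (monom ?c ?n) + degree G" by (rule degree_mult_le)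
      also have "\<dots> \<le> ?n + degree G" by (simp add: degree_monom_le)
      finally show "degree (monom ?c ?n * G) \<le> degree F" using False by simp
    qed (rule degree_smult_le)
    have "H = 0 \<or> degree H < degree F"
      using c0 dH by (metis le_neq_implies_less leading_coeff_0_iff)
    then have "\<exists>k. \<exists>S\<in>poly_over R. \<exists>T\<in>poly_over R.
        smult (lead_coeff G ^ k) H = G * S + T \<and> (T = 0 \<or> degree T < degree G)"
    proof
      assume "H = 0"
      then show ?thesis
        by (intro exI[of _ 0] bexI[of _ 0]) auto
    qed (use less.hyps HR in blast)
    then obtain k S T where *: "S \<in> poly_over R" "T \<in> poly_over R"
        "smult (lead_coeff G ^ k) H = G * S + T" "T = 0 \<or> degree T < degree G"
      by blast
    let ?S = "S + smult (lead_coeff G ^ k) (monom ?c ?n)"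
    have "smult (lead_coeff G ^ Suc k) F = smult (lead_coeff G ^ k) (H + monom ?c ?n * G)"
      by (simp add: H_def mult.commute)
    also have "\<dots> = G * ?S + T"
      by (simp add: smult_add_right *(3) algebra_simps)
    finally have "smult (lead_coeff G ^ Suc k) F = G * ?S + T" .
    moreover have "?S \<in> poly_over R"
      by (intro PR.add_closed smult_closed monom_closed power_closed coeff_closed less.prems G *(1))
    ultimately show ?thesis using *(2,4) by blast
  qed
qed

lemma monic_division:
  assumes "G \<in> poly_over R" "lead_coeff G = 1" "F \<in> poly_over R"
  shows "\<exists>S\<in>poly_over R. \<exists>T\<in>poly_over R. F = G * S + T \<and> (T = 0 \<or> degree T < degree G)"
proof -
  have "G \<noteq> 0" using assms(2) by auto
  from monic_pseudo_division[OF assms(1) this assms(3)] show ?thesis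
    by (auto simp: assms(2))
qed

end

lemma monic_mult_left_cancel:
  fixes G :: "'a::idom poly"
  assumes "lead_coeff G = 1"
  shows "degree (G * Q) = degree G + degree Q \<or> Q = 0" "lead_coeff (G * Q) = lead_coeff Q"
proof -
  have *: "coeff (G * Q) (degree G + degree Q) = lead_coeff Q"
    using assms by (simp add: coeff_mult_degree_sum)
  show "degree (G * Q) = degree G + degree Q \<or> Q = 0"
    using * degree_mult_le[of G Q] by (metis le_antisym le_degree leading_coeff_0_iff)
  then show "lead_coeff (G * Q) = lead_coeff Q" using * by auto
qed

text \<open>\<open>Q\<close> is a quotient in the whole domain. Division inside \<open>R\<close>
  leaves the remainder \<open>G * (Q - S)\<close>, and since \<open>G\<close> is monic this has
  degree below that of \<open>G\<close> only if \<open>Q = S\<close>.\<close>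

lemma (in unital_subring) monic_quotient_closed:
  assumes "G \<in> poly_over R" "lead_coeff G = 1" "G * Q \<in> poly_over R"
  shows "Q \<in> poly_over R"
proof -
  obtain S T where *: "S \<in> poly_over R" "G * Q = G * S + T" "T = 0 \<or> degree T < degree G"
    using monic_division[OF assms] by blast
  have "G * (Q - S) = T" using *(2) by (simp add: algebra_simps)
  then have "Q - S = 0" using *(3) monic_mult_left_cancel[OF assms(2), of "Q - S"]
    by (metis leD le_add1 leading_coeff_0_iff)
  then show ?thesis using *(1) by simp
qed

text \<open>A greatest common divisor over the fraction field, with all denominators cleared.\<close>

lemma pseudo_gcd:
  fixes R :: "'a::idom set"
  assumes "unital_subring R" "P \<in> poly_over R" "Q \<in> poly_over R" "P \<noteq> 0"
  shows "\<exists>D\<in>poly_over R. \<exists>U\<in>poly_over R. \<exists>W\<in>poly_over R. \<exists>M\<in>poly_over R. \<exists>N\<in>poly_over R. \<exists>s\<in>R.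
    s \<noteq> 0 \<and> D = U * P + W * Q \<and> smult s P = D * M \<and> smult s Q = D * N"
proof -
  interpret unital_subring R by fact
  interpret PR: unital_subring "poly_over R" by (rule unital_subring_poly_over)
  show ?thesis using assms(2-4)
  \<comment> \<open>The measure puts 0 below the nonzero constants, which still need one step to
    reach the remainder 0.\<close>
  proof (induction "if Q = 0 then 0 else Suc (degree Q)" arbitrary: P Q rule: less_induct)
    case (less Q P)
    have prems: "P \<in> poly_over R" "Q \<in> poly_over R" "P \<noteq> 0" using less.prems by auto
    show ?case
    proof (cases "Q = 0")
      case True
      show ?thesis
        apply (rule bexI[of _ P], rule bexI[of _ 1], rule bexI[of _ 0], rule bexI[of _ 1], rule bexI[of _ 0], rule bexI[of _ 1])
        using True prems by auto
    next
      case False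
      obtain k S T where *: "S \<in> poly_over R" "T \<in> poly_over R"
        "smult (lead_coeff Q ^ k) P = Q * S + T" "T = 0 \<or> degree T < degree Q"
        using monic_pseudo_division[OF prems(2) False prems(1)] by blast
      let ?l = "lead_coeff Q ^ k"
      have l: "?l \<noteq> 0" "?l \<in> R" using False prems by auto
      have lt: "(if T = 0 then 0 else Suc (degree T)) < (if Q = 0 then 0 else Suc (degree Q))"
        using False *(4) by auto
      obtain D U W M N s where IH: "D \<in> poly_over R" "U \<in> poly_over R" "W \<in> poly_over R"
        "M \<in> poly_over R" "N \<in> poly_over R" "s \<in> R" "s \<noteq> 0" "D = U * Q + W * T"
        "smult s Q = D * M" "smult s T = D * N"
        using less.hyps[OF lt prems(2) *(2) False] by (elim bexE conjE) (rule that; assumption)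
      have "smult (s * ?l) P = smult s Q * S + smult s T"
        using *(3) by (metis mult_smult_left smult_add_right smult_smult)
      then have 1: "smult (s * ?l) P = D * (M * S + N)"
        by (simp add: IH(9,10) algebra_simps)
      have 2: "smult (s * ?l) Q = D * smult ?l M"
        by (metis IH(9) mult.commute mult_smult_right smult_smult)
      have 3: "D = smult ?l W * P + (U - W * S) * Q"
      proof -
        have T: "T = smult ?l P - Q * S" using *(3) by (simp add: algebra_simps)
        show ?thesis unfolding IH(8) T by (simp add: algebra_simps)
      qed
      show ?thesis
        apply (rule bexI[of _ D], rule bexI[of _ "smult ?l W"], rule bexI[of _ "U - W * S"],
            rule bexI[of _ "M * S + N"], rule bexI[of _ "smult ?l M"], rule bexI[of _ "s * ?l"])
        subgoal using 1 2 3 l(1) IH(7) by (intro conjI) simp_all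
        subgoal using IH(6) l(2) by (rule mult_closed)
        subgoal using l(2) IH(4) by (rule smult_closed)
        subgoal using PR.add_closed[OF PR.mult_closed[OF IH(4) *(1)] IH(5)] .
        subgoal using PR.diff_closed[OF IH(2) PR.mult_closed[OF IH(3) *(1)]] .
        subgoal using smult_closed[OF l(2) IH(3)] .
        subgoal using IH(1) .
        done
    qed
  qed
qed

text \<open>The values of \<open>h\<close> outside \<open>R\<close> are arbitrary: the value of a
  fraction under a specialization is given by a description that means something only where the
  fraction is defined.\<close>

locale partial_hom = unital_subring R for R :: "'a::idom set" +
  fixes h :: "'a \<Rightarrow> 'b::idom"
  assumes hom_add: "a \<in> R \<Longrightarrow> b \<in> R \<Longrightarrow> h (a + b) = h a + h b"
    and hom_mult: "a \<in> R \<Longrightarrow> b \<in> R \<Longrightarrow> h (a * b) = h a * h b"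
    and hom_one [simp]: "h 1 = 1"
begin

lemma hom_zero [simp]: "h 0 = 0"
proof -
  have "h 0 + h 0 = h 0" using hom_add[of 0 0] by (simp del: add_0_right)
  then show ?thesis by (metis add_cancel_left_left)
qed

lemma hom_uminus: "a \<in> R \<Longrightarrow> h (- a) = - h a"
  using hom_add[of a "- a"] by (simp add: uminus_closed eq_neg_iff_add_eq_0 add.commute)

lemma hom_diff: "a \<in> R \<Longrightarrow> b \<in> R \<Longrightarrow> h (a - b) = h a - h b"
  using hom_add[of a "- b"] by (simp add: hom_uminus uminus_closed)

lemma hom_sum: "(\<And>i. i \<in> I \<Longrightarrow> f i \<in> R) \<Longrightarrow> h (sum f I) = (\<Sum>i\<in>I. h (f i))"
  by (induction I rule: infinite_finite_induct) (auto simp: hom_add sum_closed)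

lemma hom_prod: "(\<And>i. i \<in> I \<Longrightarrow> f i \<in> R) \<Longrightarrow> h (prod f I) = (\<Prod>i\<in>I. h (f i))"
  by (induction I rule: infinite_finite_induct) (auto simp: hom_mult prod_closed)

lemma hom_power: "a \<in> R \<Longrightarrow> h (a ^ n) = h a ^ n"
  by (induction n) (auto simp: hom_mult power_closed)

lemma hom_of_nat: "h (of_nat n) = of_nat n"
  by (induction n) (auto simp: hom_add)

lemma hom_of_int: "h (of_int n) = of_int n"
proof (cases n rule: int_cases)
  case (neg m)
  then show ?thesis
    by (metis hom_uminus hom_of_nat of_int_minus of_int_of_nat_eq of_nat_closed)
qed (simp add: hom_of_nat)

lemma coeff_map [simp]: "coeff (map_poly h p) i = h (coeff p i)"
  by (simp add: coeff_map_poly)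

lemma map_poly_add: "p \<in> poly_over R \<Longrightarrow> q \<in> poly_over R \<Longrightarrow> map_poly h (p + q) = map_poly h p + map_poly h q"
  by (rule poly_eqI) (simp add: hom_add coeff_closed)

lemma map_poly_mult: "p \<in> poly_over R \<Longrightarrow> q \<in> poly_over R \<Longrightarrow> map_poly h (p * q) = map_poly h p * map_poly h q"
  by (rule poly_eqI) (simp add: coeff_mult hom_sum hom_mult coeff_closed mult_closed)

lemma map_poly_one: "map_poly h 1 = 1"
  by (rule poly_eqI) (simp add: coeff_1)

lemma partial_hom_map_poly: "partial_hom (poly_over R) (map_poly h)"
proof -
  interpret PR: unital_subring "poly_over R" by (rule unital_subring_poly_over)
  show ?thesis by standard (auto simp: map_poly_add map_poly_mult map_poly_one)
qed

lemma map_poly_pderiv: "p \<in> poly_over R \<Longrightarrow> map_poly h (pderiv p) = pderiv (map_poly h p)"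
  by (rule poly_eqI) (simp add: coeff_pderiv hom_mult hom_of_nat coeff_closed flip: of_nat_Suc)

lemma map_poly_smult: "a \<in> R \<Longrightarrow> p \<in> poly_over R \<Longrightarrow> map_poly h (smult a p) = smult (h a) (map_poly h p)"
  by (rule poly_eqI) (simp add: hom_mult coeff_closed)

lemma monic_map_poly:
  assumes "lead_coeff p = 1"
  shows "degree (map_poly h p) = degree p" "lead_coeff (map_poly h p) = 1"
proof -
  have "coeff (map_poly h p) (degree p) = 1" using assms by simp
  then show "degree (map_poly h p) = degree p"
    by (metis coeff_map degree_map_poly_le le_antisym le_degree one_neq_zero)
  then show "lead_coeff (map_poly h p) = 1" using assms by simp
qed

lemma poly_map_poly:
  assumes "p \<in> poly_over R" "x \<in> R"
  shows "poly (map_poly h p) (h x) = h (poly p x)"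
proof -
  have "poly (map_poly h p) (h x) = (\<Sum>i\<le>degree p. h (coeff p i) * h x ^ i)"
    by (rule poly_as_sum_of_monoms'[where p = "map_poly h p" and n = "degree p",
          THEN arg_cong[where f = "\<lambda>q. poly q (h x)"], symmetric, THEN trans])
       (simp_all add: degree_map_poly_le poly_sum poly_monom)
  also have "\<dots> = h (poly p x)"
    using assms by (subst poly_altdef, subst hom_sum) (auto simp: hom_mult hom_power coeff_closed power_closed)
  finally show ?thesis .
qed

lemma hom_det:
  assumes "M \<in> carrier_mat n n" "\<And>i j. i < n \<Longrightarrow> j < n \<Longrightarrow> M $$ (i, j) \<in> R"
  shows "det (map_mat h M) = h (det M)"
proof -
  have mem: "(\<Prod>i = 0..<n. M $$ (i, p i)) \<in> R" if "p permutes {0..<n}" for p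
    by (rule prod_closed) (use that assms in \<open>auto simp: permutes_in_image\<close>)
  have *: "h (\<Prod>i = 0..<n. M $$ (i, p i)) = (\<Prod>i = 0..<n. h (M $$ (i, p i)))" if "p permutes {0..<n}" for p
    by (rule hom_prod) (use that assms in \<open>auto simp: permutes_in_image\<close>)
  have "det (map_mat h M) = (\<Sum>p | p permutes {0..<n}. of_int (sign p) * (\<Prod>i = 0..<n. h (M $$ (i, p i))))"
    unfolding det_def using assms(1)
    by (auto intro!: sum.cong prod.cong simp: permutes_in_image)
  also have "\<dots> = (\<Sum>p | p permutes {0..<n}. h (of_int (sign p) * (\<Prod>i = 0..<n. M $$ (i, p i))))"
    by (rule sum.cong) (auto simp: hom_mult hom_of_int mem *)
  also have "\<dots> = h (det M)"
    using assms(1) mem by (auto simp: det_def intro!: hom_sum[symmetric])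
  finally show ?thesis .
qed

text \<open>The degrees determine the size of the Sylvester matrix. If \<open>h\<close> preserves
  them, the claim is that \<open>h\<close> commutes with determinants.\<close>

lemma hom_resultant:
  assumes "p \<in> poly_over R" "q \<in> poly_over R"
    "degree (map_poly h p) = degree p" "degree (map_poly h q) = degree q"
  shows "resultant (map_poly h p) (map_poly h q) = h (resultant p q)"
proof -
  have "map_mat h (sylvester_mat p q) = sylvester_mat (map_poly h p) (map_poly h q)"
    unfolding sylvester_mat_def assms(3,4) by (rule sylvester_mat_sub_map) simp
  moreover have "det (map_mat h (sylvester_mat p q)) = h (det (sylvester_mat p q))"
    by (rule hom_det[OF sylvester_carrier_mat]) (use assms in \<open>auto simp: sylvester_index_mat\<close>)
  ultimately show ?thesis unfolding resultant_def by simp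
qed

end

lemma (in unital_subring) discriminant_closed:
  "p \<in> poly_over R \<Longrightarrow> (- 1) ^ n * resultant p (pderiv p) \<in> R"
  by (intro mult_closed power_closed uminus_closed one_closed resultant_closed pderiv_closed)

lemma discriminant_in:
  fixes R :: "'a::idom set"
  assumes "unital_subring R" "p \<in> poly_over R"
  shows "discriminant p \<in> R"
  unfolding discriminant_def using assms by (rule unital_subring.discriminant_closed)

text \<open>A monic polynomial keeps its degree under \<open>h\<close>, and in characteristic zero
  the degree of the derivative is determined by it on both sides. So the two Sylvester matrices
  correspond.\<close>

lemma discriminant_hom:
  fixes R :: "'a::{idom,ring_char_0} set" and h :: "'a \<Rightarrow> 'b::{idom,ring_char_0}"
  assumes "partial_hom R h" "p \<in> poly_over R" "lead_coeff p = 1"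
  shows "discriminant (map_poly h p) = h (discriminant p)"
proof -
  interpret partial_hom R h by fact
  have d: "degree (map_poly h p) = degree p" "lead_coeff (map_poly h p) = 1"
    using monic_map_poly[OF assms(3)] by auto
  have *: "resultant (map_poly h p) (map_poly h (pderiv p)) = h (resultant p (pderiv p))"
    by (rule hom_resultant)
      (use assms d degree_pderiv[of p] degree_pderiv[of "map_poly h p"] map_poly_pderiv[OF assms(2)] in auto)
  have m1: "- 1 \<in> R" using uminus_closed one_closed by blast
  have "h (discriminant p) = h ((- 1) ^ (degree p * (degree p - 1) div 2)) * h (resultant p (pderiv p))"
    unfolding discriminant_def using assms m1 by (intro hom_mult power_closed resultant_closed pderiv_closed) auto
  also have "h ((- 1) ^ (degree p * (degree p - 1) div 2)) = (- 1) ^ (degree p * (degree p - 1) div 2)"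
    using m1 by (simp add: hom_power hom_uminus)
  finally show ?thesis
    unfolding discriminant_def d using assms * by (simp add: map_poly_pderiv)
qed

lemma of_nat_mps: "mcoeff (of_nat n :: ('v, 'a::comm_ring_1) mps) 0 = of_nat n"
  by (induction n) (simp_all add: plus_mps_def mcoeff_one)

instance mps :: (type, "{comm_ring_1, ring_char_0}") ring_char_0
proof
  show "inj (of_nat :: nat \<Rightarrow> ('a, 'b) mps)"
    by (rule injI) (metis of_nat_mps of_nat_eq_iff)
qed

instance fract :: ("{idom, ring_char_0}") field_char_0
proof
  show "inj (of_nat :: nat \<Rightarrow> 'a fract)"
    by (rule injI) (metis of_nat_fract eq_fract(1) of_nat_eq_iff mult_1_right zero_neq_one)
qed

section \<open>The resultant as a product over roots\<close>

definition roots_poly :: "'a::comm_ring_1 multiset \<Rightarrow> 'a poly" where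
  "roots_poly A = (\<Prod>x\<in>#A. [:- x, 1:])"

lemma roots_poly_monic [simp]:
  fixes A :: "'a::idom multiset"
  shows "degree (roots_poly A) = size A" "lead_coeff (roots_poly A) = 1" "roots_poly A \<noteq> 0"
proof -
  have "degree (roots_poly A) = size A \<and> coeff (roots_poly A) (size A) = 1 \<and> roots_poly A \<noteq> 0"
  proof (induction A)
    case (add x A)
    have eq: "roots_poly (add_mset x A) = [:- x, 1:] * roots_poly A" by (simp add: roots_poly_def)
    have "degree ([:- x, 1:] * roots_poly A) = Suc (size A)"
      using add by (subst degree_mult_eq) auto
    moreover have "lead_coeff ([:- x, 1:] * roots_poly A) = 1"
      unfolding lead_coeff_mult using add by simp
    ultimately show ?case using add unfolding eq by (simp del: mult_pCons_left)
  qed (simp add: roots_poly_def)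
  then show "degree (roots_poly A) = size A" "lead_coeff (roots_poly A) = 1" "roots_poly A \<noteq> 0"
    by auto
qed

lemma poly_roots_poly: "poly (roots_poly A) y = (\<Prod>x\<in>#A. y - x)"
  by (simp add: poly_prod_mset roots_poly_def)

lemma roots_poly_eq_0_iff [simp]: "poly (roots_poly (A :: 'a::idom multiset)) y = 0 \<longleftrightarrow> y \<in># A"
  by (auto simp: poly_roots_poly prod_mset_zero_iff)

lemma prod_mset_diff_swap:
  fixes A B :: "'a::idom multiset"
  shows "(\<Prod>y\<in>#B. \<Prod>x\<in>#A. y - x) = (- 1) ^ (size A * size B) * (\<Prod>x\<in>#A. \<Prod>y\<in>#B. x - y)"
proof -
  have 1: "(\<Prod>y\<in>#B. y - x) = (- 1) ^ size B * (\<Prod>y\<in>#B. x - y)" for x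
    by (induction B) (auto simp: algebra_simps)
  have "(\<Prod>y\<in>#B. \<Prod>x\<in>#A. y - x) = (\<Prod>x\<in>#A. \<Prod>y\<in>#B. y - x)"
    by (induction A) (simp_all add: prod_mset.distrib)
  also have "\<dots> = (- 1) ^ (size A * size B) * (\<Prod>x\<in>#A. \<Prod>y\<in>#B. x - y)"
    unfolding 1 by (induction A) (simp_all add: power_add mult_ac)
  finally show ?thesis .
qed

lemma prod_mset_smult:
  "(\<Prod>x\<in>#A. poly (smult b q) x) = b ^ size A * (\<Prod>x\<in>#A. poly q x)" for b :: "'a::comm_ring_1"
  by (induction A) (auto simp: algebra_simps)

text \<open>Both sides come from \<open>a ^ size B * b ^ size A\<close> times the product of all
  differences \<open>x - y\<close>. The sign is the one that the resultant acquires when its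
  arguments are swapped.\<close>

lemma double_product_swap:
  fixes A B :: "'a::idom multiset"
  assumes "F = smult a (roots_poly A)" "G = smult b (roots_poly B)"
  shows "a ^ size B * (\<Prod>x\<in>#A. poly G x) = (- 1) ^ (size A * size B) * (b ^ size A * (\<Prod>y\<in>#B. poly F y))"
proof -
  have "a ^ size B * (\<Prod>x\<in>#A. poly G x) = a ^ size B * b ^ size A * (\<Prod>x\<in>#A. \<Prod>y\<in>#B. x - y)"
    unfolding assms(2) prod_mset_smult poly_roots_poly by simp
  also have "(\<Prod>x\<in>#A. \<Prod>y\<in>#B. x - y) = (- 1) ^ (size A * size B) * (\<Prod>y\<in>#B. \<Prod>x\<in>#A. y - x)"
    using prod_mset_diff_swap[where A = B and B = A] by (simp only: mult.commute[of "size B"])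
  also have "a ^ size B * b ^ size A * \<dots> = (- 1) ^ (size A * size B) * (b ^ size A * (a ^ size B * (\<Prod>y\<in>#B. \<Prod>x\<in>#A. y - x)))"
    by (simp add: mult_ac)
  also have "a ^ size B * (\<Prod>y\<in>#B. \<Prod>x\<in>#A. y - x) = (\<Prod>y\<in>#B. poly F y)"
    unfolding assms(1) prod_mset_smult poly_roots_poly by simp
  finally show ?thesis .
qed

text \<open>One step of Euclid's algorithm, read off from the subresultant of index 0. A constant
  \<open>H\<close> is a separate case because the index then equals the degree of \<open>H\<close>
  instead of lying below it.\<close>

lemma resultant_reduce:
  fixes F G H :: "'a::idom poly"
  assumes "F = Q * G + H" "degree G \<le> degree F" "degree H < degree G" "H \<noteq> 0"
  shows "resultant F G = (- 1) ^ (degree F * degree G) * lead_coeff G ^ (degree F - degree H) * resultant G H"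
proof -
  have eq: "F + (- Q) * G = H" using assms(1) by simp
  show ?thesis
  proof (cases "degree H = 0")
    case True
    then obtain h where h: "H = [:h:]" by (metis degree_eq_zeroE)
    have "degree G \<noteq> 0" using assms(3) by simp
    then have p: "h ^ (degree G - 1) * h = h ^ degree G"
      by (metis power_minus_mult neq0_conv)
    from BT_lemma_1_13[OF eq assms(2) disjI1[OF assms(3)] disjI1[OF assms(3)]]
    have "[:resultant F G:] = smult ((- 1) ^ (degree F * degree G) * lead_coeff G ^ degree F * h ^ (degree G - 1)) [:h:]"
      by (simp add: h subresultant_resultant)
    then show ?thesis using p by (simp add: h mult.assoc)
  next
    case False
    from BT_lemma_1_12[OF eq assms(2) disjI1[OF assms(3)], of 0] False
    show ?thesis by (simp add: subresultant_resultant)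
  qed
qed

text \<open>Induction along Euclid's algorithm. The remainder \<open>H\<close> of \<open>F\<close>
  modulo \<open>G\<close> has the same values as \<open>F\<close> at the roots of \<open>G\<close>,
  so the formula for \<open>G\<close> and \<open>H\<close> yields a product of values of
  \<open>F\<close> over the roots of \<open>G\<close>; the symmetry of the double product turns it
  into one over the roots of \<open>F\<close>. The fact \<open>step\<close> treats
  \<open>degree G \<le> degree F\<close>; otherwise the arguments are swapped.\<close>

lemma resultant_roots:
  fixes F G :: "'a::alg_closed_field poly"
  assumes "F = smult a (roots_poly A)" "a \<noteq> 0" "G \<noteq> 0"
  shows "resultant F G = a ^ degree G * (\<Prod>x\<in>#A. poly G x)"
  using assms
proof (induction "degree F + degree G" arbitrary: F G a A rule: less_induct)
  case (less F G a A)
  have step: "resultant F G = a ^ degree G * (\<Prod>x\<in>#A. poly G x)"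
    if IH: "\<And>(F' :: 'a poly) G' a A. degree F' + degree G' < degree F + degree G \<Longrightarrow> F' = smult a (roots_poly A) \<Longrightarrow>
           a \<noteq> 0 \<Longrightarrow> G' \<noteq> 0 \<Longrightarrow> resultant F' G' = a ^ degree G' * (\<Prod>x\<in>#A. poly G' x)"
      and F: "F = smult a (roots_poly A)" "a \<noteq> 0" and G0: "G \<noteq> 0" and dd: "degree G \<le> degree F"
    for F G :: "'a poly" and a A
  proof (cases "degree G = 0")
    case True
    then obtain g where "G = [:g:]" by (metis degree_eq_zeroE)
    then show ?thesis using F by (auto simp: prod_mset_constant)
  next
    case dG: False
    have szA: "degree F = size A" using F by simp
    obtain B where B: "size B = degree G" "G = smult (lead_coeff G) (roots_poly B)"
      using alg_closed_imp_factorization[OF G0, folded roots_poly_def] by blast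
    define H where "H = F mod G"
    have eq: "F = (F div G) * G + H" by (simp add: H_def)
    show ?thesis
    \<comment> \<open>If the nonconstant \<open>G\<close> divides \<open>F\<close>, its roots are
      roots of \<open>F\<close>, and both sides are 0.\<close>
    proof (cases "H = 0")
      case True
      then have eq: "F = (F div G) * G" using eq by simp
      have "B \<noteq> {#}" using B dG by auto
      then obtain y where y: "y \<in># B" by blast
      have "poly G y = 0" using y by (subst B(2)) auto
      then have "poly F y = 0" by (subst eq) simp
      then have "y \<in># A" using F by auto
      then have "(\<Prod>x\<in>#A. poly G x) = 0" using \<open>poly G y = 0\<close> by (auto simp: prod_mset_zero_iff)
      moreover have "subresultant 0 F G = 0"
        using subresultant_product[OF eq dd, of 0] dG by simp
      ultimately show ?thesis by (simp add: subresultant_resultant)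
    next
      case False
      have dH: "degree H < degree G" using degree_mod_less[OF G0, of F] False by (simp add: H_def)
      have "resultant G H = lead_coeff G ^ degree H * (\<Prod>x\<in>#B. poly H x)"
        using IH[of G H "lead_coeff G" B] dH dd B False G0 by simp
      also have "(\<Prod>x\<in>#B. poly H x) = (\<Prod>x\<in>#B. poly F x)"
      proof -
        have "poly H x = poly F x" if "x \<in># B" for x
        proof -
          have "poly G x = 0" using that by (subst B(2)) auto
          then show ?thesis by (subst eq) simp
        qed
        then show ?thesis by (intro arg_cong[where f = prod_mset] image_mset_cong) auto
      qed
      finally have "resultant F G = (- 1) ^ (degree F * degree G) *
          (lead_coeff G ^ (degree F - degree H) * lead_coeff G ^ degree H) * (\<Prod>x\<in>#B. poly F x)"
        using resultant_reduce[OF eq dd dH False] by simp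
      also have "lead_coeff G ^ (degree F - degree H) * lead_coeff G ^ degree H = lead_coeff G ^ degree F"
        using dH dd by (simp flip: power_add)
      finally show ?thesis
        using double_product_swap[OF F(1) B(2)] szA B(1) by (simp add: mult.assoc)
    qed
  qed
  show ?case
  proof (cases "degree G \<le> degree F")
    case True
    show ?thesis by (rule step) (use less True in auto)
  next
    case False
    obtain B where B: "size B = degree G" "G = smult (lead_coeff G) (roots_poly B)"
      using alg_closed_imp_factorization[OF less.prems(3), folded roots_poly_def] by blast
    have szA: "degree F = size A" using less.prems by simp
    have "F \<noteq> 0" using less.prems by auto
    have "resultant G F = lead_coeff G ^ degree F * (\<Prod>x\<in>#B. poly F x)"
      by (rule step) (use less B \<open>F \<noteq> 0\<close> False in \<open>auto simp: add.commute\<close>)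
    then show ?thesis
      using double_product_swap[OF less.prems(1) B(2)] szA B(1)
      by (simp add: resultant_swap[of F G] mult.assoc)
  qed
qed

lemma resultant_monic_roots:
  fixes G :: "'a::alg_closed_field poly"
  shows "resultant (roots_poly A) G = (\<Prod>x\<in>#A. poly G x)"
proof (cases "G = 0")
  case True
  have "(\<Prod>x\<in>#A. poly 0 x) = (0 :: 'a) ^ size A" by (induction A) auto
  then show ?thesis using True resultant_const(2)[of "roots_poly A" 0] by simp
next
  case False
  then show ?thesis using resultant_roots[of "roots_poly A" 1 A G] by simp
qed

lemma monic_eq_roots_poly:
  fixes F :: "'a::alg_closed_field poly"
  assumes "lead_coeff F = 1"
  obtains A where "F = roots_poly A" "\<And>x. poly F x = 0 \<longleftrightarrow> x \<in># A"
proof -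
  have "F \<noteq> 0" using assms by auto
  from alg_closed_imp_factorization[OF this, folded roots_poly_def] assms obtain A where A: "F = roots_poly A" by auto
  then show ?thesis using that by auto
qed

section \<open>Product rules for resultants and discriminants\<close>

lemma resultant_mult_left:
  fixes F G H :: "'a::alg_closed_field poly"
  assumes "lead_coeff F = 1" "lead_coeff G = 1"
  shows "resultant (F * G) H = resultant F H * resultant G H"
proof -
  obtain A B where AB: "F = roots_poly A" "G = roots_poly B"
    using assms monic_eq_roots_poly by metis
  have "F * G = roots_poly (A + B)" by (simp add: AB roots_poly_def)
  then show ?thesis by (simp only: resultant_monic_roots AB) simp
qed

text \<open>Only the values of the second argument at the roots of \<open>F\<close> count, and there
  the multiple of \<open>F\<close> disappears.\<close>

lemma resultant_monic_cong:
  fixes F G H :: "'a::alg_closed_field poly"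
  assumes "lead_coeff F = 1"
  shows "resultant F (F * Q + G * H) = resultant F G * resultant F H"
proof -
  obtain A where A: "F = roots_poly A" "\<And>x. poly F x = 0 \<longleftrightarrow> x \<in># A"
    using assms monic_eq_roots_poly by metis
  have "(\<Prod>x\<in>#A. poly (F * Q + G * H) x) = (\<Prod>x\<in>#A. poly G x * poly H x)"
    using A(2) by (intro arg_cong[where f = prod_mset] image_mset_cong) auto
  then show ?thesis by (simp only: A(1) resultant_monic_roots prod_mset.distrib)
qed

text \<open>At the roots of \<open>F\<close> the derivative of \<open>F * G\<close> is that of
  \<open>F\<close> times \<open>G\<close>. Up to signs this says that the discriminant of a product
  is the product of the discriminants and the square of the resultant.\<close>

lemma resultant_pderiv_mult:
  fixes F G :: "'a::alg_closed_field poly"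
  assumes "lead_coeff F = 1" "lead_coeff G = 1"
  shows "resultant (F * G) (pderiv (F * G)) =
    resultant F (pderiv F) * resultant G (pderiv G) * (resultant F G * resultant G F)"
proof -
  have "resultant F (pderiv (F * G)) = resultant F (pderiv F) * resultant F G"
    using resultant_monic_cong[OF assms(1), of "pderiv G" "pderiv F" G]
    by (simp add: pderiv_mult mult.commute)
  moreover have "resultant G (pderiv (F * G)) = resultant G (pderiv G) * resultant G F"
    using resultant_monic_cong[OF assms(2), of "pderiv F" "pderiv G" F]
    by (simp add: pderiv_mult mult.commute add.commute)
  ultimately show ?thesis by (simp add: resultant_mult_left[OF assms])
qed

lemma resultant_pderiv_nonzero_iff:
  fixes F :: "'a::{alg_closed_field, field_char_0} poly"
  assumes "lead_coeff F = 1"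
  shows "resultant F (pderiv F) \<noteq> 0 \<longleftrightarrow> rsquarefree F"
proof -
  obtain A where A: "F = roots_poly A" "\<And>x. poly F x = 0 \<longleftrightarrow> x \<in># A"
    using assms monic_eq_roots_poly by metis
  have "resultant F (pderiv F) = (\<Prod>x\<in>#A. poly (pderiv F) x)"
    by (subst (1) A(1), rule resultant_monic_roots)
  then show ?thesis
    using A(2) unfolding rsquarefree_roots by (auto simp: prod_mset_zero_iff)
qed

section \<open>Divisibility tested on roots\<close>

lemma dvd_if_order_le:
  fixes F G :: "'a::alg_closed_field poly"
  assumes "F \<noteq> 0" "G \<noteq> 0" "\<And>x. order x F \<le> order x G"
  shows "F dvd G"
  using assms
proof (induction "degree F" arbitrary: F G rule: less_induct)
  case less
  show ?case
  proof (cases "degree F = 0")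
    case True
    then show ?thesis using less.prems(1) by (metis degree_eq_zeroE is_unit_pCons_iff unit_imp_dvd pCons_0_0)
  next
    case False
    then obtain x where "poly F x = 0" using alg_closed_imp_poly_has_root by blast
    then have o: "order x F \<ge> 1" using less.prems by (metis One_nat_def Suc_leI neq0_conv order_root)
    then have "order x G \<ge> 1" using less.prems(3)[of x] by simp
    then have "[:- x, 1:] ^ 1 dvd F" "[:- x, 1:] ^ 1 dvd G" using o order_divides by blast+
    then obtain F' G' where F': "F = [:- x, 1:] * F'" and G': "G = [:- x, 1:] * G'"
      by (auto simp: dvd_def simp del: mult_pCons_left)
    have nz: "F' \<noteq> 0" "G' \<noteq> 0" using F' G' less.prems by auto
    have "order y F = order y [:- x, 1:] + order y F'" "order y G = order y [:- x, 1:] + order y G'" for y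
      using less.prems unfolding F' G' by (metis order_mult)+
    then have "order y F' \<le> order y G'" for y
      using less.prems(3)[of y] by simp
    moreover have "degree F' < degree F" unfolding F' using nz by (simp add: degree_mult_eq del: mult_pCons_left)
    ultimately have "F' dvd G'" using less.hyps nz by blast
    then show ?thesis unfolding F' G' by (rule mult_dvd_mono[OF dvd_refl])
  qed
qed

lemma rsquarefree_dvd:
  fixes F G :: "'a::{alg_closed_field, field_char_0} poly"
  assumes "rsquarefree F" "\<And>x. poly F x = 0 \<Longrightarrow> poly G x = 0"
  shows "F dvd G"
proof (cases "G = 0")
  case False
  have F0: "F \<noteq> 0" using assms(1) by (simp add: rsquarefree_def)
  show ?thesis
  proof (rule dvd_if_order_le[OF F0 False])
    fix x
    show "order x F \<le> order x G"
      using assms False F0 unfolding rsquarefree_def by (metis le0 One_nat_def Suc_leI neq0_conv order_root)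
  qed
qed simp

text \<open>The exponent \<open>degree F\<close> bounds the multiplicity of every root of
  \<open>F\<close>.\<close>

lemma dvd_power_if_roots:
  fixes F G :: "'a::alg_closed_field poly"
  assumes "F \<noteq> 0" "G \<noteq> 0" "\<And>x. poly F x = 0 \<Longrightarrow> poly G x = 0"
  shows "F dvd G ^ degree F"
proof (rule dvd_if_order_le[OF assms(1)])
  show "G ^ degree F \<noteq> 0" using assms by simp
  fix x
  show "order x F \<le> order x (G ^ degree F)"
  proof (cases "poly F x = 0")
    case True
    then have "1 \<le> order x G" using assms by (metis One_nat_def Suc_leI neq0_conv order_root)
    then have "[:- x, 1:] dvd G" using order_divides[of x 1 G] by simp
    then have "[:- x, 1:] ^ degree F dvd G ^ degree F" by (rule dvd_power_same)
    then have "degree F \<le> order x (G ^ degree F)" using order_divides assms by (metis power_not_zero)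
    then show ?thesis using order_degree[OF assms(1), of x] by simp
  qed (simp add: order_root)
qed

section \<open>Embedding a domain into an algebraically closed field\<close>

text \<open>The product formula for resultants and the description of squarefree polynomials by
  their roots need an algebraically closed field. Injectivity brings equations, and divisibility by
  monic polynomials, back to the domain.\<close>

definition closure_embedding :: "'a::idom \<Rightarrow> 'a fract alg_closure" where
  "closure_embedding x = to_ac (to_fract x)"

lemma closure_embedding_eq_iff [simp]: "closure_embedding x = closure_embedding y \<longleftrightarrow> x = y"
  by (simp add: closure_embedding_def)

interpretation emb: inj_idom_hom closure_embedding
  by standard (simp_all add: closure_embedding_def)

section \<open>Radicals of monic polynomials\<close>

abbreviation emb_poly :: "'a::idom poly \<Rightarrow> 'a fract alg_closure poly" where
  "emb_poly \<equiv> map_poly closure_embedding"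

interpretation embp: map_poly_inj_idom_hom closure_embedding ..

lemma closure_embedding_of_nat [simp]: "closure_embedding (of_nat a) = of_nat a"
  by (induction a) (simp_all add: emb.hom_add)

lemmas emb_poly_simps = embp.hom_add embp.hom_mult embp.hom_power emb.map_poly_hom_smult emb.map_poly_pderiv

lemma emb_poly_monic: "lead_coeff p = 1 \<Longrightarrow> lead_coeff (emb_poly p) = 1"
  by simp

lemma monic_mult_monic:
  fixes G :: "'a::idom poly"
  assumes "lead_coeff G = 1" "lead_coeff (G * H) = 1"
  shows "lead_coeff H = 1"
  using assms by (simp add: lead_coeff_mult)

text \<open>Division by the monic \<open>G\<close> takes place in the domain. The embedding
  preserves the degree of the remainder, so the remainder is 0 as soon as the image of
  \<open>G\<close> divides its image.\<close>

lemma emb_poly_dvd_iff: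
  assumes "lead_coeff G = 1"
  shows "emb_poly G dvd emb_poly F \<longleftrightarrow> G dvd F"
proof
  assume dvd: "emb_poly G dvd emb_poly F"
  interpret U: unital_subring "UNIV :: 'a set" by standard auto
  have UN: "p \<in> poly_over UNIV" for p :: "'a poly" by (simp add: poly_over_def)
  obtain S T where *: "F = G * S + T" "T = 0 \<or> degree T < degree G"
    using U.monic_division[OF UN assms UN, of F] by blast
  have "emb_poly F = emb_poly G * emb_poly S + emb_poly T"
    by (simp add: *(1) emb_poly_simps)
  then have "emb_poly G dvd emb_poly T" using dvd by (metis dvd_add_right_iff dvd_triv_left)
  have "T = 0"
  proof (rule ccontr)
    assume "T \<noteq> 0"
    then have "degree (emb_poly G) \<le> degree (emb_poly T)"
      using \<open>emb_poly G dvd emb_poly T\<close> by (intro dvd_imp_degree_le) auto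
    then show False using *(2) \<open>T \<noteq> 0\<close> by simp
  qed
  then show "G dvd F" using *(1) by simp
next
  assume "G dvd F" then show "emb_poly G dvd emb_poly F" by (rule embp.hom_dvd)
qed

lemma discriminant_nonzero_iff:
  fixes G :: "'a::{idom,ring_char_0} poly"
  assumes "lead_coeff G = 1"
  shows "discriminant G \<noteq> 0 \<longleftrightarrow> rsquarefree (emb_poly G)"
proof -
  have "resultant (emb_poly G) (pderiv (emb_poly G)) = closure_embedding (resultant G (pderiv G))"
    by (simp add: emb.resultant_hom flip: emb.map_poly_pderiv)
  then have "resultant G (pderiv G) \<noteq> 0 \<longleftrightarrow> rsquarefree (emb_poly G)"
    using resultant_pderiv_nonzero_iff[OF emb_poly_monic[OF assms]]
    by (metis closure_embedding_eq_iff emb.hom_zero)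
  then show ?thesis by (simp add: discriminant_def)
qed

text \<open>A counterpart of \<open>reduced_of\<close> that mentions no coefficient ring, so that
  radicals over different rings can be compared and carried along homomorphisms. The discriminant
  expresses that \<open>G\<close> is squarefree, the two divisibilities that \<open>P\<close> and
  \<open>G\<close> have the same roots.\<close>

definition monic_radical :: "'a::idom poly \<Rightarrow> 'a poly \<Rightarrow> bool" where
  "monic_radical P G \<longleftrightarrow> lead_coeff G = 1 \<and> discriminant G \<noteq> 0 \<and> G dvd P \<and> (\<exists>n. P dvd G ^ n)"

lemma monic_radicalD:
  fixes P G :: "'a::{idom,ring_char_0} poly"
  assumes "monic_radical P G"
  shows "rsquarefree (emb_poly G)" "poly (emb_poly G) x = 0 \<longleftrightarrow> poly (emb_poly P) x = 0"
proof -
  show "rsquarefree (emb_poly G)"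
    using assms discriminant_nonzero_iff by (auto simp: monic_radical_def)
  obtain n where "G dvd P" "P dvd G ^ n" using assms by (auto simp: monic_radical_def)
  obtain A where A: "P = G * A" using \<open>G dvd P\<close> by (rule dvdE)
  obtain B where B: "G ^ n = P * B" using \<open>P dvd G ^ n\<close> by (rule dvdE)
  have 1: "poly (emb_poly P) x = poly (emb_poly G) x * poly (emb_poly A) x"
    unfolding A embp.hom_mult by simp
  have "poly (emb_poly (G ^ n)) x = poly (emb_poly P) x * poly (emb_poly B) x"
    unfolding B embp.hom_mult by simp
  then have 2: "poly (emb_poly G) x ^ n = poly (emb_poly P) x * poly (emb_poly B) x"
    by (simp add: embp.hom_power)
  show "poly (emb_poly G) x = 0 \<longleftrightarrow> poly (emb_poly P) x = 0"
  proof
    assume "poly (emb_poly P) x = 0"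
    then have "poly (emb_poly G) x ^ n = 0" using 2 by simp
    then show "poly (emb_poly G) x = 0" by (simp only: power_eq_0_iff)
  qed (simp add: 1)
qed

text \<open>The roots of \<open>P\<close> are roots of \<open>H\<close>. The roots of
  \<open>G\<close> are the same and simple, so \<open>G\<close> divides \<open>H\<close> over the
  closure and hence over the domain.\<close>

lemma monic_radical_dvd:
  fixes P G :: "'a::{idom,ring_char_0} poly"
  assumes "monic_radical P G" "P dvd H ^ n"
  shows "G dvd H"
proof -
  have "emb_poly P dvd emb_poly H ^ n" using embp.hom_dvd[OF assms(2)] by (simp only: embp.hom_power)
  then obtain k where k: "emb_poly H ^ n = emb_poly P * k" by (rule dvdE)
  have "poly (emb_poly H) x = 0" if "poly (emb_poly P) x = 0" for x
  proof -
    have "poly (emb_poly H) x ^ n = 0" using arg_cong[OF k, of "\<lambda>p. poly p x"] that by simp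
    then show ?thesis by (simp only: power_eq_0_iff)
  qed
  then have "emb_poly G dvd emb_poly H"
    using monic_radicalD[OF assms(1)] by (intro rsquarefree_dvd) auto
  then show ?thesis using emb_poly_dvd_iff assms(1) by (auto simp: monic_radical_def)
qed

lemma monic_radical_unique:
  fixes P :: "'a::{idom,ring_char_0} poly"
  assumes "monic_radical P G" "monic_radical P H"
  shows "G = H"
proof -
  have "G dvd H" "H dvd G"
    using assms monic_radical_dvd unfolding monic_radical_def by metis+
  moreover have m: "lead_coeff G = 1" "lead_coeff H = 1" using assms by (auto simp: monic_radical_def)
  ultimately have d: "degree G = degree H"
    by (intro le_antisym dvd_imp_degree_le) auto
  obtain A where A: "H = G * A" using \<open>G dvd H\<close> by (rule dvdE)
  have "A \<noteq> 0" "G \<noteq> 0" using A m by auto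
  then have "degree A = 0" using d A by (simp add: degree_mult_eq)
  then obtain a where a: "A = [:a:]" by (rule degree_eq_zeroE)
  have "lead_coeff A = 1" using monic_mult_monic[OF m(1)] m(2) A by blast
  then show ?thesis using A a by simp
qed

lemma monic_radical_one: "monic_radical 1 (1 :: 'a::idom poly)"
  by (auto simp: monic_radical_def discriminant_def)

lemma monic_dvd_one:
  assumes "lead_coeff (G :: 'a::idom poly) = 1" "G dvd 1"
  shows "G = 1"
  using assms by (auto simp: is_unit_poly_iff)

lemma reduced_of_if_monic_radical:
  fixes R :: "'a::{idom,ring_char_0} set"
  assumes "unital_subring R" "P \<in> poly_over R" "lead_coeff P = 1" "G \<in> poly_over R" "monic_radical P G"
  shows "reduced_of R P G"
proof -
  interpret unital_subring R by fact
  interpret PR: unital_subring "poly_over R" by (rule unital_subring_poly_over)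
  have G1: "lead_coeff G = 1" using assms(5) by (simp add: monic_radical_def)
  obtain n where n: "P dvd G ^ n" using assms(5) by (auto simp: monic_radical_def)
  have "(\<exists>Q\<in>poly_over R. H = G * Q) \<longleftrightarrow> (\<exists>n. \<exists>Q\<in>poly_over R. H ^ n = P * Q)" if H: "H \<in> poly_over R" for H
  proof
    assume "\<exists>Q\<in>poly_over R. H = G * Q"
    then have "P dvd H ^ n" using n by (auto simp: power_mult_distrib)
    then obtain Q where Q: "H ^ n = P * Q" by (auto simp: dvd_def)
    moreover have "Q \<in> poly_over R"
      using monic_quotient_closed[OF assms(2,3), of Q] PR.power_closed[OF H, of n] Q by simp
    ultimately show "\<exists>n. \<exists>Q\<in>poly_over R. H ^ n = P * Q" by blast
  next
    assume "\<exists>n. \<exists>Q\<in>poly_over R. H ^ n = P * Q"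
    then have "G dvd H" using monic_radical_dvd[OF assms(5)] by (metis dvd_triv_left)
    then obtain Q where Q: "H = G * Q" by (auto simp: dvd_def)
    moreover have "Q \<in> poly_over R"
      using monic_quotient_closed[OF assms(4) G1, of Q] H Q by simp
    ultimately show "\<exists>Q\<in>poly_over R. H = G * Q" by blast
  qed
  then show ?thesis unfolding reduced_of_def using assms(4) G1 by blast
qed

text \<open>The defining property of \<open>G\<close>, applied to \<open>G\<close> itself and to
  \<open>P\<close>, gives the two divisibilities. In a system of pseudopolynomials the discriminant
  is nonzero because it divides a monic member.\<close>

lemma monic_radical_if_reduced_of:
  fixes R :: "'a::{idom,ring_char_0} set"
  assumes "unital_subring R" "P \<in> poly_over R" "reduced_of R P G" "discriminant G \<noteq> 0"
  shows "monic_radical P G" "G \<in> poly_over R"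
proof -
  interpret unital_subring R by fact
  interpret PR: unital_subring "poly_over R" by (rule unital_subring_poly_over)
  have *: "G \<in> poly_over R" "lead_coeff G = 1"
    "\<And>H. H \<in> poly_over R \<Longrightarrow> (\<exists>Q\<in>poly_over R. H = G * Q) \<longleftrightarrow> (\<exists>n. \<exists>Q\<in>poly_over R. H ^ n = P * Q)"
    using assms(3) unfolding reduced_of_def by blast+
  show "G \<in> poly_over R" by fact
  have "G = G * 1" by simp
  then have "\<exists>n. P dvd G ^ n" using *(3)[OF *(1)] PR.one_closed by (metis dvd_triv_left)
  moreover have "P ^ 1 = P * 1" by simp
  then have "G dvd P" using *(3)[OF assms(2)] PR.one_closed by (metis dvd_triv_left)
  ultimately show "monic_radical P G" using assms(4) *(2) by (simp add: monic_radical_def)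
qed

text \<open>By the product rule the cofactor is built from resultants of \<open>G'\<close>,
  \<open>H\<close> and the derivative of \<open>H\<close>; it lies in \<open>R\<close> since
  \<open>H\<close>, a quotient by a monic polynomial, has coefficients there. The signs in front of
  the resultants are moved into the cofactor.\<close>

lemma discriminant_dvd:
  fixes R :: "'a::{idom,ring_char_0} set"
  assumes "unital_subring R" "G \<in> poly_over R" "G' \<in> poly_over R"
    "lead_coeff G = 1" "lead_coeff G' = 1" "G' dvd G"
  shows "\<exists>h\<in>R. discriminant G = discriminant G' * h"
proof -
  interpret unital_subring R by fact
  obtain H where H: "G = G' * H" using assms(6) by (auto simp: dvd_def)
  have HR: "H \<in> poly_over R" using monic_quotient_closed[OF assms(3,5), of H] assms(2) H by simp
  have H1: "lead_coeff H = 1" using monic_mult_monic[OF assms(5)] assms(4) H by simp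
  have "closure_embedding (resultant (G' * H) (pderiv (G' * H))) =
    closure_embedding (resultant G' (pderiv G') * resultant H (pderiv H) * (resultant G' H * resultant H G'))"
    using resultant_pderiv_mult[OF emb_poly_monic[OF assms(5)] emb_poly_monic[OF H1]]
    by (simp add: emb.resultant_hom emb.hom_mult flip: emb.map_poly_pderiv embp.hom_mult)
  then have res: "resultant G (pderiv G) = resultant G' (pderiv G') * (resultant H (pderiv H) * (resultant G' H * resultant H G'))"
    unfolding closure_embedding_eq_iff H by (simp add: mult.assoc)
  define a b where "a = degree G * (degree G - 1) div 2" and "b = degree G' * (degree G' - 1) div 2"
  let ?h = "(- 1) ^ a * (- 1) ^ b * (resultant H (pderiv H) * (resultant G' H * resultant H G'))"
  have b: "(- 1) ^ b * (- 1) ^ b = (1 :: 'a)" by (simp flip: power_mult_distrib)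
  have "(- 1) ^ b * x * ((- 1) ^ a * (- 1) ^ b * y) = ((- 1) ^ b * (- 1) ^ b) * ((- 1) ^ a * (x * y))" for x y :: 'a
    by (simp only: mult_ac)
  then have "discriminant G = discriminant G' * ?h"
    unfolding discriminant_def a_def[symmetric] b_def[symmetric] res b by simp
  moreover have "?h \<in> R"
    by (intro mult_closed power_closed uminus_closed one_closed resultant_closed pderiv_closed HR assms)
  ultimately show ?thesis by blast
qed

text \<open>The cofactors in both divisibilities are quotients by monic polynomials, so they lie
  over \<open>R\<close> and can be mapped. Squarefreeness is what \<open>h\<close> could destroy,
  hence the condition on the discriminant.\<close>

lemma monic_radical_hom:
  fixes R :: "'a::{idom,ring_char_0} set" and h :: "'a \<Rightarrow> 'b::{idom,ring_char_0}"
  assumes "partial_hom R h" "P \<in> poly_over R" "G \<in> poly_over R" "lead_coeff P = 1" "monic_radical P G"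
    "h (discriminant G) \<noteq> 0"
  shows "monic_radical (map_poly h P) (map_poly h G)"
proof -
  interpret partial_hom R h by fact
  interpret PR: partial_hom "poly_over R" "map_poly h" by (rule partial_hom_map_poly)
  have G1: "lead_coeff G = 1" using assms(5) by (simp add: monic_radical_def)
  obtain n where n: "P dvd G ^ n" "G dvd P" using assms(5) by (auto simp: monic_radical_def)
  obtain A where A': "P = G * A" using n(2) by (rule dvdE)
  obtain B where B': "G ^ n = P * B" using n(1) by (rule dvdE)
  note * = A' B'
  have A: "A \<in> poly_over R" using monic_quotient_closed[OF assms(3) G1, of A] * assms(2) by simp
  have B: "B \<in> poly_over R" using monic_quotient_closed[OF assms(2,4), of B] * PR.power_closed[OF assms(3), of n] by simp
  have "map_poly h P = map_poly h G * map_poly h A" using * A assms by (simp add: PR.hom_mult)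
  moreover have "map_poly h G ^ n = map_poly h P * map_poly h B"
    using * B assms by (metis PR.hom_mult PR.hom_power)
  ultimately show ?thesis
    unfolding monic_radical_def using monic_map_poly[OF G1] discriminant_hom[OF assms(1,3) G1] assms(6)
    by (metis dvd_triv_left)
qed

text \<open>\<open>M\<close> is, up to a scalar, \<open>P\<close> divided by the greatest common
  divisor \<open>D\<close> of \<open>P\<close> and its derivative over the fraction field.
  \<open>U\<close> and \<open>W\<close> are Bezout coefficients and \<open>s\<close> clears
  denominators. All witnesses lie over \<open>R\<close>, so that the notion can be mapped.\<close>

definition squarefree_part :: "'a::idom set \<Rightarrow> 'a poly \<Rightarrow> 'a poly \<Rightarrow> bool" where
  "squarefree_part R P M \<longleftrightarrow> M \<in> poly_over R \<and>
     (\<exists>D\<in>poly_over R. \<exists>U\<in>poly_over R. \<exists>W\<in>poly_over R. \<exists>N\<in>poly_over R. \<exists>s\<in>R. s \<noteq> 0 \<and>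
        D = U * P + W * pderiv P \<and> smult s P = D * M \<and> smult s (pderiv P) = D * N)"

lemma squarefree_part_exists:
  assumes "unital_subring R" "P \<in> poly_over R" "P \<noteq> 0"
  shows "\<exists>M. squarefree_part R P M"
proof -
  obtain D U W M N s where *: "D \<in> poly_over R" "U \<in> poly_over R" "W \<in> poly_over R" "M \<in> poly_over R"
    "N \<in> poly_over R" "s \<in> R" "s \<noteq> 0" "D = U * P + W * pderiv P" "smult s P = D * M" "smult s (pderiv P) = D * N"
    using pseudo_gcd[OF assms(1,2) unital_subring.pderiv_closed[OF assms(1,2)] assms(3)]
    by (elim bexE conjE) (rule that; assumption)
  show ?thesis unfolding squarefree_part_def by (intro exI[of _ M] conjI bexI) (fact *)+
qed

lemma squarefree_part:
  fixes R :: "'a::{idom,ring_char_0} set"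
  assumes "squarefree_part R P M" "pderiv P \<noteq> 0"
  shows "rsquarefree (emb_poly M)" "poly (emb_poly M) x = 0 \<longleftrightarrow> poly (emb_poly P) x = 0"
proof -
  obtain D U W N s where *: "s \<noteq> 0" "D = U * P + W * pderiv P"
    "smult s P = D * M" "smult s (pderiv P) = D * N"
    using assms(1) unfolding squarefree_part_def by (elim bexE conjE) (rule that; assumption)
  let ?e = emb_poly and ?s = "closure_embedding s"
  have s0: "?s \<noteq> 0" using *(1) by (metis closure_embedding_eq_iff emb.hom_zero)
  have 1: "smult ?s (?e P) = ?e D * ?e M" "smult ?s (pderiv (?e P)) = ?e D * ?e N"
    using arg_cong[OF *(3), of ?e] arg_cong[OF *(4), of ?e] by (simp_all add: emb_poly_simps)
  have 2: "?e P = smult (inverse ?s) (?e M) * ?e D" "pderiv (?e P) = smult (inverse ?s) (?e N) * ?e D"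
    using arg_cong[OF 1(1), of "smult (inverse ?s)"] arg_cong[OF 1(2), of "smult (inverse ?s)"] s0
    by (simp_all add: mult.commute)
  have 3: "?e D = ?e U * ?e P + ?e W * pderiv (?e P)"
    using arg_cong[OF *(2), of ?e] by (simp add: emb_poly_simps)
  have "pderiv (?e P) \<noteq> 0" using assms(2) by (simp flip: emb.map_poly_pderiv)
  from poly_squarefree_decomp[OF this 2 3]
  have sq: "rsquarefree (smult (inverse ?s) (?e M))" and roots: "\<forall>a. poly (smult (inverse ?s) (?e M)) a = 0 \<longleftrightarrow> poly (?e P) a = 0"
    by auto
  show "rsquarefree (?e M)"
    using sq s0 unfolding rsquarefree_roots by (simp add: pderiv_smult)
  show "poly (?e M) x = 0 \<longleftrightarrow> poly (?e P) x = 0" using roots s0 by simp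
qed

text \<open>The definition consists of polynomial identities over \<open>R\<close>, which any
  \<open>h\<close> respects, and of \<open>s \<noteq> 0\<close>, which needs the trivial
  kernel.\<close>

lemma squarefree_part_hom:
  assumes "partial_hom R h" "\<And>a. a \<in> R \<Longrightarrow> h a = 0 \<Longrightarrow> a = 0" "P \<in> poly_over R" "squarefree_part R P M"
  shows "squarefree_part UNIV (map_poly h P) (map_poly h M)"
proof -
  interpret partial_hom R h by fact
  interpret PR: partial_hom "poly_over R" "map_poly h" by (rule partial_hom_map_poly)
  obtain D U W N s where D: "D \<in> poly_over R" "U \<in> poly_over R" "W \<in> poly_over R"
    "N \<in> poly_over R" "s \<in> R" "s \<noteq> 0" and *: "D = U * P + W * pderiv P" "smult s P = D * M" "smult s (pderiv P) = D * N"
    using assms(4) unfolding squarefree_part_def by (elim bexE conjE) (rule that; assumption)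
  have M: "M \<in> poly_over R" using assms(4) by (simp add: squarefree_part_def)
  have P': "pderiv P \<in> poly_over R" using assms(3) by (rule pderiv_closed)
  have "h s \<noteq> 0" using assms(2) D by blast
  moreover have "map_poly h D = map_poly h U * map_poly h P + map_poly h W * pderiv (map_poly h P)"
    unfolding *(1) using D assms(3) P' by (simp add: PR.hom_add PR.hom_mult PR.mult_closed map_poly_pderiv)
  moreover have "smult (h s) (map_poly h P) = map_poly h D * map_poly h M"
    using arg_cong[OF *(2), of "map_poly h"] D M assms(3) by (simp add: PR.hom_mult map_poly_smult)
  moreover have "smult (h s) (pderiv (map_poly h P)) = map_poly h D * map_poly h N"
    using arg_cong[OF *(3), of "map_poly h"] D P' assms(3) by (simp add: PR.hom_mult map_poly_smult map_poly_pderiv)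
  moreover have "p \<in> poly_over UNIV" for p :: "'b poly" by (simp add: poly_over_def)
  ultimately show ?thesis unfolding squarefree_part_def by (metis UNIV_I)
qed

lemma monic_pderiv_eq_0:
  fixes P :: "'a::{idom,ring_char_0} poly"
  assumes "pderiv P = 0" "lead_coeff P = 1"
  shows "P = 1"
proof -
  have "degree P = 0" using assms(1) pderiv_eq_0_iff by blast
  then obtain a where "P = [:a:]" by (rule degree_eq_zeroE)
  then show ?thesis using assms(2) by simp
qed

lemma squarefree_same_roots:
  fixes F G :: "'a::{alg_closed_field, field_char_0} poly"
  assumes "rsquarefree F" "rsquarefree G" "\<And>x. poly F x = 0 \<longleftrightarrow> poly G x = 0" "lead_coeff G = 1"
  shows "F = smult (lead_coeff F) G"
proof -
  have "F dvd G" "G dvd F" using assms rsquarefree_dvd by metis+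
  obtain A where A: "F = G * A" using \<open>G dvd F\<close> by (rule dvdE)
  have nz: "G \<noteq> 0" "F \<noteq> 0" using assms by (auto simp: rsquarefree_def)
  then have "degree F = degree G"
    using \<open>F dvd G\<close> \<open>G dvd F\<close> by (intro le_antisym dvd_imp_degree_le) auto
  moreover have "A \<noteq> 0" using A nz by auto
  ultimately have "degree A = 0" using A nz by (simp add: degree_mult_eq)
  then obtain a where a: "A = [:a:]" by (rule degree_eq_zeroE)
  have "lead_coeff F = lead_coeff G * lead_coeff A" unfolding A by (rule lead_coeff_mult)
  then have "lead_coeff F = a" using assms(4) a by simp
  moreover have "F = smult a G" unfolding A a by simp
  ultimately show ?thesis by (simp only:)
qed

text \<open>\<open>G\<close> itself may have coefficients outside \<open>R\<close>. The squarefree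
  part \<open>M\<close> does not; it is its leading coefficient \<open>l\<close> times
  \<open>G\<close>, while its image is a squarefree part of the image of \<open>P\<close> and
  therefore \<open>h l\<close> times \<open>G'\<close>. With \<open>h\<close> the identity this
  supplies a denominator of \<open>G\<close>; with \<open>h\<close> the Taylor expansion it relates
  the radicals before and after expansion.\<close>

lemma monic_radical_denominator:
  fixes R :: "'a::{idom,ring_char_0} set" and h :: "'a \<Rightarrow> 'b::{idom,ring_char_0}"
  assumes "partial_hom R h" "\<And>a. a \<in> R \<Longrightarrow> h a = 0 \<Longrightarrow> a = 0" "P \<in> poly_over R" "lead_coeff P = 1"
    "monic_radical P G" "monic_radical (map_poly h P) G'"
  shows "\<exists>l\<in>R. l \<noteq> 0 \<and> smult l G \<in> poly_over R \<and> map_poly h (smult l G) = smult (h l) G'"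
proof (cases "pderiv P = 0")
  case True
  interpret partial_hom R h by fact
  interpret PR: partial_hom "poly_over R" "map_poly h" by (rule partial_hom_map_poly)
  have P: "P = 1" using True assms(4) by (rule monic_pderiv_eq_0)
  then have "G = 1" using assms(5) monic_radical_one monic_radical_unique by blast
  moreover have "G' = 1" using assms(6) monic_radical_one monic_radical_unique by (metis P map_poly_one)
  ultimately show ?thesis by (intro bexI[of _ 1]) simp_all
next
  case False
  interpret partial_hom R h by fact
  have P0: "P \<noteq> 0" using assms(4) by auto
  obtain M where M: "squarefree_part R P M"
    using squarefree_part_exists[OF unital_subring_axioms assms(3) P0] by blast
  \<comment> \<open>Stated for an arbitrary type, since it is applied on both sides of
    \<open>h\<close>.\<close>
  have key: "M = smult (lead_coeff M) G"
    if "squarefree_part R P M" "pderiv P \<noteq> 0" "monic_radical P G" for R and P M G :: "'c::{idom,ring_char_0} poly"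
  proof -
    have "emb_poly M = smult (lead_coeff (emb_poly M)) (emb_poly G)"
      by (rule squarefree_same_roots)
        (use squarefree_part[OF that(1,2)] monic_radicalD[OF that(3)] that(3) in \<open>auto simp: monic_radical_def\<close>)
    then have "emb_poly M = emb_poly (smult (lead_coeff M) G)" by (simp add: emb_poly_simps)
    then show ?thesis by (rule embp.injectivity)
  qed
  have MG: "M = smult (lead_coeff M) G" by (rule key[OF M False assms(5)])
  have MR: "M \<in> poly_over R" using M by (simp add: squarefree_part_def)
  have "rsquarefree (emb_poly M)" using squarefree_part(1)[OF M False] .
  then have M0: "M \<noteq> 0" by (auto simp: rsquarefree_def)
  have "degree (map_poly h P) = degree P" by (rule monic_map_poly(1)[OF assms(4)])
  then have "pderiv (map_poly h P) \<noteq> 0" using False by (metis pderiv_eq_0_iff)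
  from key[OF squarefree_part_hom[OF assms(1-3) M] this assms(6)]
  have eq: "map_poly h M = smult (lead_coeff (map_poly h M)) G'" .
  have "h (lead_coeff M) \<noteq> 0" using assms(2) MR M0 by (metis coeff_closed leading_coeff_0_iff)
  then have "degree (map_poly h M) = degree M"
    by (metis coeff_map degree_map_poly_le le_antisym le_degree)
  then have "lead_coeff (map_poly h M) = h (lead_coeff M)" by simp
  then show ?thesis
    using eq MG MR M0 by (intro bexI[of _ "lead_coeff M"] conjI) auto
qed

text \<open>Difference quotients: with \<open>p = (x - a0) * q + p(a0)\<close>, the values of
  \<open>q\<close> at the integers beyond \<open>a0\<close> lie in \<open>I\<close>, because
  \<open>x - a0\<close> is there a positive integer and can be divided out. \<open>q\<close> has
  smaller degree. The lemma serves to pass from values in the multiples of \<open>l\<close> to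
  coefficients in the multiples of \<open>l\<close>.\<close>

lemma interpolation:
  fixes p :: "'a::idom poly" and I :: "'a set"
  assumes add: "\<And>a b. a \<in> I \<Longrightarrow> b \<in> I \<Longrightarrow> a + b \<in> I"
    and scale: "\<And>n a. a \<in> I \<Longrightarrow> of_int n * a \<in> I"
    and divide: "\<And>n a. of_nat (Suc n) * a \<in> I \<Longrightarrow> a \<in> I"
    and vals: "\<And>a. a \<ge> a0 \<Longrightarrow> poly p (of_nat a) \<in> I"
  shows "coeff p i \<in> I"
  using vals
proof (induction "degree p" arbitrary: p a0 i rule: less_induct)
  case (less p a0 i)
  have zero: "0 \<in> I" using scale[OF less.prems[of a0], of 0] by simp
  let ?a = "of_nat a0 :: 'a"
  have c: "poly p ?a \<in> I" using less.prems by simp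
  show ?case
  proof (cases "degree p = 0")
    case True
    then obtain c where "p = [:c:]" by (metis degree_eq_zeroE)
    then show ?thesis using c zero by (cases i) auto
  next
    case False
    define q where "q = synthetic_div p ?a"
    have p: "p = [:- ?a, 1:] * q + [:poly p ?a:]"
      unfolding q_def by (rule synthetic_div_correct'[symmetric])
    have q: "coeff q j \<in> I" for j
    proof (rule less.hyps)
      show "degree q < degree p" using False by (simp add: q_def degree_synthetic_div)
      fix a assume a: "Suc a0 \<le> a"
      define d where "d = a - Suc a0"
      have a': "of_nat a = ?a + (of_nat (Suc d) :: 'a)" using a by (simp add: d_def flip: of_nat_add)
      have "poly p (of_nat a) = of_nat (Suc d) * poly q (of_nat a) + poly p ?a"
        by (subst p) (simp add: a' algebra_simps)
      then have "of_nat (Suc d) * poly q (of_nat a) = poly p (of_nat a) + of_int (- 1) * poly p ?a" by simp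
      also have "\<dots> \<in> I" by (intro add scale c less.prems) (use a in simp)
      finally show "poly q (of_nat a) \<in> I" by (rule divide)
    qed
    have "coeff p i = (of_int (- int a0) * coeff q i + (if i = 0 then 0 else coeff q (i - 1))) + (if i = 0 then poly p ?a else 0)"
      by (subst p) (cases i, auto simp: coeff_pCons split: nat.splits)
    also have "\<dots> \<in> I" by (intro add scale q) (use q c zero in auto)
    finally show ?thesis .
  qed
qed

text \<open>The usual condition on almost integral elements without the fraction field:
  \<open>p / l\<close> lies in \<open>R\<close> if all its powers have a common denominator
  \<open>e\<close>.\<close>

definition completely_integrally_closed :: "'a::comm_ring_1 set \<Rightarrow> bool" where
  "completely_integrally_closed R \<longleftrightarrow> (\<forall>p\<in>R. \<forall>l\<in>R. \<forall>e\<in>R. l \<noteq> 0 \<and> e \<noteq> 0 \<and>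
     (\<forall>n. \<exists>h\<in>R. e * p ^ n = l ^ n * h) \<longrightarrow> (\<exists>q\<in>R. p = l * q))"

text \<open>
  Let \<open>l\<close> be the leading coefficient of the squarefree part \<open>M\<close>, with roots \<open>Z\<close>, and let \<open>a\<close> be an
  integer. Dividing $(x-a)^n$ by \<open>P\<close> does not change its values on \<open>Z\<close>, so the resultant of \<open>M\<close> and
  the remainder shows that all powers of \<open>M(a)/l\<close> have a common denominator.
\<close>

lemma monic_radical_exists:
  fixes R :: "'a::{idom,ring_char_0} set"
  assumes "unital_subring R" "P \<in> poly_over R" "lead_coeff P = 1"
    and cic: "completely_integrally_closed R"
    and nat_unit: "\<And>n. \<exists>q\<in>R. of_nat (Suc n) * q = 1"
  shows "\<exists>G\<in>poly_over R. monic_radical P G"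
proof -
  interpret unital_subring R by fact
  interpret PR: unital_subring "poly_over R" by (rule unital_subring_poly_over)
  have P0: "P \<noteq> 0" using assms(3) by auto
  have "\<exists>M\<in>poly_over R. rsquarefree (emb_poly M) \<and> (\<forall>x. poly (emb_poly M) x = 0 \<longleftrightarrow> poly (emb_poly P) x = 0)"
  proof (cases "pderiv P = 0")
    case True
    then have "P = 1" using assms(3) by (rule monic_pderiv_eq_0)
    then show ?thesis using assms(2) by (intro bexI[of _ 1]) (auto simp: rsquarefree_def)
  next
    case False
    then show ?thesis
      using squarefree_part_exists[OF assms(1,2) P0] squarefree_part by (metis squarefree_part_def)
  qed
  then obtain M where M: "M \<in> poly_over R" "rsquarefree (emb_poly M)" "\<And>x. poly (emb_poly M) x = 0 \<longleftrightarrow> poly (emb_poly P) x = 0"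
    by blast
  define l where "l = lead_coeff M"
  have M0: "M \<noteq> 0" using M(2) by (auto simp: rsquarefree_def)
  then have l: "l \<in> R" "l \<noteq> 0" using M(1) by (auto simp: l_def)
  let ?l = "closure_embedding l"
  have l0: "?l \<noteq> 0" using l(2) by (metis closure_embedding_eq_iff emb.hom_zero)
  obtain Z where Z: "emb_poly M = smult ?l (roots_poly Z)"
    using alg_closed_imp_factorization[of "emb_poly M", folded roots_poly_def] M0 by (auto simp: l_def)
  have rootsZ: "x \<in># Z \<Longrightarrow> poly (emb_poly P) x = 0" for x
    using M(3)[of x] l0 by (simp add: Z)
  have "\<exists>q\<in>R. poly M (of_nat a) = l * q" for a
  proof -
    let ?y = "poly M (of_nat a)" and ?N = "degree P" and ?s = "(- 1) ^ size Z :: 'a"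
    have y: "?y \<in> R" using M(1) by blast
    have E: "closure_embedding ?y = ?l * (\<Prod>z\<in>#Z. of_nat a - z)"
    proof -
      have "closure_embedding ?y = poly (emb_poly M) (of_nat a)" by (metis emb.poly_map_poly closure_embedding_of_nat)
      then show ?thesis by (simp add: Z poly_roots_poly)
    qed
    \<comment> \<open>The denominator \<open>l ^ ?N\<close> is independent of \<open>n\<close>,
      because every remainder modulo \<open>P\<close> has degree at most \<open>?N\<close>.\<close>
    have "\<exists>h\<in>R. l ^ ?N * ?y ^ n = l ^ n * h" for n
    proof -
      let ?X = "[:- of_nat a, 1:] ^ n :: 'a poly"
      have X: "?X \<in> poly_over R" by (intro PR.power_closed pCons_closed uminus_closed) auto
      obtain S T where ST: "T \<in> poly_over R" "?X = P * S + T" "T = 0 \<or> degree T < degree P"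
        using monic_division[OF assms(2,3) X] by blast
      \<comment> \<open>The product formula needs a nonzero second argument. If the remainder is 0,
        it is replaced by \<open>P\<close>, which also vanishes on \<open>Z\<close>.\<close>
      define S' T' where "S' = (if T = 0 then S - 1 else S)" and "T' = (if T = 0 then P else T)"
      have T': "T' \<in> poly_over R" "?X = P * S' + T'" "degree T' \<le> ?N" "T' \<noteq> 0"
        using ST assms(2) P0 by (auto simp: S'_def T'_def algebra_simps)
      have vals: "poly (emb_poly T') z = (z - of_nat a) ^ n" if "z \<in># Z" for z
      proof -
        have "emb_poly ?X = emb_poly P * emb_poly S' + emb_poly T'"
          using arg_cong[OF T'(2), of emb_poly] by (simp only: embp.hom_add embp.hom_mult)
        moreover have "poly (emb_poly ?X) z = (z - of_nat a) ^ n"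
          by (simp add: emb_poly_simps emb.hom_uminus)
        ultimately show ?thesis using rootsZ[OF that] by simp
      qed
      have "closure_embedding (resultant M T') = resultant (emb_poly M) (emb_poly T')"
        by (simp add: emb.resultant_hom)
      also have "\<dots> = ?l ^ degree T' * (\<Prod>z\<in>#Z. poly (emb_poly T') z)"
        using resultant_roots[OF Z l0, of "emb_poly T'"] T'(4) by simp
      also have "(\<Prod>z\<in>#Z. poly (emb_poly T') z) = (\<Prod>z\<in>#Z. (z - of_nat a) ^ n)"
        using vals by (intro arg_cong[where f = prod_mset] image_mset_cong) auto
      also have "\<dots> = ((- 1) ^ size Z * (\<Prod>z\<in>#Z. of_nat a - z)) ^ n"
      proof (induction Z)
        case (add z Z)
        have "(z - of_nat a) * ((- 1) ^ size Z * (\<Prod>z\<in>#Z. of_nat a - z)) =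
            (- 1) ^ size (add_mset z Z) * (\<Prod>z\<in>#add_mset z Z. of_nat a - z)"
          by (simp add: algebra_simps)
        then show ?case
          using add by (simp only: image_mset_add_mset prod_mset.add_mset power_mult_distrib[symmetric])
      qed simp
      finally have "?l ^ n * closure_embedding (resultant M T') = ?l ^ degree T' * ((- 1) ^ size Z * closure_embedding ?y) ^ n"
        unfolding E by (simp add: power_mult_distrib mult_ac)
      then have "closure_embedding (l ^ n * resultant M T') = closure_embedding (l ^ degree T' * (?s * ?y) ^ n)"
        by (simp only: emb.hom_mult emb.hom_power emb.hom_uminus emb.hom_one)
      then have eq: "l ^ n * resultant M T' = l ^ degree T' * (?s * ?y) ^ n" by simp
      have "?s ^ n * ?s ^ n = 1" by (simp flip: power_mult_distrib)
      then have "l ^ degree T' * ?y ^ n = l ^ n * (?s ^ n * resultant M T')"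
      proof -
        assume s: "?s ^ n * ?s ^ n = 1"
        have "?s ^ n * (l ^ degree T' * (?s * ?y) ^ n) = (?s ^ n * ?s ^ n) * (l ^ degree T' * ?y ^ n)"
          by (simp only: power_mult_distrib mult_ac)
        then have "l ^ degree T' * ?y ^ n = ?s ^ n * (l ^ n * resultant M T')" by (simp only: s eq mult_1)
        then show ?thesis by (simp only: mult_ac)
      qed
      then have "l ^ (?N - degree T') * (l ^ degree T' * ?y ^ n) = l ^ n * (l ^ (?N - degree T') * (?s ^ n * resultant M T'))"
        by (simp add: mult_ac)
      then have "l ^ ?N * ?y ^ n = l ^ n * (l ^ (?N - degree T') * (?s ^ n * resultant M T'))"
        using T'(3) by (simp flip: mult.assoc power_add)
      moreover have "l ^ (?N - degree T') * (?s ^ n * resultant M T') \<in> R"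
        by (intro mult_closed power_closed uminus_closed one_closed resultant_closed l M(1) T'(1))
      ultimately show ?thesis by blast
    qed
    then show ?thesis
      using cic[unfolded completely_integrally_closed_def, rule_format, OF y l(1), of "l ^ ?N"] l by (auto intro!: power_closed)
  qed
  then have vals: "poly M (of_nat a) \<in> (*) l ` R" for a by blast
  \<comment> \<open>All values of \<open>M\<close> at natural numbers are divisible by
    \<open>l\<close>; interpolation transfers this to the coefficients, and the quotient
    \<open>G\<close> of \<open>M\<close> by \<open>l\<close> is the radical.\<close>
  have "coeff M i \<in> (*) l ` R" for i
  proof (rule interpolation[of _ 0])
    fix a b assume "a \<in> (*) l ` R" "b \<in> (*) l ` R"
    then show "a + b \<in> (*) l ` R" by (auto simp: add_closed simp flip: distrib_left)
  next
    fix n a assume "a \<in> (*) l ` R"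
    then obtain q where q: "q \<in> R" "a = l * q" by blast
    show "of_int n * a \<in> (*) l ` R"
      by (rule image_eqI[of _ _ "of_int n * q"]) (use q in \<open>auto simp: mult_ac\<close>)
  next
    fix n a assume "of_nat (Suc n) * a \<in> (*) l ` R"
    then obtain q where q: "q \<in> R" "of_nat (Suc n) * a = l * q" by blast
    obtain u where u: "u \<in> R" "of_nat (Suc n) * u = 1" using nat_unit by blast
    have "a = (of_nat (Suc n) * u) * a" using u(2) by simp
    also have "\<dots> = u * (of_nat (Suc n) * a)" by (simp only: mult_ac)
    also have "\<dots> = l * (u * q)" unfolding q(2) by (simp only: mult_ac)
    finally show "a \<in> (*) l ` R" using u(1) q(1) by blast
  qed (rule vals)
  then have "\<forall>i. \<exists>g. g \<in> R \<and> coeff M i = l * g" by blast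
  then obtain g where g: "\<And>i. g i \<in> R" "\<And>i. coeff M i = l * g i" by metis
  have "g i = 0" if "i > degree M" for i using g(2)[of i] l(2) that by (simp add: coeff_eq_0)
  then have cG: "coeff (Abs_poly g) i = g i" for i
    by (subst coeff_Abs_poly[of "degree M"]) auto
  define G where "G = Abs_poly g"
  have GR: "G \<in> poly_over R" by (simp add: poly_over_iff G_def cG g(1))
  have MG: "M = smult l G" by (rule poly_eqI) (simp add: G_def cG g(2))
  have G1: "lead_coeff G = 1"
    using l(2) MG unfolding l_def by (metis lead_coeff_smult mult_cancel_left1)
  have eM: "emb_poly M = smult ?l (emb_poly G)" by (simp add: MG emb_poly_simps)
  have sq: "rsquarefree (emb_poly G)"
    using M(2) l0 unfolding rsquarefree_roots eM by (simp add: pderiv_smult)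
  have roots: "poly (emb_poly G) x = 0 \<longleftrightarrow> poly (emb_poly P) x = 0" for x
    using M(3)[of x] l0 by (simp add: eM)
  have "emb_poly G dvd emb_poly P" by (rule rsquarefree_dvd[OF sq]) (use roots in auto)
  then have "G dvd P" using emb_poly_dvd_iff[OF G1] by blast
  moreover have "emb_poly P dvd emb_poly G ^ degree (emb_poly P)"
    by (rule dvd_power_if_roots) (use roots P0 G1 in auto)
  then have "P dvd G ^ degree (emb_poly P)"
    using emb_poly_dvd_iff[OF assms(3)] by (metis embp.hom_power)
  ultimately show ?thesis
    using GR G1 sq discriminant_nonzero_iff[OF G1] by (auto simp: monic_radical_def)
qed

section \<open>Power series over a subring\<close>

lemma mcoeff_add [simp]: "mcoeff (f + g) m = mcoeff f m + mcoeff g m"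
  by (simp add: plus_mps_def)

lemma mcoeff_uminus [simp]: "mcoeff (- f) m = - mcoeff f m"
  by (simp add: uminus_mps_def)

lemma mcoeff_diff [simp]: "mcoeff (f - g) m = mcoeff f m - mcoeff g m"
  by (simp add: minus_mps_def)

lemma mcoeff_sum: "mcoeff (sum f I) m = (\<Sum>i\<in>I. mcoeff (f i) m)"
  by (induction I rule: infinite_finite_induct) auto

lemma mcoeff_mult_0:
  fixes f g :: "('v, 'a::comm_ring_1) mps"
  shows "mcoeff (f * g) 0 = mcoeff f 0 * mcoeff g 0"
proof -
  have "splits (0 :: 'v \<Rightarrow>\<^sub>0 nat) = {(0, 0)}"
  proof -
    have "a = 0 \<and> b = 0" if "a + b = 0" for a b :: "'v \<Rightarrow>\<^sub>0 nat"
    proof -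
      have "lookup a v + lookup b v = 0" for v
        unfolding lookup_add[symmetric] that by (rule lookup_zero)
      then have *: "lookup a v = 0" "lookup b v = 0" for v unfolding add_is_0 by blast+
      have "a = 0" by (rule poly_mapping_eqI) (simp only: *(1) lookup_zero)
      moreover have "b = 0" by (rule poly_mapping_eqI) (simp only: *(2) lookup_zero)
      ultimately show ?thesis by blast
    qed
    note zero = this
    show ?thesis
    proof (intro equalityI subsetI)
      fix x assume x: "x \<in> splits (0 :: 'v \<Rightarrow>\<^sub>0 nat)"
      obtain a b where ab: "x = (a, b)" by (cases x)
      have "a + b = 0" using x unfolding ab by simp
      from zero[OF this] show "x \<in> {(0, 0)}" unfolding ab by blast
    next
      fix x assume "x \<in> {(0 :: 'v \<Rightarrow>\<^sub>0 nat, 0 :: 'v \<Rightarrow>\<^sub>0 nat)}"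
      then show "x \<in> splits 0" by (auto simp: splits_def)
    qed
  qed
  then show ?thesis by (simp add: mcoeff_mult)
qed

lemma mcoeff_mult_nonzero:
  assumes "mcoeff (f * g) m \<noteq> 0"
  obtains a b where "m = a + b" "mcoeff f a \<noteq> 0" "mcoeff g b \<noteq> 0"
proof -
  have "\<exists>x\<in>splits m. (case x of (a, b) \<Rightarrow> mcoeff f a * mcoeff g b) \<noteq> 0"
    using assms unfolding mcoeff_mult by (meson sum.neutral)
  then obtain a b where "a + b = m" "mcoeff f a * mcoeff g b \<noteq> 0" by (auto simp: splits_def)
  moreover from this have "mcoeff f a \<noteq> 0" "mcoeff g b \<noteq> 0" by (metis mult_zero_left mult_zero_right)+
  ultimately show ?thesis using that[of a b] by auto
qed

lemma mcoeff_mult_cong: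
  assumes "\<And>p q. p + q = m \<Longrightarrow> mcoeff f p \<noteq> 0 \<Longrightarrow> mcoeff Z q = mcoeff Z' q"
  shows "mcoeff (f * Z) m = mcoeff (f * Z') m"
  unfolding mcoeff_mult
proof (rule sum.cong[OF refl], clarify)
  fix p q assume "(p, q) \<in> splits m"
  then show "mcoeff f p * mcoeff Z q = mcoeff f p * mcoeff Z' q"
    using assms[of p q] by (cases "mcoeff f p = 0") auto
qed

lemma mcoeff_mult_single:
  assumes "p + q = m" "\<And>a b. a + b = m \<Longrightarrow> (a, b) \<noteq> (p, q) \<Longrightarrow> mcoeff f a * mcoeff g b = 0"
  shows "mcoeff (f * g) m = mcoeff f p * mcoeff g q"
proof -
  have "(\<Sum>(a, b)\<in>splits m. mcoeff f a * mcoeff g b) = (\<Sum>(a, b)\<in>{(p, q)}. mcoeff f a * mcoeff g b)"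
  proof (rule sum.mono_neutral_right)
    show "\<forall>i\<in>splits m - {(p, q)}. (case i of (a, b) \<Rightarrow> mcoeff f a * mcoeff g b) = 0"
    proof
      fix i assume i: "i \<in> splits m - {(p, q)}"
      obtain a b where "i = (a, b)" by (cases i)
      then show "(case i of (a, b) \<Rightarrow> mcoeff f a * mcoeff g b) = 0" using assms(2)[of a b] i by simp
    qed
  qed (use assms(1) in auto)
  then show ?thesis by (simp add: mcoeff_mult)
qed

lemma series_overI:
  assumes "\<And>m. mcoeff f m \<in> K" "\<And>m. mcoeff f m \<noteq> 0 \<Longrightarrow> keys m \<subseteq> V"
  shows "f \<in> series_over K V"
  using assms by (auto simp: series_over_def)

lemma series_overD:
  assumes "f \<in> series_over K V"
  shows "mcoeff f m \<in> K" "mcoeff f m \<noteq> 0 \<Longrightarrow> keys m \<subseteq> V"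
  using assms by (auto simp: series_over_def)

lemma series_over_mono: "K \<subseteq> L \<Longrightarrow> V \<subseteq> W \<Longrightarrow> series_over K V \<subseteq> series_over L W"
  by (fastforce simp: series_over_def)

lemma poly_over_mono: "R \<subseteq> R' \<Longrightarrow> poly_over R \<subseteq> poly_over R'"
  by (auto simp: poly_over_def)

lemma unital_subring_UNIV: "unital_subring (UNIV :: 'a::idom set)"
  by standard auto

lemma unital_subring_series_over:
  fixes K :: "'a::idom set"
  assumes "unital_subring K"
  shows "unital_subring (series_over K V :: ('v::linorder, 'a) mps set)"
proof -
  interpret K: unital_subring K by fact
  show ?thesis
  proof
    show "0 \<in> series_over K V" by (rule series_overI) auto
    show "1 \<in> series_over K V" by (rule series_overI) (auto simp: mcoeff_one split: if_splits)
    fix f g :: "('v, 'a) mps" assume f: "f \<in> series_over K V" and g: "g \<in> series_over K V"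
    show "f + g \<in> series_over K V"
    proof (rule series_overI)
      fix m assume "mcoeff (f + g) m \<noteq> 0"
      then have "mcoeff f m \<noteq> 0 \<or> mcoeff g m \<noteq> 0" by auto
      then show "keys m \<subseteq> V" using f g series_overD(2) by blast
    qed (use f g in \<open>auto intro!: K.add_closed dest: series_overD\<close>)
    show "f * g \<in> series_over K V"
    proof (rule series_overI)
      fix m show "mcoeff (f * g) m \<in> K"
        unfolding mcoeff_mult
        by (rule K.sum_closed) (use f g in \<open>auto intro!: K.mult_closed dest: series_overD\<close>)
      assume "mcoeff (f * g) m \<noteq> 0"
      then obtain a b where "m = a + b" "mcoeff f a \<noteq> 0" "mcoeff g b \<noteq> 0" by (rule mcoeff_mult_nonzero)
      then show "keys m \<subseteq> V" using f g series_overD(2) keys_add[of a b] by blast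
    qed
    show "- f \<in> series_over K V" using f by (auto intro!: series_overI K.uminus_closed dest: series_overD)
  qed
qed

section \<open>Monomials, constants and variables as series\<close>

definition mmon :: "('v \<Rightarrow>\<^sub>0 nat) \<Rightarrow> ('v, 'a::comm_ring_1) mps" where
  "mmon k = Abs_mps (\<lambda>m. if m = k then 1 else 0)"

lemma mcoeff_mmon: "mcoeff (mmon k) m = (if m = k then 1 else 0)"
  by (simp add: mmon_def)

lemma mcoeff_mconst: "mcoeff (mconst a) m = (if m = 0 then a else 0)"
  by (simp add: mconst_def)

lemma mconst_hom:
  fixes a b :: "'a::comm_ring_1"
  shows "mconst (a + b) = (mconst a + mconst b :: ('v, 'a) mps)"
    "mconst (a * b) = (mconst a * mconst b :: ('v, 'a) mps)"
    "mconst 1 = (1 :: ('v, 'a) mps)" "mconst 0 = (0 :: ('v, 'a) mps)"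
proof -
  show "mconst (a * b) = (mconst a * mconst b :: ('v, 'a) mps)"
  proof (rule mps_eqI)
    fix m :: "'v \<Rightarrow>\<^sub>0 nat"
    show "mcoeff (mconst (a * b)) m = mcoeff (mconst a * (mconst b :: ('v, 'a) mps)) m"
      by (subst mcoeff_mult_single[of 0 m]) (auto simp: mcoeff_mconst)
  qed
qed (auto intro!: mps_eqI simp: mcoeff_mconst mcoeff_one)

lemma mcoeff_mmon_mult:
  "mcoeff (mmon k * f) (k + q) = mcoeff f q"
  by (subst mcoeff_mult_single[of k q]) (auto simp: mcoeff_mmon)

lemma mcoeff_mmon_mult_eq_0:
  assumes "\<And>q. m \<noteq> k + q"
  shows "mcoeff (mmon k * f) m = 0"
proof (rule ccontr)
  assume "mcoeff (mmon k * f) m \<noteq> 0"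
  then obtain a b where "m = a + b" "mcoeff (mmon k :: ('a, 'b) mps) a \<noteq> 0" by (rule mcoeff_mult_nonzero)
  then show False using assms[of b] by (auto simp: mcoeff_mmon split: if_splits)
qed

lemma mmon_mult: "mmon j * mmon k = (mmon (j + k) :: ('v, 'a::comm_ring_1) mps)"
proof (rule mps_eqI)
  fix m :: "'v \<Rightarrow>\<^sub>0 nat"
  show "mcoeff (mmon j * mmon k) m = mcoeff (mmon (j + k) :: ('v, 'a) mps) m"
  proof (cases "\<exists>q. m = j + q")
    case True
    then show ?thesis by (auto simp: mcoeff_mmon_mult mcoeff_mmon)
  qed (auto simp: mcoeff_mmon_mult_eq_0 mcoeff_mmon)
qed

lemma mvar_eq: "mvar v = mmon (Poly_Mapping.single v 1)"
  by (simp add: mvar_def mmon_def)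

lemma mvar_power: "mvar v ^ j = mmon (Poly_Mapping.single v j)"
proof (induction j)
  case 0
  then show ?case by (auto intro!: mps_eqI simp: mcoeff_mmon mcoeff_one)
next
  case (Suc j)
  then show ?case by (simp add: mvar_eq mmon_mult flip: single_add)
qed

lemma mmon_closed:
  fixes K :: "'a::idom set"
  assumes "unital_subring K" "keys k \<subseteq> V"
  shows "mmon k \<in> series_over K V"
proof -
  interpret unital_subring K by fact
  show ?thesis using assms(2) by (intro series_overI) (auto simp: mcoeff_mmon split: if_splits)
qed

lemma mvar_closed:
  fixes K :: "'a::idom set"
  assumes "unital_subring K" "v \<in> V"
  shows "mvar v \<in> series_over K V"
  unfolding mvar_eq by (rule mmon_closed[OF assms(1)]) (use assms(2) in simp)

lemma mconst_closed: "a \<in> K \<Longrightarrow> 0 \<in> K \<Longrightarrow> mconst a \<in> series_over K V"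
  by (rule series_overI) (auto simp: mcoeff_mconst split: if_splits)

lemma diff_single_add: "j \<le> lookup (m :: 'v \<Rightarrow>\<^sub>0 nat) v \<Longrightarrow> Poly_Mapping.single v j + (m - Poly_Mapping.single v j) = m"
  by (rule poly_mapping_eqI) (auto simp: lookup_add lookup_minus lookup_single when_def)

lemma mcoeff_mult_mvar_power:
  "mcoeff (f * mvar v ^ j) m = (if j \<le> lookup m v then mcoeff f (m - Poly_Mapping.single v j) else 0)"
proof (cases "j \<le> lookup m v")
  case True
  then have "mcoeff (mmon (Poly_Mapping.single v j) * f) m = mcoeff f (m - Poly_Mapping.single v j)"
    by (metis diff_single_add mcoeff_mmon_mult)
  then show ?thesis using True by (simp add: mvar_power mult.commute)
next
  case False
  have "mcoeff (mmon (Poly_Mapping.single v j) * f) m = 0"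
    by (rule mcoeff_mmon_mult_eq_0) (use False in \<open>auto simp: lookup_add\<close>)
  then show ?thesis using False by (simp add: mvar_power mult.commute)
qed

text \<open>The coefficients of \<open>P\<close> do not involve \<open>v\<close>, so the exponent of
  \<open>v\<close> in \<open>m\<close> selects the only term that contributes.\<close>

lemma mcoeff_poly_mvar:
  assumes P: "P \<in> poly_over (series_over K V)" and v: "v \<notin> V" and K0: "0 \<in> K"
  shows "mcoeff (poly P (mvar v)) m = mcoeff (coeff P (lookup m v)) (m - Poly_Mapping.single v (lookup m v))"
proof -
  have PC: "coeff P i \<in> series_over K V" for i
  proof (cases "coeff P i = 0")
    case True
    then show ?thesis using K0 by (auto intro!: series_overI)
  next
    case False
    then have "coeff P i \<in> set (coeffs P)" by (metis coeff_0 coeff_in_coeffs le_degree)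
    then show ?thesis using P by (auto simp: poly_over_def)
  qed
  have *: "mcoeff (coeff P i * mvar v ^ i) m = (if i = lookup m v then mcoeff (coeff P i) (m - Poly_Mapping.single v i) else 0)" for i
  proof (cases "i \<le> lookup m v \<and> i \<noteq> lookup m v")
    case True
    have "mcoeff (coeff P i) (m - Poly_Mapping.single v i) = 0"
    proof (rule ccontr)
      assume "\<not> ?thesis"
      then have "keys (m - Poly_Mapping.single v i) \<subseteq> V" using PC series_overD(2) by blast
      then have "lookup (m - Poly_Mapping.single v i) v = 0" using v by (auto simp: in_keys_iff)
      then show False using True by (simp add: lookup_minus)
    qed
    then show ?thesis using True by (simp add: mcoeff_mult_mvar_power)
  qed (auto simp: mcoeff_mult_mvar_power)
  show ?thesis
    unfolding poly_altdef mcoeff_sum *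
    by (auto simp: coeff_eq_0)
qed

lemma poly_mvar_inject:
  assumes "P \<in> poly_over (series_over K V)" "Q \<in> poly_over (series_over K V)" "v \<notin> V" "0 \<in> K"
    and eq: "poly P (mvar v) = poly Q (mvar v)"
  shows "P = Q"
proof (rule poly_eqI, rule mps_eqI)
  fix i m
  have z: "mcoeff (coeff P i) m = 0 \<and> mcoeff (coeff Q i) m = 0" if "lookup m v \<noteq> 0"
  proof -
    have "\<not> keys m \<subseteq> V" using that assms(3) by (metis in_keys_iff subsetD)
    moreover have "coeff R i \<in> series_over K V" if "R \<in> poly_over (series_over K V)" for R
    proof (cases "coeff R i = 0")
      case True
      then show ?thesis using assms(4) by (auto intro!: series_overI)
    next
      case False
      then have "coeff R i \<in> set (coeffs R)" by (metis coeff_0 coeff_in_coeffs le_degree)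
      then show ?thesis using that by (auto simp: poly_over_def)
    qed
    ultimately show ?thesis using assms(1,2) series_overD(2) by blast
  qed
  show "mcoeff (coeff P i) m = mcoeff (coeff Q i) m"
  proof (cases "lookup m v = 0")
    case True
    let ?m = "Poly_Mapping.single v i + m"
    have "mcoeff (poly P (mvar v)) ?m = mcoeff (poly Q (mvar v)) ?m" by (simp add: eq)
    then show ?thesis using True
      by (simp add: mcoeff_poly_mvar[OF assms(1,3,4)] mcoeff_poly_mvar[OF assms(2,3,4)] lookup_add)
  qed (use z in simp)
qed

text \<open>Well-founded recursion on monomials replaces the convergence of a contraction: the
  coefficient at \<open>m\<close> may use only coefficients at smaller monomials. Inverses of units,
  Weierstrass division and division by leading monomials are instances with different relations
  \<open>r\<close>.\<close>

lemma mps_fixpoint: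
  fixes F :: "('v, 'a::comm_ring_1) mps \<Rightarrow> ('v \<Rightarrow>\<^sub>0 nat) \<Rightarrow> 'a"
  assumes wf: "wf r" and K0: "0 \<in> K"
    and cong: "\<And>Z Z' m. (\<And>m'. (m', m) \<in> r \<Longrightarrow> mcoeff Z m' = mcoeff Z' m') \<Longrightarrow> F Z m = F Z' m"
    and closed: "\<And>Z m. Z \<in> series_over K V \<Longrightarrow> F Z m \<in> K \<and> (F Z m \<noteq> 0 \<longrightarrow> keys m \<subseteq> V)"
  shows "\<exists>Z\<in>series_over K V. \<forall>m. mcoeff Z m = F Z m"
proof -
  define G where "G = (\<lambda>f m. F (Abs_mps f) m)"
  define Z where "Z = Abs_mps (wfrec r G)"
  have "adm_wf r G"
    unfolding adm_wf_def G_def by (auto intro!: cong)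
  from wfrec_fixpoint[OF wf this] have "wfrec r G = G (wfrec r G)" by simp
  then have fp: "mcoeff Z m = F Z m" for m
    unfolding Z_def G_def by (metis mcoeff_Abs_mps)
  have "mcoeff Z m \<in> K \<and> (mcoeff Z m \<noteq> 0 \<longrightarrow> keys m \<subseteq> V)" for m
  proof (induction m rule: wf_induct_rule[OF wf])
    case (1 m)
    \<comment> \<open>The truncation of \<open>Z\<close> below \<open>m\<close> lies in
      \<open>series_over K V\<close> by the induction hypothesis and leads to the same coefficient
      at \<open>m\<close>.\<close>
    define Z' where "Z' = Abs_mps (\<lambda>m'. if (m', m) \<in> r then mcoeff Z m' else 0)"
    have "Z' \<in> series_over K V"
    proof (rule series_overI)
      fix m'
      show "mcoeff Z' m' \<in> K" using 1[of m'] K0 by (simp add: Z'_def)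
      show "mcoeff Z' m' \<noteq> 0 \<Longrightarrow> keys m' \<subseteq> V" using 1[of m'] by (simp add: Z'_def split: if_splits)
    qed
    moreover have "F Z m = F Z' m" by (rule cong) (simp add: Z'_def)
    ultimately show ?case using closed[of Z' m] fp by simp
  qed
  then show ?thesis using fp by (intro bexI[of _ Z] series_overI) auto
qed

lemma mdeg_eq_0_iff [simp]: "mdeg m = 0 \<longleftrightarrow> m = 0"
  by (auto simp: mdeg_def in_keys_iff intro!: poly_mapping_eqI)

text \<open>The units of a power series ring are the series whose constant term is a unit.\<close>

definition series_unit :: "'a::comm_ring_1 set \<Rightarrow> 'v set \<Rightarrow> ('v, 'a) mps \<Rightarrow> bool" where
  "series_unit K V u \<longleftrightarrow> u \<in> series_over K V \<and> (\<exists>a\<in>K. mcoeff u 0 * a = 1)"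

lemma series_unit_inverse:
  fixes K :: "'a::idom set" and u :: "('v::linorder, 'a) mps"
  assumes "unital_subring K" "series_unit K V u"
  shows "\<exists>w. series_unit K V w \<and> u * w = 1"
proof -
  interpret K: unital_subring K by fact
  interpret SK: unital_subring "series_over K V :: ('v, 'a) mps set" using unital_subring_series_over[OF assms(1)] .
  obtain a where u: "u \<in> series_over K V" and a: "a \<in> K" "mcoeff u 0 * a = 1"
    using assms(2) by (auto simp: series_unit_def)
  define u' where "u' = u - mconst (mcoeff u 0)"
  have mc: "mconst b \<in> series_over K V" if "b \<in> K" for b using that by (intro mconst_closed) auto
  have u': "u' \<in> series_over K V" unfolding u'_def using u by (intro SK.diff_closed mc) (auto dest: series_overD)
  have u'0: "mcoeff u' 0 = 0" by (simp add: u'_def mcoeff_mconst)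
  \<comment> \<open>With \<open>u'\<close> the part of \<open>u\<close> without constant term, an
    inverse \<open>Z\<close> satisfies \<open>Z = a * (1 - u' * Z)\<close>. The right side at
    \<open>m\<close> involves only coefficients of \<open>Z\<close> of smaller total degree.\<close>
  define F where "F = (\<lambda>Z. mcoeff (mconst a * (1 - u' * Z)))"
  have "\<exists>Z\<in>series_over K V. \<forall>m. mcoeff Z m = F Z m"
  proof (rule mps_fixpoint)
    show "wf (inv_image less_than (mdeg :: ('v \<Rightarrow>\<^sub>0 nat) \<Rightarrow> nat))" by (rule wf_inv_image) simp
    show "0 \<in> K" by simp
    fix Z Z' :: "('v, 'a) mps" and m :: "'v \<Rightarrow>\<^sub>0 nat"
    assume *: "\<And>m'. (m', m) \<in> inv_image less_than mdeg \<Longrightarrow> mcoeff Z m' = mcoeff Z' m'"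
    have "mcoeff (u' * Z) m = mcoeff (u' * Z') m"
    proof (rule mcoeff_mult_cong)
      fix p q assume pq: "p + q = m" "mcoeff u' p \<noteq> 0"
      then have "p \<noteq> 0" using u'0 by auto
      then have "mdeg p \<noteq> 0" by simp
      then have "mdeg q < mdeg m" unfolding pq(1)[symmetric] mdeg_add by linarith
      then show "mcoeff Z q = mcoeff Z' q" using * by simp
    qed
    moreover have "mcoeff (mconst a * f) m = a * mcoeff f m" for f :: "('v, 'a) mps"
      by (subst mcoeff_mult_single[of 0 m]) (auto simp: mcoeff_mconst)
    ultimately show "F Z m = F Z' m" by (simp add: F_def)
  next
    fix Z :: "('v, 'a) mps" and m assume "Z \<in> series_over K V"
    then have "mconst a * (1 - u' * Z) \<in> series_over K V"
      using u' a(1) by (intro SK.mult_closed SK.diff_closed SK.one_closed mc)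
    then show "F Z m \<in> K \<and> (F Z m \<noteq> 0 \<longrightarrow> keys m \<subseteq> V)" by (auto simp: F_def dest: series_overD)
  qed
  then obtain Z where Z: "Z \<in> series_over K V" "Z = mconst a * (1 - u' * Z)"
    unfolding F_def by (auto intro: mps_eqI)
  have "mconst (mcoeff u 0) * Z = mconst (mcoeff u 0 * a) * (1 - u' * Z)"
    by (subst Z(2)) (simp add: mconst_hom)
  then have "mconst (mcoeff u 0) * Z = 1 - u' * Z" by (simp only: a(2) mconst_hom(3) mult_1)
  then have "u * Z = 1" by (simp add: u'_def algebra_simps)
  moreover from this have "mcoeff Z 0 * mcoeff u 0 = 1"
    using mcoeff_mult_0[of u Z] by (simp add: mcoeff_one mult.commute)
  ultimately show ?thesis using Z(1) u by (auto simp: series_unit_def dest: series_overD)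
qed

lemma series_unit_mult:
  fixes K :: "'a::idom set" and u w :: "('v::linorder, 'a) mps"
  assumes "unital_subring K" "series_unit K V u" "series_unit K V w"
  shows "series_unit K V (u * w)"
proof -
  interpret K: unital_subring K by fact
  interpret SK: unital_subring "series_over K V :: ('v, 'a) mps set" using unital_subring_series_over[OF assms(1)] .
  obtain a b where ab: "a \<in> K" "b \<in> K" "mcoeff u 0 * a = 1" "mcoeff w 0 * b = 1"
    using assms(2,3) by (auto simp: series_unit_def)
  have "mcoeff (u * w) 0 * (a * b) = (mcoeff u 0 * a) * (mcoeff w 0 * b)"
    by (simp add: mcoeff_mult_0 mult_ac)
  then show ?thesis using ab assms(2,3) unfolding series_unit_def
    by (metis K.mult_closed SK.mult_closed mult_1)
qed

lemma series_unit_if_dvd_one: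
  fixes K :: "'a::idom set" and u w :: "('v::linorder, 'a) mps"
  assumes "u \<in> series_over K V" "w \<in> series_over K V" "u * w = 1"
  shows "series_unit K V u"
  using assms mcoeff_mult_0[of u w] by (auto simp: series_unit_def mcoeff_one dest: series_overD)

lemma series_unit_mono: "series_unit K V u \<Longrightarrow> K \<subseteq> L \<Longrightarrow> V \<subseteq> W \<Longrightarrow> series_unit L W u"
  using series_over_mono[of K L V W] by (auto simp: series_unit_def)

lemma vanishes_on_zero_mult: "vanishes_on_zero W f \<Longrightarrow> vanishes_on_zero W (f * g)"
  unfolding vanishes_on_zero_def
proof (intro allI impI, rule ccontr)
  fix m assume f: "\<forall>m. keys m \<inter> W = {} \<longrightarrow> mcoeff f m = 0" and m: "keys m \<inter> W = {}" "mcoeff (f * g) m \<noteq> 0"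
  obtain a b where ab: "m = a + b" "mcoeff f a \<noteq> 0" using m(2) by (rule mcoeff_mult_nonzero)
  have "keys a \<inter> W = {}" using m(1) keys_subset_add_left[of a b] unfolding ab(1) by blast
  then show False using f ab(2) by blast
qed

lemma vanishes_on_zero_sum: "(\<And>i. i \<in> I \<Longrightarrow> vanishes_on_zero W (f i)) \<Longrightarrow> vanishes_on_zero W (sum f I)"
  by (simp add: vanishes_on_zero_def mcoeff_sum)

section \<open>Weierstrass preparation\<close>

text \<open>
  \<open>V\<close> consists of the coefficient variables and \<open>W \<subseteq> V\<close> of those on whose zero set all
  non-leading coefficients vanish; \<open>v\<close> is the main variable.
\<close>

definition weierstrass_form ::
    "'a::comm_ring_1 set \<Rightarrow> 'v set \<Rightarrow> 'v set \<Rightarrow> 'v \<Rightarrow> ('v, 'a) mps \<Rightarrow> ('v, 'a) mps poly \<Rightarrow> bool" where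
  "weierstrass_form A W V v F P \<longleftrightarrow>
     P \<in> poly_over (series_over A V) \<and> lead_coeff P = 1 \<and>
     (\<forall>j<degree P. vanishes_on_zero W (coeff P j)) \<and>
     (\<exists>u. series_unit A (insert v V) u \<and> F = u * poly P (mvar v))"

text \<open>For a series in \<open>v\<close> and the coefficient variables, restricting to
  \<open>W = 0\<close> leaves \<open>v ^ d\<close> times a unit. The parameters outside
  \<open>W\<close> are not set to zero in the first condition; this is why the lower coefficients of
  the Weierstrass polynomial vanish on all of \<open>W = 0\<close> and not just at the
  origin.\<close>

definition regular_at ::
    "'a::comm_ring_1 set \<Rightarrow> 'v set \<Rightarrow> 'v \<Rightarrow> nat \<Rightarrow> ('v, 'a) mps \<Rightarrow> bool" where
  "regular_at A W v d F \<longleftrightarrow>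
     (\<forall>m. keys m \<inter> W = {} \<and> lookup m v < d \<longrightarrow> mcoeff F m = 0) \<and>
     (\<exists>a\<in>A. mcoeff F (Poly_Mapping.single v d) * a = 1)"

locale weierstrass = unital_subring A for A :: "'a::idom set" +
  fixes W V :: "'v::linorder set" and v :: 'v
  assumes W: "finite W" "W \<subseteq> V" and v: "v \<notin> V"
begin

abbreviation "SV \<equiv> series_over A V"
abbreviation "SU \<equiv> series_over A (insert v V)"

lemma subring_SV: "unital_subring SV" and subring_SU: "unital_subring SU"
  by (rule unital_subring_series_over[OF unital_subring_axioms])+

interpretation SV: unital_subring SV by (rule subring_SV)
interpretation SU: unital_subring SU by (rule subring_SU)

lemma SV_SU: "f \<in> SV \<Longrightarrow> f \<in> SU"
  using series_over_mono[of A A V "insert v V"] by blast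

lemma mvar_SU: "mvar v \<in> SU"
  by (rule mvar_closed[OF unital_subring_axioms]) simp

lemma poly_SU: "P \<in> poly_over SV \<Longrightarrow> poly P (mvar v) \<in> SU"
  using SV_SU mvar_SU by (intro SU.poly_closed) (auto simp: SV.poly_over_iff SU.poly_over_iff)

lemma v_W: "v \<notin> W" using W v by blast

section \<open>Weierstrass division by a regular series\<close>

definition wdeg :: "('v \<Rightarrow>\<^sub>0 nat) \<Rightarrow> nat" where
  "wdeg m = (\<Sum>w\<in>W. lookup m w)"

lemma wdeg_add: "wdeg (p + q) = wdeg p + wdeg q"
  by (simp add: wdeg_def lookup_add sum.distrib)

lemma wdeg_single [simp]: "wdeg (Poly_Mapping.single v j) = 0"
  using v_W by (auto simp: wdeg_def lookup_single when_def intro!: sum.neutral)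

lemma wdeg_eq_0_iff: "wdeg m = 0 \<longleftrightarrow> keys m \<inter> W = {}"
  using W(1) by (auto simp: wdeg_def in_keys_iff)

definition head :: "nat \<Rightarrow> ('v, 'a) mps \<Rightarrow> ('v, 'a) mps" where
  "head d F = Abs_mps (\<lambda>m. mcoeff F (m + Poly_Mapping.single v d))"

lemma mcoeff_head: "mcoeff (head d F) m = mcoeff F (m + Poly_Mapping.single v d)"
  by (simp add: head_def)

lemma head_SU: "F \<in> SU \<Longrightarrow> head d F \<in> SU"
  using keys_subset_add_left by (fastforce intro!: series_overI simp: mcoeff_head dest: series_overD)

lemma head_mvar_power: "head d (f * mvar v ^ d) = f"
  by (rule mps_eqI) (simp add: mcoeff_head mcoeff_mult_mvar_power lookup_add)

lemma head_diff: "head d (f - g) = head d f - head d g"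
  by (rule mps_eqI) (simp add: mcoeff_head)

lemma head_add: "head d (f + g) = head d f + head d g"
  by (rule mps_eqI) (simp add: mcoeff_head)

lemma head_eq_0_iff: "head d f = 0 \<longleftrightarrow> (\<forall>m. d \<le> lookup m v \<longrightarrow> mcoeff f m = 0)"
proof
  assume *: "head d f = 0"
  show "\<forall>m. d \<le> lookup m v \<longrightarrow> mcoeff f m = 0"
  proof clarify
    fix m :: "'v \<Rightarrow>\<^sub>0 nat" assume "d \<le> lookup m v"
    then have "m = (m - Poly_Mapping.single v d) + Poly_Mapping.single v d"
      using diff_single_add[of d m v] by (simp add: add.commute)
    then show "mcoeff f m = 0" using * mcoeff_head[of d f "m - Poly_Mapping.single v d"] by simp
  qed
next
  assume "\<forall>m. d \<le> lookup m v \<longrightarrow> mcoeff f m = 0"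
  then show "head d f = 0" by (intro mps_eqI) (simp add: mcoeff_head lookup_add)
qed

text \<open>
  \<open>F = head d F * v\<^sup>d + N\<close>, where \<open>head d F\<close> is a unit and all monomials of \<open>N\<close> contain a
  variable of \<open>W\<close>. With \<open>Z = Q * head d F\<close> the equation \<open>head d (G - Q * F) = 0\<close> for division by \<open>F\<close>
  is the fixpoint equation \<open>Z = head d (G - Z * N')\<close>, which is contracting in the degree in \<open>W\<close>.
\<close>

lemma regular_split:
  assumes F: "F \<in> SU" and reg: "regular_at A W v d F"
  obtains Y N' where "Y \<in> SU" "head d F * Y = 1" "N' \<in> SU"
    "F = head d F * (mvar v ^ d + N')" "\<And>m. mcoeff N' m \<noteq> 0 \<Longrightarrow> wdeg m \<noteq> 0" "F * Y = mvar v ^ d + N'"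
proof -
  have "series_unit A (insert v V) (head d F)"
    using reg head_SU[OF F, of d] by (auto simp: series_unit_def regular_at_def mcoeff_head)
  then obtain Y where Y: "Y \<in> SU" "head d F * Y = 1"
    using series_unit_inverse[OF unital_subring_axioms] by (auto simp: series_unit_def)
  define N where "N = F - head d F * mvar v ^ d"
  have N: "N \<in> SU" unfolding N_def by (intro SU.diff_closed SU.mult_closed SU.power_closed mvar_SU head_SU F)
  have N0: "wdeg m \<noteq> 0" if "mcoeff N m \<noteq> 0" for m
  proof
    assume "wdeg m = 0"
    then have k: "keys m \<inter> W = {}" by (simp add: wdeg_eq_0_iff)
    have "mcoeff N m = 0"
    proof (cases "d \<le> lookup m v")
      case True
      have "head d N = 0" by (simp add: N_def head_diff head_mvar_power)
      then show ?thesis using True by (simp add: head_eq_0_iff)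
    next
      case False
      then show ?thesis using reg k by (simp add: N_def regular_at_def mcoeff_mult_mvar_power)
    qed
    then show False using that by simp
  qed
  have "wdeg m \<noteq> 0" if "mcoeff (Y * N) m \<noteq> 0" for m
    using that N0 wdeg_add by (metis add_is_0 mcoeff_mult_nonzero)
  moreover have FY: "F * Y = mvar v ^ d + Y * N"
  proof -
    have "F = head d F * mvar v ^ d + N" by (simp add: N_def)
    then have "F * Y = (head d F * Y) * mvar v ^ d + Y * N" by (metis distrib_right mult.assoc mult.commute)
    then show ?thesis using Y(2) by simp
  qed
  moreover have "F = head d F * (mvar v ^ d + Y * N)"
  proof -
    have "head d F * (F * Y) = F * (head d F * Y)" by (simp only: mult_ac)
    then show ?thesis unfolding FY Y(2) by simp
  qed
  ultimately show ?thesis using that[of Y "Y * N"] Y N SU.mult_closed by blast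
qed

lemma head_mult_cong:
  assumes N': "\<And>m. mcoeff N' m \<noteq> 0 \<Longrightarrow> wdeg m \<noteq> 0"
    and Z: "\<And>m'. wdeg m' < wdeg m \<Longrightarrow> mcoeff Z m' = mcoeff Z' m'"
  shows "mcoeff (head d (N' * Z)) m = mcoeff (head d (N' * Z')) m"
  unfolding mcoeff_head
proof (rule mcoeff_mult_cong)
  fix p q assume pq: "p + q = m + Poly_Mapping.single v d" "mcoeff N' p \<noteq> 0"
  have "wdeg p + wdeg q = wdeg m" using arg_cong[OF pq(1), of wdeg] by (simp add: wdeg_add)
  then have "wdeg q < wdeg m" using N'[OF pq(2)] by simp
  then show "mcoeff Z q = mcoeff Z' q" by (rule Z)
qed

lemma weierstrass_division:
  assumes F: "F \<in> SU" and reg: "regular_at A W v d F" and G: "G \<in> SU"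
  shows "\<exists>Q\<in>SU. head d (G - Q * F) = 0"
proof -
  obtain Y N' where Y: "Y \<in> SU" "head d F * Y = 1" "N' \<in> SU"
    and N': "\<And>m. mcoeff N' m \<noteq> 0 \<Longrightarrow> wdeg m \<noteq> 0" and FY: "F * Y = mvar v ^ d + N'"
    using regular_split[OF F reg] by metis
  have "\<exists>Z\<in>SU. \<forall>m. mcoeff Z m = mcoeff (head d (G - N' * Z)) m"
  proof (rule mps_fixpoint)
    show "wf (inv_image less_than wdeg)" by (rule wf_inv_image) simp
    fix Z Z' :: "('v, 'a) mps" and m
    assume "\<And>m'. (m', m) \<in> inv_image less_than wdeg \<Longrightarrow> mcoeff Z m' = mcoeff Z' m'"
    then have "mcoeff (head d (N' * Z)) m = mcoeff (head d (N' * Z')) m"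
      by (intro head_mult_cong N') auto
    then show "mcoeff (head d (G - N' * Z)) m = mcoeff (head d (G - N' * Z')) m"
      by (simp add: head_diff)
  next
    fix Z :: "('v, 'a) mps" and m assume "Z \<in> SU"
    then have "head d (G - N' * Z) \<in> SU" by (intro head_SU SU.diff_closed SU.mult_closed G Y)
    then show "mcoeff (head d (G - N' * Z)) m \<in> A \<and> (mcoeff (head d (G - N' * Z)) m \<noteq> 0 \<longrightarrow> keys m \<subseteq> insert v V)"
      by (auto dest: series_overD)
  qed simp
  then obtain Z where Z: "Z \<in> SU" "Z = head d (G - N' * Z)"
    by (auto intro: mps_eqI)
  have "Z * Y * F = Z * mvar v ^ d + N' * Z"
    by (metis FY distrib_left mult.assoc mult.commute)
  then have "G - Z * Y * F = (G - N' * Z) - Z * mvar v ^ d" by simp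
  then have "head d (G - Z * Y * F) = 0"
    using Z(2) by (simp only: head_diff head_mvar_power) simp
  then show ?thesis using Z(1) Y(1) by (intro bexI[of _ "Z * Y"]) auto
qed

text \<open>\<open>Z = Q * head d F\<close> solves the homogeneous fixpoint equation, and the same
  contraction makes its coefficients vanish by induction on the degree in \<open>W\<close>.\<close>

lemma weierstrass_division_unique:
  assumes F: "F \<in> SU" and reg: "regular_at A W v d F" and Q: "head d (Q * F) = 0"
  shows "Q = 0"
proof -
  obtain Y N' where Y: "head d F * Y = 1"
    and N': "\<And>m. mcoeff N' m \<noteq> 0 \<Longrightarrow> wdeg m \<noteq> 0" and FN: "F = head d F * (mvar v ^ d + N')"
    using regular_split[OF F reg] by metis
  define Z where "Z = Q * head d F"
  have "Q * F = Z * mvar v ^ d + N' * Z"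
    by (subst FN) (simp add: Z_def algebra_simps)
  then have Z: "Z = - head d (N' * Z)"
    using Q by (simp add: head_add head_mvar_power eq_neg_iff_add_eq_0)
  have "mcoeff Z m = 0" for m
  proof (induction "wdeg m" arbitrary: m rule: less_induct)
    case less
    have "mcoeff (head d (N' * Z)) m = mcoeff (head d (N' * 0)) m"
      by (rule head_mult_cong[OF N']) (use less in auto)
    then show ?case by (subst Z) (simp add: mcoeff_head)
  qed
  then have "Z = 0" by (intro mps_eqI) simp
  then have "Q * (head d F * Y) = 0" by (simp add: Z_def flip: mult.assoc)
  then show ?thesis using Y by simp
qed

text \<open>Reads a series of degree below \<open>d\<close> in \<open>v\<close> as a polynomial in
  \<open>v\<close>; the test on \<open>lookup m v\<close> keeps \<open>v\<close> out of the
  coefficients.\<close>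

definition low_poly :: "nat \<Rightarrow> ('v, 'a) mps \<Rightarrow> ('v, 'a) mps poly" where
  "low_poly d R = (\<Sum>j<d. monom (Abs_mps (\<lambda>m. if lookup m v = 0 then mcoeff R (m + Poly_Mapping.single v j) else 0)) j)"

lemma coeff_low_poly:
  "coeff (low_poly d R) i = (if i < d then Abs_mps (\<lambda>m. if lookup m v = 0 then mcoeff R (m + Poly_Mapping.single v i) else 0) else 0)"
  by (simp add: low_poly_def coeff_sum)

lemma low_poly_closed:
  assumes "R \<in> SU"
  shows "low_poly d R \<in> poly_over SV"
proof -
  have "Abs_mps (\<lambda>m. if lookup m v = 0 then mcoeff R (m + Poly_Mapping.single v i) else 0) \<in> SV" for i
  proof (rule series_overI)
    fix m
    assume "mcoeff (Abs_mps (\<lambda>m. if lookup m v = 0 then mcoeff R (m + Poly_Mapping.single v i) else 0)) m \<noteq> 0"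
    then have *: "lookup m v = 0" "mcoeff R (m + Poly_Mapping.single v i) \<noteq> 0" by (auto split: if_splits)
    have "keys m \<subseteq> insert v V" using series_overD(2)[OF assms *(2)] keys_subset_add_left[of m] by blast
    then show "keys m \<subseteq> V" using *(1) by (auto simp: in_keys_iff)
  qed (use assms in \<open>auto dest: series_overD\<close>)
  then show ?thesis by (auto simp: SV.poly_over_iff coeff_low_poly)
qed

lemma poly_low_poly:
  assumes "R \<in> SU" "head d R = 0"
  shows "poly (low_poly d R) (mvar v) = R"
proof (rule mps_eqI)
  fix m :: "'v \<Rightarrow>\<^sub>0 nat"
  let ?j = "lookup m v"
  have "(m - Poly_Mapping.single v ?j) + Poly_Mapping.single v ?j = m"
    using diff_single_add[of ?j m v] by (simp add: add.commute)
  then have "mcoeff (coeff (low_poly d R) ?j) (m - Poly_Mapping.single v ?j) = (if ?j < d then mcoeff R m else 0)"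
    by (simp add: coeff_low_poly lookup_minus)
  moreover have "mcoeff R m = 0" if "\<not> ?j < d" using assms(2) that by (simp add: head_eq_0_iff)
  ultimately show "mcoeff (poly (low_poly d R) (mvar v)) m = mcoeff R m"
    using mcoeff_poly_mvar[OF low_poly_closed[OF assms(1)] v zero_closed, of d m] by auto
qed

text \<open>Divide \<open>v ^ d\<close> by \<open>F\<close>. The Weierstrass polynomial is
  \<open>v ^ d\<close> minus the remainder, that is \<open>Q * F\<close>, and comparing coefficients
  at \<open>v ^ d\<close> shows that \<open>Q\<close> is a unit. A single coefficient of
  \<open>F\<close> has to be invertible in \<open>A\<close>, so the result is available over
  localizations.\<close>

lemma weierstrass_exists:
  assumes F: "F \<in> SU" and reg: "regular_at A W v d F"
  shows "\<exists>P. weierstrass_form A W V v F P \<and> degree P = d"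
proof -
  obtain Q where Q: "Q \<in> SU" "head d (mvar v ^ d - Q * F) = 0"
    using weierstrass_division[OF F reg SU.power_closed[OF mvar_SU]] by blast
  define R where "R = mvar v ^ d - Q * F"
  have R: "R \<in> SU" unfolding R_def by (intro SU.diff_closed SU.power_closed SU.mult_closed mvar_SU Q F)
  define P where "P = monom 1 d - low_poly d R"
  have PV: "P \<in> poly_over SV"
    using low_poly_closed[OF R, of d] unfolding P_def SV.poly_over_iff by auto
  have cP: "coeff P i = (if i = d then 1 else if i < d then - coeff (low_poly d R) i else 0)" for i
    by (auto simp: P_def coeff_low_poly)
  have degP: "degree P = d"
    using cP by (intro antisym degree_le le_degree) auto
  have Px: "poly P (mvar v) = Q * F"
    using poly_low_poly[OF R, of d] Q(2) by (simp add: P_def poly_monom R_def)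
  have QF: "mcoeff (Q * F) m = 0" if "keys m \<inter> W = {}" "lookup m v < d" for m :: "'v \<Rightarrow>\<^sub>0 nat"
  proof (rule ccontr)
    assume "mcoeff (Q * F) m \<noteq> 0"
    then obtain a b where ab: "m = a + b" "mcoeff F b \<noteq> 0" by (rule mcoeff_mult_nonzero)
    then have "keys b \<inter> W = {}" "lookup b v < d" using that keys_subset_add_right[of b a] by (auto simp: lookup_add)
    then show False using reg ab(2) by (simp add: regular_at_def)
  qed
  have van: "vanishes_on_zero W (coeff P j)" if "j < d" for j
    unfolding vanishes_on_zero_def
  proof clarify
    fix m :: "'v \<Rightarrow>\<^sub>0 nat" assume m: "keys m \<inter> W = {}"
    show "mcoeff (coeff P j) m = 0"
    proof (cases "lookup m v = 0")
      case True
      let ?m = "m + Poly_Mapping.single v j"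
      have "keys ?m \<inter> W = {}" using m v_W keys_add[of m "Poly_Mapping.single v j"] by (auto split: if_splits)
      moreover have lt: "lookup ?m v < d" using True that by (simp add: lookup_add)
      moreover have "?m \<noteq> Poly_Mapping.single v d" using lt by (metis less_irrefl lookup_single_eq)
      ultimately have "mcoeff R ?m = 0"
        using QF[of ?m] by (simp add: R_def mvar_power mcoeff_mmon)
      then show ?thesis using that by (simp add: cP coeff_low_poly)
    next
      case False
      then show ?thesis using that by (simp add: cP coeff_low_poly)
    qed
  qed
  have "mcoeff (Q * F) (Poly_Mapping.single v d) = mcoeff Q 0 * mcoeff F (Poly_Mapping.single v d)"
  proof (rule mcoeff_mult_single)
    fix a b assume ab: "a + b = Poly_Mapping.single v d" "(a, b) \<noteq> (0, Poly_Mapping.single v d)"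
    show "mcoeff Q a * mcoeff F b = 0"
    proof (cases "lookup b v < d")
      case True
      have "keys b \<inter> W = {}" using keys_subset_add_right[of b a] ab(1) v_W by (auto split: if_splits)
      then show ?thesis using True reg by (simp add: regular_at_def)
    next
      case False
      have sum: "lookup a w + lookup b w = (if w = v then d else 0)" for w
        using arg_cong[OF ab(1), of "\<lambda>m. lookup m w"] by (simp add: lookup_add lookup_single when_def eq_commute)
      have "lookup a w = 0" for w using sum[of w] False by (cases "w = v") auto
      then have "a = 0" by (intro poly_mapping_eqI) simp
      then show ?thesis using ab by simp
    qed
  qed simp
  moreover have "mcoeff (Q * F) (Poly_Mapping.single v d) = 1"
  proof -
    have "mcoeff R (Poly_Mapping.single v d) = 0" using Q(2) by (simp add: head_eq_0_iff R_def[symmetric])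
    then show ?thesis by (simp add: R_def mvar_power mcoeff_mmon)
  qed
  ultimately have "mcoeff Q 0 * mcoeff F (Poly_Mapping.single v d) = 1" by simp
  then have "series_unit A (insert v V) Q" using Q(1) F by (auto simp: series_unit_def dest: series_overD)
  then obtain u where u: "series_unit A (insert v V) u" "Q * u = 1"
    using series_unit_inverse[OF unital_subring_axioms] by blast
  have "u * poly P (mvar v) = (Q * u) * F" unfolding Px by (simp only: mult_ac)
  then have "F = u * poly P (mvar v)" by (simp add: u(2))
  then show ?thesis
    using PV degP cP van u(1) unfolding weierstrass_form_def by auto
qed

section \<open>Uniqueness and factors of Weierstrass polynomials\<close>

lemma pseudo_mcoeff:
  assumes P: "P \<in> poly_over SV" "lead_coeff P = 1" "\<forall>j<degree P. vanishes_on_zero W (coeff P j)"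
    and m: "keys (m :: 'v \<Rightarrow>\<^sub>0 nat) \<inter> W = {}"
  shows "mcoeff (poly P (mvar v)) m = (if m = Poly_Mapping.single v (degree P) then 1 else 0)"
proof -
  let ?j = "lookup m v"
  have eq: "mcoeff (poly P (mvar v)) m = mcoeff (coeff P ?j) (m - Poly_Mapping.single v ?j)"
    by (rule mcoeff_poly_mvar[OF P(1) v zero_closed])
  consider "?j < degree P" | "?j = degree P" | "?j > degree P" by linarith
  then show ?thesis
  proof cases
    case 1
    have "keys (m - Poly_Mapping.single v ?j) \<subseteq> keys m" by (auto simp: in_keys_iff lookup_minus)
    then have "mcoeff (coeff P ?j) (m - Poly_Mapping.single v ?j) = 0"
      using P(3) 1 m unfolding vanishes_on_zero_def by blast
    then show ?thesis using eq 1 by auto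
  next
    case 2
    then have "coeff P ?j = 1" using P(2) by simp
    moreover have "m - Poly_Mapping.single v ?j = 0 \<longleftrightarrow> m = Poly_Mapping.single v (degree P)"
      using diff_single_add[of ?j m v] 2 by (metis add.right_neutral diff_self_eq_0 add_diff_cancel_left' le_refl)
    ultimately show ?thesis using eq by (simp add: mcoeff_one)
  next
    case 3
    then show ?thesis using eq by (auto simp: coeff_eq_0)
  qed
qed

lemma weierstrass_form_series:
  assumes "weierstrass_form A W V v F P"
  shows "F \<in> SU"
  using assms poly_SU unfolding weierstrass_form_def series_unit_def by auto

lemma regular_if_weierstrass_form:
  assumes "weierstrass_form A W V v F P"
  shows "regular_at A W v (degree P) F"
proof -
  obtain u where P: "P \<in> poly_over SV" "lead_coeff P = 1" "\<forall>j<degree P. vanishes_on_zero W (coeff P j)"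
    and u: "series_unit A (insert v V) u" "F = u * poly P (mvar v)"
    using assms unfolding weierstrass_form_def by blast
  note pm = pseudo_mcoeff[OF P]
  show ?thesis
    unfolding regular_at_def
  proof (intro conjI allI impI)
    fix m :: "'v \<Rightarrow>\<^sub>0 nat" assume m: "keys m \<inter> W = {} \<and> lookup m v < degree P"
    show "mcoeff F m = 0"
    proof (rule ccontr)
      assume "mcoeff F m \<noteq> 0"
      then obtain a b where ab: "m = a + b" "mcoeff (poly P (mvar v)) b \<noteq> 0"
        unfolding u(2) by (rule mcoeff_mult_nonzero)
      have "keys b \<inter> W = {}" using m keys_subset_add_right[of b a] ab(1) by blast
      then have "b = Poly_Mapping.single v (degree P)" using pm[of b] ab(2) by (auto split: if_splits)
      then show False using ab(1) m by (simp add: lookup_add)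
    qed
  next
    have "mcoeff F (Poly_Mapping.single v (degree P)) = mcoeff u 0 * mcoeff (poly P (mvar v)) (Poly_Mapping.single v (degree P))"
      unfolding u(2)
    proof (rule mcoeff_mult_single)
      fix a b assume ab: "a + b = Poly_Mapping.single v (degree P)" "(a, b) \<noteq> (0, Poly_Mapping.single v (degree P))"
      have "keys b \<inter> W = {}" using keys_subset_add_right[of b a] ab(1) v_W by (auto split: if_splits)
      moreover have "b \<noteq> Poly_Mapping.single v (degree P)" using ab by auto
      ultimately show "mcoeff u a * mcoeff (poly P (mvar v)) b = 0" using pm[of b] by simp
    qed simp
    moreover have "keys (Poly_Mapping.single v (degree P)) \<inter> W = {}" using v_W by auto
    ultimately have "mcoeff F (Poly_Mapping.single v (degree P)) = mcoeff u 0" using pm by simp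
    then show "\<exists>a\<in>A. mcoeff F (Poly_Mapping.single v (degree P)) * a = 1"
      using u(1) by (auto simp: series_unit_def)
  qed
qed

lemma regular_at_unique:
  assumes "regular_at A W v d F" "regular_at B W v e F"
  shows "d = e"
proof -
  have k: "keys (Poly_Mapping.single v i) \<inter> W = {}" for i :: nat using v_W by auto
  have "mcoeff F (Poly_Mapping.single v d) \<noteq> 0" "mcoeff F (Poly_Mapping.single v e) \<noteq> 0"
    using assms by (auto simp: regular_at_def)
  then have "\<not> d < e" "\<not> e < d" using assms k unfolding regular_at_def
    by (metis lookup_single_eq)+
  then show ?thesis by simp
qed

text \<open>With \<open>u'\<close> and \<open>w'\<close> the inverses of the two units,
  \<open>(u' - w') * F\<close> is the value of \<open>P - Q\<close>, whose degree in
  \<open>v\<close> is below the order of \<open>F\<close>. Uniqueness of division by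
  \<open>F\<close> gives \<open>u' = w'\<close>.\<close>

lemma weierstrass_form_unique:
  assumes "weierstrass_form A W V v F P" "weierstrass_form A W V v F Q"
  shows "P = Q"
proof -
  obtain u w where P: "P \<in> poly_over SV" "lead_coeff P = 1" and Q: "Q \<in> poly_over SV" "lead_coeff Q = 1"
    and u: "series_unit A (insert v V) u" "F = u * poly P (mvar v)"
    and w: "series_unit A (insert v V) w" "F = w * poly Q (mvar v)"
    using assms unfolding weierstrass_form_def by blast
  have deg: "degree P = degree Q"
    by (rule regular_at_unique[OF regular_if_weierstrass_form[OF assms(1)] regular_if_weierstrass_form[OF assms(2)]])
  obtain u' w' where uw: "u * u' = 1" "w * w' = 1"
    using series_unit_inverse[OF unital_subring_axioms] u(1) w(1) by metis
  have "u' * F = (u * u') * poly P (mvar v)" unfolding u(2) by (simp only: mult_ac)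
  moreover have "w' * F = (w * w') * poly Q (mvar v)" unfolding w(2) by (simp only: mult_ac)
  ultimately have "u' * F = poly P (mvar v)" "w' * F = poly Q (mvar v)" by (simp_all only: uw mult_1)
  then have eq: "(u' - w') * F = poly (P - Q) (mvar v)" by (simp add: algebra_simps)
  have PQ: "P - Q \<in> poly_over SV" using P Q by (auto simp: SV.poly_over_iff)
  have c: "coeff (P - Q) i = 0" if "degree P \<le> i" for i
    using that P Q deg by (cases "i = degree P") (auto simp: coeff_eq_0)
  have "head (degree P) ((u' - w') * F) = 0"
    unfolding eq head_eq_0_iff by (simp add: mcoeff_poly_mvar[OF PQ v zero_closed] c del: coeff_diff poly_diff)
  then have "u' - w' = 0"
    by (rule weierstrass_division_unique[OF weierstrass_form_series[OF assms(1)] regular_if_weierstrass_form[OF assms(1)]])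
  then have "poly P (mvar v) = poly Q (mvar v)" using eq by simp
  then show ?thesis by (rule poly_mvar_inject[OF P(1) Q(1) v zero_closed])
qed

lemma weierstrass_form_mult:
  assumes "weierstrass_form A W V v F P" "weierstrass_form A W V v G Q"
  shows "weierstrass_form A W V v (F * G) (P * Q)"
proof -
  interpret PV: unital_subring "poly_over SV" by (rule SV.unital_subring_poly_over)
  obtain u w where P: "P \<in> poly_over SV" "lead_coeff P = 1" "\<forall>j<degree P. vanishes_on_zero W (coeff P j)"
    and Q: "Q \<in> poly_over SV" "lead_coeff Q = 1" "\<forall>j<degree Q. vanishes_on_zero W (coeff Q j)"
    and u: "series_unit A (insert v V) u" "F = u * poly P (mvar v)"
    and w: "series_unit A (insert v V) w" "G = w * poly Q (mvar v)"
    using assms unfolding weierstrass_form_def by blast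
  have nz: "P \<noteq> 0" "Q \<noteq> 0" using P(2) Q(2) by auto
  have "vanishes_on_zero W (coeff (P * Q) j)" if "j < degree (P * Q)" for j
    unfolding coeff_mult
  proof (rule vanishes_on_zero_sum)
    fix i assume "i \<in> {..j}"
    then have "i < degree P \<or> j - i < degree Q" using that nz by (auto simp: degree_mult_eq)
    then show "vanishes_on_zero W (coeff P i * coeff Q (j - i))"
      using P(3) Q(3) vanishes_on_zero_mult by (metis mult.commute)
  qed
  moreover have "F * G = (u * w) * poly (P * Q) (mvar v)" by (simp add: u(2) w(2) mult_ac)
  moreover have "series_unit A (insert v V) (u * w)" by (rule series_unit_mult[OF unital_subring_axioms u(1) w(1)])
  moreover have "lead_coeff (P * Q) = 1" using P(2) Q(2) by (simp add: lead_coeff_mult)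
  ultimately show ?thesis unfolding weierstrass_form_def using P(1) Q(1) PV.mult_closed by blast
qed

text \<open>The lowest coefficients in \<open>v\<close> of \<open>F\<close> and \<open>H\<close>, both restricted to \<open>W = 0\<close>, multiply to that of \<open>F * H\<close>.\<close>

lemma regular_factor:
  assumes FH: "F * H = poly P (mvar v)"
    and P: "P \<in> poly_over SV" "lead_coeff P = 1" "\<forall>j<degree P. vanishes_on_zero W (coeff P j)"
    and F: "F \<in> SU" and inv: "\<And>a. a \<in> A \<Longrightarrow> a \<noteq> 0 \<Longrightarrow> \<exists>b\<in>A. a * b = 1"
  shows "\<exists>d. regular_at A W v d F"
proof -
  define C where "C = (\<lambda>(f :: ('v, 'a) mps) e. \<exists>m. keys m \<inter> W = {} \<and> lookup m v = e \<and> mcoeff f m \<noteq> 0)"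
  have top: "mcoeff (F * H) (Poly_Mapping.single v (degree P)) \<noteq> 0"
    unfolding FH using pseudo_mcoeff[OF P, of "Poly_Mapping.single v (degree P)"] v_W by auto
  obtain a b where ab: "Poly_Mapping.single v (degree P) = a + b" "mcoeff F a \<noteq> 0" "mcoeff H b \<noteq> 0"
    using mcoeff_mult_nonzero[OF top] by blast
  have "keys (a + b) \<inter> W = {}" using v_W by (simp flip: ab(1))
  then have "keys a \<inter> W = {}" "keys b \<inter> W = {}" using keys_subset_add_left[of a b] keys_subset_add_right[of b a] by auto
  then have ex: "\<exists>e. C F e" "\<exists>e. C H e" using ab by (auto simp: C_def)
  define e e' where "e = (LEAST e. C F e)" and "e' = (LEAST e. C H e)"
  have Ce: "C F e" "C H e'" using LeastI_ex[OF ex(1)] LeastI_ex[OF ex(2)] unfolding e_def e'_def by blast+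
  have low: "mcoeff F m = 0" if "keys m \<inter> W = {}" "lookup m v < e" for m
  proof (rule ccontr)
    assume "mcoeff F m \<noteq> 0"
    then have "C F (lookup m v)" using that(1) unfolding C_def by blast
    then have "e \<le> lookup m v" unfolding e_def by (rule Least_le)
    then show False using that(2) by simp
  qed
  have low': "mcoeff H m = 0" if "keys m \<inter> W = {}" "lookup m v < e'" for m
  proof (rule ccontr)
    assume "mcoeff H m \<noteq> 0"
    then have "C H (lookup m v)" using that(1) unfolding C_def by blast
    then have "e' \<le> lookup m v" unfolding e'_def by (rule Least_le)
    then show False using that(2) by simp
  qed
  define L where "L = (\<lambda>(f :: ('v, 'a) mps) e. Abs_mps (\<lambda>m. if keys m \<inter> W = {} \<and> lookup m v = 0 then mcoeff f (m + Poly_Mapping.single v e) else 0))"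
  have nonzero: "L f e \<noteq> 0" if Cfe: "C f e" for f e
  proof -
    obtain m where m: "keys m \<inter> W = {}" "lookup m v = e" "mcoeff f m \<noteq> 0" using Cfe by (auto simp: C_def)
    let ?m = "m - Poly_Mapping.single v e"
    have "?m + Poly_Mapping.single v e = m" using diff_single_add[of e m v] m(2) by (simp add: add.commute)
    moreover have "keys ?m \<subseteq> keys m" by (auto simp: in_keys_iff lookup_minus)
    then have "keys ?m \<inter> W = {}" using m(1) by blast
    ultimately have "mcoeff (L f e) ?m \<noteq> 0" using m by (simp add: L_def lookup_minus)
    then show ?thesis by auto
  qed
  \<comment> \<open>Among the decompositions of the exponent \<open>e + e'\<close> of
    \<open>v\<close> only \<open>e\<close> and \<open>e'\<close> contribute; in any other one factor
    lies below its lowest exponent.\<close>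
  have prod: "mcoeff (L F e * L H e') m = mcoeff (F * H) (m + Poly_Mapping.single v (e + e'))"
    if m: "keys m \<inter> W = {}" "lookup m v = 0" for m
  proof -
    have "(\<Sum>(p, q)\<in>splits m. mcoeff (L F e) p * mcoeff (L H e') q) =
        (\<Sum>(p, q)\<in>{(p, q). p + q = m + Poly_Mapping.single v (e + e') \<and> lookup p v = e \<and> lookup q v = e'}. mcoeff F p * mcoeff H q)"
    proof (rule sum.reindex_bij_witness[of _
        "\<lambda>(p, q). (p - Poly_Mapping.single v e, q - Poly_Mapping.single v e')"
        "\<lambda>(p, q). (p + Poly_Mapping.single v e, q + Poly_Mapping.single v e')"], goal_cases)
      case (1 x)
      obtain p q where x: "x = (p, q)" by fastforce
      show ?case unfolding x by simp
    next
      case (2 x)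
      obtain p q where x: "x = (p, q)" by fastforce
      have "lookup p v + lookup q v = 0" using 2 m(2) by (metis x lookup_add splits_iff)
      moreover have "p + q = m" using 2 x by simp
      ultimately show ?case using x by (auto simp: lookup_add single_add algebra_simps)
    next
      case (3 x)
      obtain p q where x: "x = (p, q)" by fastforce
      have "p = Poly_Mapping.single v e + (p - Poly_Mapping.single v e)" "q = Poly_Mapping.single v e' + (q - Poly_Mapping.single v e')"
        using 3 x diff_single_add by (metis (mono_tags, lifting) case_prodD mem_Collect_eq order_refl)+
      then show ?case unfolding x by (simp add: add.commute)
    next
      case (4 x)
      obtain p q where x: "x = (p, q)" "p + q = m + Poly_Mapping.single v (e + e')" "lookup p v = e" "lookup q v = e'" using 4 by fastforce
      have "(p - Poly_Mapping.single v e) + (q - Poly_Mapping.single v e') = m"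
      proof (rule poly_mapping_eqI)
        fix w
        have "lookup p w + lookup q w = lookup m w + (if w = v then e + e' else 0)"
          using arg_cong[OF x(2), of "\<lambda>m. lookup m w"] by (simp add: lookup_add lookup_single when_def)
        then show "lookup ((p - Poly_Mapping.single v e) + (q - Poly_Mapping.single v e')) w = lookup m w"
          using x by (auto simp: lookup_add lookup_minus lookup_single when_def)
      qed
      then show ?case using x by simp
    next
      case (5 x)
      obtain p q where x: "x = (p, q)" "p + q = m" using 5 by (cases x) simp
      then have "keys p \<inter> W = {}" "keys q \<inter> W = {}" using m keys_subset_add_left[of p q] keys_subset_add_right[of q p] by auto
      moreover have "lookup p v = 0" "lookup q v = 0" using m(2) x by (auto simp: lookup_add)
      ultimately show ?case using x by (simp add: L_def)
    qed
    also have "\<dots> = (\<Sum>(p, q)\<in>splits (m + Poly_Mapping.single v (e + e')). mcoeff F p * mcoeff H q)"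
    proof (rule sum.mono_neutral_left)
      show "finite (splits (m + Poly_Mapping.single v (e + e')))" by simp
      show "{(p, q). p + q = m + Poly_Mapping.single v (e + e') \<and> lookup p v = e \<and> lookup q v = e'} \<subseteq> splits (m + Poly_Mapping.single v (e + e'))"
        by (auto simp: splits_def)
      show "\<forall>i\<in>splits (m + Poly_Mapping.single v (e + e')) - {(p, q). p + q = m + Poly_Mapping.single v (e + e') \<and> lookup p v = e \<and> lookup q v = e'}.
          (case i of (p, q) \<Rightarrow> mcoeff F p * mcoeff H q) = 0"
      proof
        fix i assume "i \<in> splits (m + Poly_Mapping.single v (e + e')) - {(p, q). p + q = m + Poly_Mapping.single v (e + e') \<and> lookup p v = e \<and> lookup q v = e'}"
        moreover obtain p q where i: "i = (p, q)" by (cases i)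
        ultimately have pq: "p + q = m + Poly_Mapping.single v (e + e')" "\<not> (lookup p v = e \<and> lookup q v = e')"
          by simp_all
        have "keys (m + Poly_Mapping.single v (e + e')) \<inter> W = {}"
          using m(1) v_W keys_add[of m "Poly_Mapping.single v (e + e')"] by (auto split: if_splits)
        then have k: "keys p \<inter> W = {}" "keys q \<inter> W = {}"
          unfolding pq(1)[symmetric] using keys_subset_add_left[of p q] keys_subset_add_right[of q p] by blast+
        have "lookup p v + lookup q v = e + e'"
          using m(2) arg_cong[OF pq(1), of "\<lambda>m. lookup m v"] by (simp add: lookup_add)
        then have "lookup p v < e \<or> lookup q v < e'" using pq(2) by linarith
        then have "mcoeff F p = 0 \<or> mcoeff H q = 0" using low low' k by blast
        then show "(case i of (p, q) \<Rightarrow> mcoeff F p * mcoeff H q) = 0" unfolding i by auto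
      qed
    qed
    finally show ?thesis by (simp add: mcoeff_mult)
  qed
  \<comment> \<open>On \<open>W = 0\<close> the product \<open>F * H\<close> is a pure power of
    \<open>v\<close>. So the product of the two lowest coefficients, nonzero in a domain, is
    concentrated at the monomial 1, and both have nonzero constant terms.\<close>
  have "L F e * L H e' \<noteq> 0" using nonzero Ce by simp
  then obtain m where m: "mcoeff (L F e * L H e') m \<noteq> 0" by (metis mcoeff_zero mps_eqI)
  then obtain p q where pq: "m = p + q" "mcoeff (L F e) p \<noteq> 0" "mcoeff (L H e') q \<noteq> 0" by (rule mcoeff_mult_nonzero)
  then have mk: "keys m \<inter> W = {}" "lookup m v = 0"
    using keys_add[of p q] by (auto simp: L_def lookup_add split: if_splits)
  let ?m = "m + Poly_Mapping.single v (e + e')"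
  have "keys ?m \<inter> W = {}" using mk v_W keys_add[of m "Poly_Mapping.single v (e + e')"] by (auto split: if_splits)
  moreover have "mcoeff (poly P (mvar v)) ?m \<noteq> 0" using prod[OF mk] m FH by simp
  ultimately have "?m = Poly_Mapping.single v (degree P)" using pseudo_mcoeff[OF P, of ?m] by (auto split: if_splits)
  then have lm: "lookup ?m w = lookup (Poly_Mapping.single v (degree P)) w" for w by simp
  have "lookup m w = 0" for w
    using lm[of w] mk(2) by (cases "w = v") (auto simp: lookup_add lookup_single)
  then have "m = 0" by (intro poly_mapping_eqI) simp
  then have "mcoeff (L F e) 0 \<noteq> 0" using m mcoeff_mult_0[of "L F e" "L H e'"] by auto
  then have "mcoeff F (Poly_Mapping.single v e) \<noteq> 0" by (simp add: L_def)
  then have "\<exists>a\<in>A. mcoeff F (Poly_Mapping.single v e) * a = 1" using inv F by (auto dest: series_overD)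
  then show ?thesis using low unfolding regular_at_def by blast
qed

text \<open>Both factors are regular and have Weierstrass polynomials. Their product is a
  Weierstrass polynomial of \<open>poly P (mvar v)\<close>, hence equals \<open>P\<close>. It is
  applied to discriminants that divide a member of a system.\<close>

lemma weierstrass_factor:
  assumes FH: "F * H = poly P (mvar v)"
    and P: "P \<in> poly_over SV" "lead_coeff P = 1" "\<forall>j<degree P. vanishes_on_zero W (coeff P j)"
    and F: "F \<in> SU" "H \<in> SU" and inv: "\<And>a. a \<in> A \<Longrightarrow> a \<noteq> 0 \<Longrightarrow> \<exists>b\<in>A. a * b = 1"
  shows "\<exists>Q. weierstrass_form A W V v F Q \<and> Q dvd P"
proof -
  obtain d where "regular_at A W v d F" using regular_factor[OF FH P F(1) inv] by blast
  then obtain Q where Q: "weierstrass_form A W V v F Q" using weierstrass_exists[OF F(1)] by blast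
  have HF: "H * F = poly P (mvar v)" using FH by (simp add: mult.commute)
  obtain d' where "regular_at A W v d' H" using regular_factor[OF HF P F(2) inv] by blast
  then obtain Q' where Q': "weierstrass_form A W V v H Q'" using weierstrass_exists[OF F(2)] by blast
  have "weierstrass_form A W V v (poly P (mvar v)) (Q * Q')"
    using weierstrass_form_mult[OF Q Q'] FH by simp
  moreover have "weierstrass_form A W V v (poly P (mvar v)) P"
    unfolding weierstrass_form_def
  proof (intro conjI exI[of _ 1])
    show "series_unit A (insert v V) (1 :: ('v, 'a) mps)"
      unfolding series_unit_def using SU.one_closed by (auto simp: mcoeff_one)
  qed (use P in simp_all)
  ultimately have "Q * Q' = P" by (rule weierstrass_form_unique)
  then show ?thesis using Q by auto
qed

end

section \<open>Leading monomials\<close>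

text \<open>The graded order: total degree, then the order on exponent vectors to break ties.
  Restricting it to the monomials in a finite \<open>V\<close> makes it well founded.\<close>

definition mlt :: "'v::linorder set \<Rightarrow> (('v \<Rightarrow>\<^sub>0 nat) \<times> ('v \<Rightarrow>\<^sub>0 nat)) set" where
  "mlt V = {(a, b). keys a \<subseteq> V \<and> keys b \<subseteq> V \<and> (mdeg a < mdeg b \<or> mdeg a = mdeg b \<and> a < b)}"

text \<open>A monomial has finitely many predecessors, and their number strictly decreases along the
  order.\<close>

lemma wf_mlt:
  assumes "finite V"
  shows "wf (mlt V)"
proof (rule wf_subset)
  let ?n = "\<lambda>b. card {a. (a, b) \<in> mlt V}"
  have fin: "finite {a. (a, b) \<in> mlt V}" for b
  proof (rule finite_subset)
    show "{a. (a, b) \<in> mlt V} \<subseteq> {a. keys a \<subseteq> V \<and> (\<forall>v. lookup a v \<le> mdeg b)}"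
    proof clarify
      fix a assume "(a, b) \<in> mlt V"
      then have "keys a \<subseteq> V" "mdeg a \<le> mdeg b" by (auto simp: mlt_def)
      then show "keys a \<subseteq> V \<and> (\<forall>v. lookup a v \<le> mdeg b)"
        using lookup_le_sum[of a] unfolding mdeg_def by (meson order_trans)
    qed
  qed (rule finite_bounded_monomials[OF assms])
  show "mlt V \<subseteq> measure ?n"
  proof clarify
    fix a b :: "'a \<Rightarrow>\<^sub>0 nat" assume ab: "(a, b) \<in> mlt V"
    have "{c. (c, a) \<in> mlt V} \<subset> {c. (c, b) \<in> mlt V}"
    proof
      show "{c. (c, a) \<in> mlt V} \<subseteq> {c. (c, b) \<in> mlt V}" using ab by (auto simp: mlt_def)
      have "(a, a) \<notin> mlt V" by (simp add: mlt_def)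
      then show "{c. (c, a) \<in> mlt V} \<noteq> {c. (c, b) \<in> mlt V}" using ab by blast
    qed
    then show "(a, b) \<in> measure ?n" using psubset_card_mono[OF fin] by simp
  qed
qed simp

lemma mlt_trans: "(a, b) \<in> mlt V \<Longrightarrow> (b, c) \<in> mlt V \<Longrightarrow> (a, c) \<in> mlt V"
  by (auto simp: mlt_def)

lemma mlt_total: "keys a \<subseteq> V \<Longrightarrow> keys b \<subseteq> V \<Longrightarrow> a = b \<or> (a, b) \<in> mlt V \<or> (b, a) \<in> mlt V"
  by (auto simp: mlt_def)

lemma mlt_irrefl: "(a, a) \<notin> mlt V"
  by (simp add: mlt_def)

lemma mlt_add: "(a, b) \<in> mlt V \<Longrightarrow> keys c \<subseteq> V \<Longrightarrow> (a + c, b + c) \<in> mlt V"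
  using keys_add[of a c] keys_add[of b c] by (auto simp: mlt_def mdeg_add)

lemma mlt_add_strict:
  assumes "a = b \<or> (a, b) \<in> mlt V" "c = d \<or> (c, d) \<in> mlt V" "(a, c) \<noteq> (b, d)"
    "keys b \<subseteq> V" "keys c \<subseteq> V"
  shows "(a + c, b + d) \<in> mlt V"
proof -
  have 1: "(a + c, b + c) \<in> mlt V" if "(a, b) \<in> mlt V" using mlt_add that assms(5) by blast
  have 2: "(b + c, b + d) \<in> mlt V" if "(c, d) \<in> mlt V"
    using mlt_add[OF that assms(4)] by (simp add: add.commute)
  from assms(1) show ?thesis
  proof
    assume ab: "a = b"
    then have "(c, d) \<in> mlt V" using assms(2,3) by blast
    then show ?thesis using 2 unfolding ab by blast
  next
    assume ab: "(a, b) \<in> mlt V"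
    from assms(2) show ?thesis
    proof
      assume "c = d"
      then show ?thesis using 1[OF ab] by blast
    next
      assume "(c, d) \<in> mlt V"
      then show ?thesis using mlt_trans[OF 1[OF ab] 2] by blast
    qed
  qed
qed

text \<open>As usual for power series, the leading monomial is the smallest one.\<close>

definition leading_monomial :: "'v::linorder set \<Rightarrow> ('v, 'a::zero) mps \<Rightarrow> ('v \<Rightarrow>\<^sub>0 nat) \<Rightarrow> bool" where
  "leading_monomial V f m \<longleftrightarrow> keys m \<subseteq> V \<and> mcoeff f m \<noteq> 0 \<and> (\<forall>p. mcoeff f p \<noteq> 0 \<longrightarrow> m = p \<or> (m, p) \<in> mlt V)"

lemma leading_monomial_exists:
  fixes f :: "('v::linorder, 'a::comm_ring_1) mps"
  assumes "finite V" "f \<in> series_over K V" "f \<noteq> 0"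
  shows "\<exists>m. leading_monomial V f m"
proof -
  obtain m0 where "mcoeff f m0 \<noteq> 0" using assms(3) by (metis mcoeff_zero mps_eqI)
  then have "m0 \<in> {m. mcoeff f m \<noteq> 0}" by simp
  from wfE_min[OF wf_mlt[OF assms(1)] this] obtain m
    where m: "m \<in> {m. mcoeff f m \<noteq> 0}" "\<And>p. (p, m) \<in> mlt V \<Longrightarrow> p \<notin> {m. mcoeff f m \<noteq> 0}"
    by blast
  have fV: "keys p \<subseteq> V" if "mcoeff f p \<noteq> 0" for p using series_overD(2)[OF assms(2) that] .
  have "m = p \<or> (m, p) \<in> mlt V" if "mcoeff f p \<noteq> 0" for p
    using mlt_total[of m V p] m(2)[of p] that fV[of p] fV[of m] m(1) by blast
  then show ?thesis using m(1) fV unfolding leading_monomial_def by blast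
qed

lemma leading_monomial_unique: "leading_monomial V f m \<Longrightarrow> leading_monomial V f n \<Longrightarrow> m = n"
  unfolding leading_monomial_def using mlt_trans[of m n V m] mlt_irrefl[of m V] by blast

lemma leading_monomial_mult:
  fixes f g :: "('v::linorder, 'a::idom) mps"
  assumes f: "leading_monomial V f a" and g: "leading_monomial V g b"
  shows "leading_monomial V (f * g) (a + b)" "mcoeff (f * g) (a + b) = mcoeff f a * mcoeff g b"
proof -
  have k: "keys a \<subseteq> V" "keys b \<subseteq> V" "keys (a + b) \<subseteq> V"
    using f g keys_add[of a b] by (auto simp: leading_monomial_def)
  have ge: "(p, q) = (a, b) \<or> (a + b, p + q) \<in> mlt V" if "mcoeff f p \<noteq> 0" "mcoeff g q \<noteq> 0" for p q
  proof -
    have a: "a = p \<or> (a, p) \<in> mlt V" and b: "b = q \<or> (b, q) \<in> mlt V"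
      using f g that by (auto simp: leading_monomial_def)
    then have "keys p \<subseteq> V" using k(1) by (auto simp: mlt_def)
    then show ?thesis using mlt_add_strict[OF a b _ _ k(2)] by blast
  qed
  show c: "mcoeff (f * g) (a + b) = mcoeff f a * mcoeff g b"
  proof (rule mcoeff_mult_single[OF refl])
    fix p q assume pq: "p + q = a + b" "(p, q) \<noteq> (a, b)"
    show "mcoeff f p * mcoeff g q = 0" using ge[of p q] pq mlt_irrefl[of "a + b" V] by auto
  qed
  show "leading_monomial V (f * g) (a + b)"
    unfolding leading_monomial_def
  proof (intro conjI allI impI k(3))
    show "mcoeff (f * g) (a + b) \<noteq> 0" using c f g by (simp add: leading_monomial_def)
    fix p assume "mcoeff (f * g) p \<noteq> 0"
    then obtain x y where "p = x + y" "mcoeff f x \<noteq> 0" "mcoeff g y \<noteq> 0" by (rule mcoeff_mult_nonzero)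
    then show "a + b = p \<or> (a + b, p) \<in> mlt V" using ge[of x y] by auto
  qed
qed

lemma leading_monomial_power:
  fixes f :: "('v::linorder, 'a::idom) mps"
  assumes "leading_monomial V f a"
  shows "\<exists>b. leading_monomial V (f ^ n) b \<and> (\<forall>v. lookup b v = n * lookup a v)"
proof (induction n)
  case 0
  show ?case by (intro exI[of _ 0]) (auto simp: leading_monomial_def mcoeff_one split: if_splits)
next
  case (Suc n)
  then obtain b where b: "leading_monomial V (f ^ n) b" "\<forall>v. lookup b v = n * lookup a v" by blast
  show ?case
    using leading_monomial_mult(1)[OF assms b(1)] b(2) by (intro exI[of _ "a + b"]) (auto simp: lookup_add)
qed

text \<open>Division with a remainder free of multiples of the leading monomial \<open>k\<close>.
  The coefficient of \<open>q\<close> at \<open>m\<close> is found at \<open>k + m\<close>; the rest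
  \<open>l'\<close> of \<open>l\<close> has only monomials above \<open>k\<close>, so it meets only
  coefficients of \<open>q\<close> below \<open>m\<close>. Only the coefficient of \<open>l\<close>
  at \<open>k\<close> has to be inverted.\<close>

lemma leading_division:
  fixes l p :: "('v::linorder, 'a::idom) mps"
  assumes V: "finite V" and A: "unital_subring A" and lm: "leading_monomial V l k"
    and l: "l \<in> series_over A V" and c: "c \<in> A" "mcoeff l k * c = 1" and p: "p \<in> series_over A V"
  shows "\<exists>q\<in>series_over A V. \<forall>m. mcoeff (p - l * q) (k + m) = 0"
proof -
  interpret A: unital_subring A by fact
  interpret SA: unital_subring "series_over A V :: ('v, 'a) mps set" using unital_subring_series_over[OF A] .
  have k: "keys k \<subseteq> V" using lm by (simp add: leading_monomial_def)
  define l' where "l' = l - mconst (mcoeff l k) * mmon k"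
  have mk: "mcoeff (mconst a * f) m = a * mcoeff f m" for a m and f :: "('v, 'a) mps"
    by (subst mcoeff_mult_single[of 0 m]) (auto simp: mcoeff_mconst)
  have l'A: "l' \<in> series_over A V"
    unfolding l'_def using l k by (intro SA.diff_closed SA.mult_closed mconst_closed mmon_closed[OF A]) (auto dest: series_overD)
  have l': "(k, m) \<in> mlt V" if "mcoeff l' m \<noteq> 0" for m
    using that lm by (auto simp: l'_def mk mcoeff_mmon leading_monomial_def split: if_splits)
  define F where "F = (\<lambda>q m. if keys m \<subseteq> V then c * mcoeff (p - l' * q) (k + m) else 0)"
  have "\<exists>q\<in>series_over A V. \<forall>m. mcoeff q m = F q m"
  proof (rule mps_fixpoint)
    show "wf (mlt V)" by (rule wf_mlt[OF V])
    show "0 \<in> A" by simp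
    fix Z Z' :: "('v, 'a) mps" and m
    assume *: "\<And>m'. (m', m) \<in> mlt V \<Longrightarrow> mcoeff Z m' = mcoeff Z' m'"
    show "F Z m = F Z' m"
    proof (cases "keys m \<subseteq> V")
      case True
      have "mcoeff (l' * Z) (k + m) = mcoeff (l' * Z') (k + m)"
      proof (rule mcoeff_mult_cong)
        fix a q assume aq: "a + q = k + m" "mcoeff l' a \<noteq> 0"
        have kq: "keys q \<subseteq> V" using keys_subset_add_right[of q a] aq(1) keys_add[of k m] k True by auto
        have "\<not> (q = m \<or> (m, q) \<in> mlt V)"
        proof
          assume "q = m \<or> (m, q) \<in> mlt V"
          then have "(k + m, a + q) \<in> mlt V"
            using mlt_add_strict[of k a V m q] l'[OF aq(2)] mlt_irrefl True by (auto simp: mlt_def)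
          then show False using aq(1) mlt_irrefl by metis
        qed
        then have "(q, m) \<in> mlt V" using mlt_total[OF kq True] by blast
        then show "mcoeff Z q = mcoeff Z' q" by (rule *)
      qed
      then show ?thesis by (simp add: F_def)
    qed (simp add: F_def)
  next
    fix Z :: "('v, 'a) mps" and m assume "Z \<in> series_over A V"
    then have "p - l' * Z \<in> series_over A V" using p l'A by (intro SA.diff_closed SA.mult_closed)
    then show "F Z m \<in> A \<and> (F Z m \<noteq> 0 \<longrightarrow> keys m \<subseteq> V)" using A.mult_closed[OF c(1) series_overD(1), of "p - l' * Z" V "k + m"] by (auto simp: F_def)
  qed
  then obtain q where q: "q \<in> series_over A V" "\<And>m. mcoeff q m = F q m" by blast
  have "mcoeff (p - l * q) (k + m) = 0" for m
  proof (cases "keys m \<subseteq> V")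
    case True
    have "l * q = mconst (mcoeff l k) * (mmon k * q) + l' * q" by (simp add: l'_def algebra_simps)
    then have "mcoeff (l * q) (k + m) = mcoeff l k * mcoeff q m + mcoeff (l' * q) (k + m)"
      by (simp add: mk mcoeff_mmon_mult)
    moreover have "mcoeff l k * mcoeff q m = mcoeff (p - l' * q) (k + m)"
      by (subst q(2)) (simp add: F_def True c(2) flip: mult.assoc)
    ultimately show ?thesis by simp
  next
    case False
    have "p - l * q \<in> series_over A V" using p l q(1) by (intro SA.diff_closed SA.mult_closed)
    then show ?thesis using series_overD(2) False keys_subset_add_right[of m k] by blast
  qed
  then show ?thesis using q(1) by blast
qed

lemma leading_division_unique:
  fixes l q :: "('v::linorder, 'a::idom) mps"
  assumes "finite V" "leading_monomial V l k" "q \<in> series_over A V" "\<And>m. mcoeff (l * q) (k + m) = 0"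
  shows "q = 0"
proof (rule ccontr)
  assume "q \<noteq> 0"
  then obtain b where b: "leading_monomial V q b" using leading_monomial_exists[OF assms(1,3)] by blast
  have "mcoeff (l * q) (k + b) \<noteq> 0" using leading_monomial_mult(1)[OF assms(2) b] by (simp add: leading_monomial_def)
  then show False using assms(4) by blast
qed

text \<open>Division over \<open>A\<close> and uniqueness of the quotient over the larger ring.
  Inverting the one coefficient of \<open>l\<close> at \<open>k\<close> thus bounds the denominators
  of all coefficients of \<open>q\<close> at once.\<close>

lemma exact_quotient_closed:
  fixes l q :: "('v::linorder, 'a::idom) mps"
  assumes "finite V" "unital_subring A" "leading_monomial V l k" "l \<in> series_over A V"
    "c \<in> A" "mcoeff l k * c = 1" "q \<in> series_over B V" "l * q \<in> series_over A V"
  shows "q \<in> series_over A V"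
proof -
  interpret U: unital_subring "series_over UNIV V :: ('v, 'a) mps set"
    using unital_subring_series_over[OF unital_subring_UNIV] .
  obtain q' where q': "q' \<in> series_over A V" "\<And>m. mcoeff (l * q - l * q') (k + m) = 0"
    using leading_division[OF assms(1-6,8)] by blast
  have "q - q' = 0"
  proof (rule leading_division_unique[OF assms(1,3)])
    show "q - q' \<in> series_over UNIV V"
      using assms(7) q'(1) series_over_mono[of _ UNIV V V] by (intro U.diff_closed) blast+
    show "mcoeff (l * (q - q')) (k + m) = 0" for m using q'(2)[of m] by (simp add: algebra_simps)
  qed
  then show ?thesis using q'(1) by simp
qed

text \<open>The remainder \<open>r\<close> of \<open>p\<close> on division by \<open>l\<close>
  contains no multiple of the leading monomial \<open>k\<close> of \<open>l\<close>. The powers of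
  \<open>r / l\<close> still have the denominator \<open>e\<close>, and comparing leading monomials
  in \<open>e * r ^ n = l ^ n * h\<close> for large \<open>n\<close> shows that \<open>k\<close>
  divides the leading monomial of \<open>r\<close>. So \<open>r = 0\<close>.\<close>

lemma completely_integrally_closed_series:
  fixes K :: "'a::idom set"
  assumes V: "finite (V :: 'v::linorder set)" and K: "unital_subring K"
    and inv: "\<And>a. a \<in> K \<Longrightarrow> a \<noteq> 0 \<Longrightarrow> \<exists>b\<in>K. a * b = 1"
  shows "completely_integrally_closed (series_over K V :: ('v, 'a) mps set)"
  unfolding completely_integrally_closed_def
proof (intro ballI impI)
  let ?S = "series_over K V :: ('v, 'a) mps set"
  interpret SK: unital_subring ?S using unital_subring_series_over[OF K] .
  fix p l e :: "('v, 'a) mps"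
  assume p: "p \<in> ?S" and l: "l \<in> ?S" and e: "e \<in> ?S" and *: "l \<noteq> 0 \<and> e \<noteq> 0 \<and> (\<forall>n. \<exists>h\<in>?S. e * p ^ n = l ^ n * h)"
  obtain k where k: "leading_monomial V l k" using leading_monomial_exists[OF V l] * by blast
  obtain c where c: "c \<in> K" "mcoeff l k * c = 1"
    using inv[of "mcoeff l k"] k series_overD(1)[OF l] by (auto simp: leading_monomial_def)
  obtain q where q: "q \<in> ?S" "\<And>m. mcoeff (p - l * q) (k + m) = 0"
    using leading_division[OF V K k l c p] by blast
  define r where "r = p - l * q"
  have r: "r \<in> ?S" unfolding r_def by (intro SK.diff_closed SK.mult_closed p l q)
  have rn: "\<exists>h\<in>?S. e * r ^ n = l ^ n * h" for n
  proof -
    obtain h where h: "\<And>i. h i \<in> ?S" "\<And>i. e * p ^ i = l ^ i * h i" using * by metis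
    \<comment> \<open>The binomial expansion of \<open>(p - l * q) ^ n\<close>; each term becomes a
      multiple of \<open>l ^ n\<close>, because \<open>e * p ^ i\<close> is one of
      \<open>l ^ i\<close>.\<close>
    let ?h = "\<Sum>i\<le>n. of_nat (n choose i) * h i * (- q) ^ (n - i)"
    have "e * r ^ n = (\<Sum>i\<le>n. of_nat (n choose i) * (e * p ^ i) * (- (l * q)) ^ (n - i))"
      unfolding r_def diff_conv_add_uminus binomial_ring sum_distrib_left by (simp add: mult_ac)
    also have "\<dots> = (\<Sum>i\<le>n. l ^ n * (of_nat (n choose i) * h i * (- q) ^ (n - i)))"
    proof (rule sum.cong[OF refl])
      fix i assume "i \<in> {..n}"
      then have "l ^ n = l ^ i * l ^ (n - i)" by (simp flip: power_add)
      moreover have "(- (l * q)) ^ (n - i) = l ^ (n - i) * (- q) ^ (n - i)"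
        by (simp flip: power_mult_distrib)
      ultimately show "of_nat (n choose i) * (e * p ^ i) * (- (l * q)) ^ (n - i) = l ^ n * (of_nat (n choose i) * h i * (- q) ^ (n - i))"
        by (simp only: h(2) mult_ac)
    qed
    finally have "e * r ^ n = l ^ n * ?h" by (simp add: sum_distrib_left)
    moreover have "?h \<in> ?S"
      by (intro SK.sum_closed SK.mult_closed SK.power_closed SK.uminus_closed SK.of_nat_closed h q)
    ultimately show ?thesis by blast
  qed
  have "r = 0"
  proof (rule ccontr)
    assume "r \<noteq> 0"
    then obtain b where b: "leading_monomial V r b" using leading_monomial_exists[OF V r] by blast
    obtain a where a: "leading_monomial V e a" using leading_monomial_exists[OF V e] * by blast
    have "lookup k v \<le> lookup b v" for v
    proof -
      \<comment> \<open>The power exceeds the exponent of \<open>v\<close> in the leading monomial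
        of \<open>e\<close>, so that \<open>e\<close> contributes less than one unit to the
        comparison divided by \<open>?n\<close>.\<close>
      let ?n = "Suc (lookup a v)"
      obtain h where h: "h \<in> ?S" "e * r ^ ?n = l ^ ?n * h" using rn by blast
      obtain b' where b': "leading_monomial V (r ^ ?n) b'" "\<forall>v. lookup b' v = ?n * lookup b v"
        using leading_monomial_power[OF b] by blast
      obtain k' where k': "leading_monomial V (l ^ ?n) k'" "\<forall>v. lookup k' v = ?n * lookup k v"
        using leading_monomial_power[OF k] by blast
      have lm1: "leading_monomial V (e * r ^ ?n) (a + b')" by (rule leading_monomial_mult(1)[OF a b'(1)])
      then have "h \<noteq> 0" using h(2) by (auto simp: leading_monomial_def)
      then obtain d where d: "leading_monomial V h d" using leading_monomial_exists[OF V h(1)] by blast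
      have "a + b' = k' + d"
        using leading_monomial_unique lm1 leading_monomial_mult(1)[OF k'(1) d] h(2) by metis
      then have "lookup a v + ?n * lookup b v = ?n * lookup k v + lookup d v"
        using b'(2) k'(2) by (metis lookup_add)
      then have "?n * lookup k v < ?n * Suc (lookup b v)" by simp
      then show ?thesis by (metis less_Suc_eq_le mult_less_cancel1)
    qed
    then have "b = k + (b - k)" by (intro poly_mapping_eqI) (simp add: lookup_add lookup_minus)
    then have "mcoeff r b = 0" using q(2)[of "b - k"] by (simp add: r_def)
    then show False using b by (simp add: leading_monomial_def)
  qed
  then show "\<exists>q\<in>?S. p = l * q" using q(1) by (auto simp: r_def)
qed

section \<open>Iterated discriminants\<close>

lemma xvars_0 [simp]: "xvars 0 = {}"
  by (simp add: xvars_def)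

lemma xvars_Suc: "xvars (Suc n) = insert (X (Suc n)) (xvars n)"
  by (auto simp: xvars_def)

lemma finite_xvars [simp]: "finite (xvars n)"
  by (simp add: xvars_def)

lemma X_in_xvars_iff [simp]: "X i \<in> xvars n \<longleftrightarrow> 1 \<le> i \<and> i \<le> n"
  by (auto simp: xvars_def)

text \<open>The index \<open>k0\<close> of a system has no counterpart: once a Weierstrass
  polynomial is 1, so are its radical and discriminant, and the remaining stages are trivial. The
  coefficients may come from any subring, in particular from a localization.\<close>

primrec discriminant_chain :: "'a::idom set \<Rightarrow> var set \<Rightarrow> nat \<Rightarrow> (var, 'a) mps \<Rightarrow> bool" where
  "discriminant_chain A Ps 0 F \<longleftrightarrow> series_unit A Ps F"
| "discriminant_chain A Ps (Suc n) F \<longleftrightarrow>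
     (\<exists>P G. weierstrass_form A (xvars n) (xvars n \<union> Ps) (X (Suc n)) F P \<and>
        G \<in> poly_over (series_over A (xvars n \<union> Ps)) \<and> monic_radical P G \<and>
        discriminant_chain A Ps n (discriminant G))"

definition parameters :: "var set \<Rightarrow> bool" where
  "parameters Ps \<longleftrightarrow> finite Ps \<and> (\<forall>i. X i \<notin> Ps)"

lemma weierstrass_xvars:
  assumes "unital_subring (A :: 'a::idom set)" "parameters Ps"
  shows "weierstrass A (xvars n) (xvars n \<union> Ps) (X (Suc n))"
  using assms by (auto simp: weierstrass_def weierstrass_axioms_def parameters_def)

definition subfield_set :: "'a::field set \<Rightarrow> bool" where
  "subfield_set K \<longleftrightarrow> unital_subring K \<and> (\<forall>a\<in>K. inverse a \<in> K)"

lemma subfield_setD: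
  assumes "subfield_set K"
  shows "unital_subring K" "a \<in> K \<Longrightarrow> a \<noteq> 0 \<Longrightarrow> \<exists>b\<in>K. a * b = 1"
  using assms by (auto simp: subfield_set_def intro!: bexI[of _ "inverse a"])

lemma series_unit_subfield:
  assumes "subfield_set K"
  shows "series_unit K V u \<longleftrightarrow> u \<in> series_over K V \<and> mcoeff u 0 \<noteq> 0"
  using subfield_setD(2)[OF assms] unfolding series_unit_def
  by (metis mult_zero_left series_overD(1) zero_neq_one)

lemma radical_over_series:
  fixes K :: "'a::field_char_0 set" and P :: "(var, 'a) mps poly"
  assumes "subfield_set K" "finite V" "P \<in> poly_over (series_over K V)" "lead_coeff P = 1"
  shows "\<exists>G\<in>poly_over (series_over K V). monic_radical P G"
proof (rule monic_radical_exists[OF _ assms(3,4)])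
  interpret K: unital_subring K by (rule subfield_setD(1)[OF assms(1)])
  show "unital_subring (series_over K V)" by (rule unital_subring_series_over) (rule K.unital_subring_axioms)
  show "completely_integrally_closed (series_over K V)"
    by (rule completely_integrally_closed_series[OF assms(2) subfield_setD[OF assms(1)]])
  fix n
  have "of_nat m = (mconst (of_nat m) :: (var, 'a) mps)" for m
    by (induction m) (simp_all add: mconst_hom)
  then have "of_nat (Suc n) * mconst (inverse (of_nat (Suc n))) = (1 :: (var, 'a) mps)"
    by (simp only: mconst_hom(2)[symmetric] right_inverse of_nat_eq_0_iff nat.distinct not_False_eq_True mconst_hom(3))
  moreover have "inverse (of_nat (Suc n)) \<in> K" using assms(1) K.of_nat_closed unfolding subfield_set_def by blast
  ultimately show "\<exists>q\<in>series_over K V. of_nat (Suc n) * q = (1 :: (var, 'a) mps)"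
    by (intro bexI[of _ "mconst (inverse (of_nat (Suc n)))"] mconst_closed) auto
qed

text \<open>The condition (b) on the members \<open>i\<close> and \<open>i + 1\<close> of a system of pseudopolynomials.\<close>

definition linked :: "'a::field set \<Rightarrow> var set \<Rightarrow> (nat \<Rightarrow> (var, 'a) mps poly) \<Rightarrow> nat \<Rightarrow> bool" where
  "linked K Ps P i \<longleftrightarrow>
     (\<exists>G. reduced_of (series_over K (xvars i \<union> Ps)) (P (i + 1)) G \<and>
          vanishes_on_zero (xvars (i + 1)) (poly G (mvar (X (i + 1)))) \<and>
          (\<exists>h\<in>series_over K (xvars i \<union> Ps). poly (P i) (mvar (X i)) = discriminant G * h))"

text \<open>The induction runs over all factors \<open>F\<close> of a member, since a system only
  asks that discriminants divide the next member. Its Weierstrass polynomial \<open>Q\<close>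
  divides \<open>P (Suc n)\<close>, so the radical of \<open>Q\<close> divides that of
  \<open>P (Suc n)\<close>, and the same holds for the discriminants. The discriminant of
  \<open>G\<close> is thus a factor of the member below.\<close>

lemma chain_of_system:
  fixes K :: "'a::field_char_0 set"
  assumes K: "subfield_set K" and Ps: "parameters Ps"
    and pseudo: "\<And>i. i \<le> N \<Longrightarrow> pseudopolynomial K Ps i (P i)"
    and link: "\<And>i. k0 \<le> i \<Longrightarrow> i < N \<Longrightarrow> linked K Ps P i"
    and one: "\<And>i. i \<le> k0 \<Longrightarrow> P i = 1"
  shows "n \<le> N \<Longrightarrow> F \<in> series_over K (xvars n \<union> Ps) \<Longrightarrow> H \<in> series_over K (xvars n \<union> Ps) \<Longrightarrow>
    F * H = poly (P n) (mvar (X n)) \<Longrightarrow> discriminant_chain K Ps n F"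
proof (induction n arbitrary: F H)
  case 0
  then show ?case using one[of 0] by (auto intro: series_unit_if_dvd_one)
next
  case (Suc n)
  let ?R = "series_over K (xvars n \<union> Ps) :: (var, 'a) mps set"
  interpret weierstrass K "xvars n" "xvars n \<union> Ps" "X (Suc n)"
    by (rule weierstrass_xvars[OF subfield_setD(1)[OF K] Ps])
  interpret R: unital_subring ?R by (rule subring_SV)
  have fin: "finite (xvars n \<union> Ps)" using Ps by (simp add: parameters_def)
  have ins: "xvars (Suc n) \<union> Ps = insert (X (Suc n)) (xvars n \<union> Ps)" by (simp add: xvars_Suc)
  have PP: "P (Suc n) \<in> poly_over ?R" "lead_coeff (P (Suc n)) = 1"
    "\<forall>j<degree (P (Suc n)). vanishes_on_zero (xvars n) (coeff (P (Suc n)) j)"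
    using pseudo[OF Suc.prems(1)] by (simp_all add: pseudopolynomial_def)
  obtain Q where Q: "weierstrass_form K (xvars n) (xvars n \<union> Ps) (X (Suc n)) F Q" "Q dvd P (Suc n)"
    using weierstrass_factor[OF Suc.prems(4) PP Suc.prems(2,3)[unfolded ins] subfield_setD(2)[OF K]] by blast
  have QR: "Q \<in> poly_over ?R" "lead_coeff Q = 1" using Q(1) by (auto simp: weierstrass_form_def)
  obtain G where G: "G \<in> poly_over ?R" "monic_radical Q G"
    using radical_over_series[OF K fin QR] by blast
  have G1: "lead_coeff G = 1" using G(2) by (simp add: monic_radical_def)
  have dG: "discriminant G \<in> ?R" by (rule discriminant_in[OF subring_SV G(1)])
  have "discriminant_chain K Ps n (discriminant G)"
  proof (cases "k0 \<le> n")
    case True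
    obtain G' h where G': "reduced_of ?R (P (Suc n)) G'" and h: "h \<in> ?R" "poly (P n) (mvar (X n)) = discriminant G' * h"
      using link[OF True] Suc.prems(1) by (auto simp: linked_def)
    \<comment> \<open>A monic member is nonzero, hence so is the discriminant dividing it, and
      \<open>G'\<close> is a radical in the sense of \<open>monic_radical\<close>. At index 0 there
      is no variable, and the member is 1.\<close>
    have "poly (P n) (mvar (X n)) \<noteq> 0"
    proof (cases n)
      case 0
      then show ?thesis using one[of 0] by simp
    next
      case (Suc k)
      interpret k: weierstrass K "xvars k" "xvars k \<union> Ps" "X (Suc k)"
        by (rule weierstrass_xvars[OF subfield_setD(1)[OF K] Ps])
      have "pseudopolynomial K Ps (Suc k) (P n)" using pseudo[of n] Suc.prems(1) Suc by simp
      then have "mcoeff (poly (P n) (mvar (X n))) (Poly_Mapping.single (X n) (degree (P n))) = 1"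
        using k.pseudo_mcoeff[of "P n" "Poly_Mapping.single (X n) (degree (P n))"] k.v_W Suc by (auto simp: pseudopolynomial_def)
      then show ?thesis by auto
    qed
    then have "discriminant G' \<noteq> 0" using h by auto
    note G'r = monic_radical_if_reduced_of[OF subring_SV PP(1) G' this]
    have "\<exists>m. P (Suc n) dvd G' ^ m" using G'r(1) by (simp add: monic_radical_def)
    then obtain m where "Q dvd G' ^ m" using Q(2) dvd_trans by blast
    then have "G dvd G'" by (rule monic_radical_dvd[OF G(2)])
    moreover have "lead_coeff G' = 1" using G'r(1) by (simp add: monic_radical_def)
    ultimately obtain h' where h': "h' \<in> ?R" "discriminant G' = discriminant G * h'"
      using discriminant_dvd[OF subring_SV G'r(2) G(1)] G1 by blast
    show ?thesis
      by (rule Suc.IH[of _ "h' * h"]) (use Suc.prems(1) dG h h' in auto)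
  next
    case False
    then have "Q = 1" using Q(2) one[of "Suc n"] QR(2) monic_dvd_one by auto
    then have "G = 1" using G by (metis G1 monic_dvd_one monic_radical_def)
    then show ?thesis
      using False one[of n] Suc.prems(1) by (intro Suc.IH[of _ 1]) (auto simp: discriminant_def)
  qed
  then show ?case using Q(1) G by auto
qed

text \<open>Each stage adds its Weierstrass polynomial on top of the system of the next
  discriminant. The unit \<open>u\<close> is carried along because a discriminant is only associated
  to its Weierstrass polynomial.\<close>

lemma system_of_chain:
  fixes K :: "'a::field_char_0 set"
  assumes K: "subfield_set K" and Ps: "parameters Ps"
  shows "discriminant_chain K Ps n F \<Longrightarrow> \<exists>k0 P. k0 \<le> n \<and> (\<forall>i\<le>n. pseudopolynomial K Ps i (P i)) \<and>
    (\<exists>u. series_unit K (xvars n \<union> Ps) u \<and> F = u * poly (P n) (mvar (X n))) \<and>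
    (\<forall>i. k0 \<le> i \<and> i < n \<longrightarrow> linked K Ps P i) \<and> (\<forall>i\<le>k0. P i = 1)"
proof (induction n arbitrary: F)
  case 0
  interpret R: unital_subring "series_over K Ps :: (var, 'a) mps set"
    by (rule unital_subring_series_over[OF subfield_setD(1)[OF K]])
  interpret RP: unital_subring "poly_over (series_over K Ps :: (var, 'a) mps set)" by (rule R.unital_subring_poly_over)
  have "pseudopolynomial K Ps 0 1" by (simp add: pseudopolynomial_def)
  then show ?case using 0 by (intro exI[of _ 0] exI[of _ "\<lambda>_. 1"]) auto
next
  case (Suc n)
  let ?R = "series_over K (xvars n \<union> Ps) :: (var, 'a) mps set" and ?v = "X (Suc n)"
  interpret weierstrass K "xvars n" "xvars n \<union> Ps" "X (Suc n)"
    by (rule weierstrass_xvars[OF subfield_setD(1)[OF K] Ps])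
  interpret R: unital_subring ?R by (rule subring_SV)
  have ins: "xvars (Suc n) \<union> Ps = insert ?v (xvars n \<union> Ps)" by (simp add: xvars_Suc)
  obtain Q G where Q: "weierstrass_form K (xvars n) (xvars n \<union> Ps) ?v F Q"
    and G: "G \<in> poly_over ?R" "monic_radical Q G" "discriminant_chain K Ps n (discriminant G)"
    using Suc.prems by auto
  obtain u where u: "series_unit K (xvars (Suc n) \<union> Ps) u" "F = u * poly Q (mvar ?v)"
    and QR: "Q \<in> poly_over ?R" "lead_coeff Q = 1" "\<forall>j<degree Q. vanishes_on_zero (xvars n) (coeff Q j)"
    using Q unfolding weierstrass_form_def ins by blast
  show ?case
  \<comment> \<open>Condition (b) demands vanishing on the zero set of the variables, which fails
    for the polynomial 1. So a stage with \<open>Q = 1\<close> has to lie at or below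
    \<open>k0\<close>, and the members under it are all taken to be 1.\<close>
  proof (cases "Q = 1")
    case True
    have "pseudopolynomial K Ps i 1" for i
    proof -
      interpret R: unital_subring "series_over K (xvars (i - 1) \<union> Ps) :: (var, 'a) mps set"
        by (rule unital_subring_series_over[OF subfield_setD(1)[OF K]])
      interpret RP: unital_subring "poly_over (series_over K (xvars (i - 1) \<union> Ps) :: (var, 'a) mps set)" by (rule R.unital_subring_poly_over)
      show ?thesis using RP.one_closed by (simp add: pseudopolynomial_def)
    qed
    then show ?thesis using u True by (intro exI[of _ "Suc n"] exI[of _ "\<lambda>_. 1"]) auto
  next
    case False
    obtain k0 P w where P: "k0 \<le> n" "\<forall>i\<le>n. pseudopolynomial K Ps i (P i)"
      "series_unit K (xvars n \<union> Ps) w" "discriminant G = w * poly (P n) (mvar (X n))"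
      "\<forall>i. k0 \<le> i \<and> i < n \<longrightarrow> linked K Ps P i" "\<forall>i\<le>k0. P i = 1"
      using Suc.IH[OF G(3)] by blast
    define P' where "P' = P(Suc n := Q)"
    have degQ: "degree Q > 0"
    proof (rule ccontr)
      assume "\<not> ?thesis"
      then obtain a where "Q = [:a:]" by (metis degree_eq_zeroE neq0_conv)
      then show False using QR(2) False by simp
    qed
    obtain w' where w': "series_unit K (xvars n \<union> Ps) w'" "w * w' = 1"
      using series_unit_inverse[OF subfield_setD(1)[OF K] P(3)] by blast
    have "poly (P n) (mvar (X n)) = discriminant G * w'"
    proof -
      have "discriminant G * w' = (w * w') * poly (P n) (mvar (X n))" by (simp only: P(4) mult_ac)
      then show ?thesis using w'(2) by simp
    qed
    moreover have "reduced_of ?R Q G" by (rule reduced_of_if_monic_radical[OF subring_SV QR(1,2) G(1,2)])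
    \<comment> \<open>\<open>G\<close> is a factor of a pseudopolynomial, hence regular of some
      order \<open>d\<close>. Some power of it is a multiple of \<open>Q\<close>, which vanishes at
      the origin, so \<open>d\<close> is positive.\<close>
    moreover have "vanishes_on_zero (xvars (Suc n)) (poly G (mvar ?v))"
    proof -
      obtain m where m: "G dvd Q" "Q dvd G ^ m" using G(2) by (auto simp: monic_radical_def)
      obtain B where B: "Q = G * B" using m(1) by (rule dvdE)
      obtain C where C: "G ^ m = Q * C" using m(2) by (rule dvdE)
      have "poly G (mvar ?v) * poly B (mvar ?v) = poly Q (mvar ?v)" by (simp add: B)
      then obtain d where d: "regular_at K (xvars n) ?v d (poly G (mvar ?v))"
        using regular_factor[OF _ QR poly_SU[OF G(1)] subfield_setD(2)[OF K]] by blast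
      have "0 \<noteq> Poly_Mapping.single ?v (degree Q)"
        using degQ by (metis less_irrefl lookup_single_eq lookup_zero)
      then have "mcoeff (poly Q (mvar ?v)) 0 = 0" using pseudo_mcoeff[OF QR, of 0] by simp
      then have "mcoeff (poly G (mvar ?v) ^ m) 0 = 0"
        using arg_cong[OF C, of "\<lambda>p. poly p (mvar ?v)"] by (simp add: mcoeff_mult_0)
      moreover have "mcoeff (f ^ m) 0 = mcoeff f 0 ^ m" for f :: "(var, 'a) mps"
        by (induction m) (simp_all add: mcoeff_mult_0 mcoeff_one)
      ultimately have G0: "mcoeff (poly G (mvar ?v)) 0 = 0" by simp
      have "d \<noteq> 0"
      proof
        assume "d = 0"
        then show False using d G0 by (simp add: regular_at_def)
      qed
      show ?thesis
        unfolding vanishes_on_zero_def xvars_Suc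
      proof clarify
        fix m :: "var \<Rightarrow>\<^sub>0 nat" assume "keys m \<inter> insert ?v (xvars n) = {}"
        then have "keys m \<inter> xvars n = {}" "lookup m ?v = 0" by (auto simp: in_keys_iff)
        then show "mcoeff (poly G (mvar ?v)) m = 0" using d \<open>d \<noteq> 0\<close> by (simp add: regular_at_def)
      qed
    qed
    ultimately have "linked K Ps P' n"
      using w'(1) unfolding linked_def by (intro exI[of _ G]) (auto simp: P'_def series_unit_def)
    moreover have "linked K Ps P' i" if "k0 \<le> i" "i < n" for i
      using P(5) that by (simp add: linked_def P'_def)
    moreover have "pseudopolynomial K Ps i (P' i)" if "i \<le> Suc n" for i
      using P(2) QR that by (auto simp: P'_def pseudopolynomial_def)
    moreover have "P' (Suc n) = Q" "\<forall>i\<le>k0. P' i = 1" using P(1,6) by (simp_all add: P'_def)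
    ultimately show ?thesis
      using P(1) u by (intro exI[of _ k0] exI[of _ P']) (auto simp: less_Suc_eq)
  qed
qed

theorem zariski_equisingular_iff_chain:
  fixes K :: "'a::field_char_0 set"
  assumes K: "subfield_set K" and Ps: "parameters Ps"
  shows "zariski_equisingular K r Ps F \<longleftrightarrow> discriminant_chain K Ps (Suc r) F"
proof
  assume "zariski_equisingular K r Ps F"
  then obtain k0 P where P: "k0 \<le> r + 1" "\<And>i. i \<le> r + 1 \<Longrightarrow> pseudopolynomial K Ps i (P i)"
    "weierstrass_polynomial_of K Ps (r + 1) F (P (r + 1))"
    "\<And>i. k0 \<le> i \<Longrightarrow> i \<le> r \<Longrightarrow> linked K Ps P i" "\<And>i. i \<le> k0 \<Longrightarrow> P i = 1"
    unfolding zariski_equisingular_def linked_def by blast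
  interpret weierstrass K "xvars r" "xvars r \<union> Ps" "X (Suc r)"
    by (rule weierstrass_xvars[OF subfield_setD(1)[OF K] Ps])
  have ins: "xvars (Suc r) \<union> Ps = insert (X (Suc r)) (xvars r \<union> Ps)" by (simp add: xvars_Suc)
  obtain u where u: "series_unit K (xvars (Suc r) \<union> Ps) u" "F = u * poly (P (Suc r)) (mvar (X (Suc r)))"
    using P(3) by (auto simp: weierstrass_polynomial_of_def series_unit_subfield[OF K])
  obtain w where w: "series_unit K (xvars (Suc r) \<union> Ps) w" "u * w = 1"
    using series_unit_inverse[OF subfield_setD(1)[OF K] u(1)] by blast
  have PS: "poly (P (Suc r)) (mvar (X (Suc r))) \<in> series_over K (xvars (Suc r) \<union> Ps)"
    unfolding ins using P(2)[of "Suc r"] by (intro poly_SU) (simp add: pseudopolynomial_def)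
  interpret SU: unital_subring "series_over K (xvars (Suc r) \<union> Ps) :: (var, 'a) mps set"
    by (rule unital_subring_series_over[OF subfield_setD(1)[OF K]])
  have "F * w = (u * w) * poly (P (Suc r)) (mvar (X (Suc r)))" by (simp only: u(2) mult_ac)
  then have "F * w = poly (P (Suc r)) (mvar (X (Suc r)))" by (simp add: w(2))
  moreover have "F \<in> series_over K (xvars (Suc r) \<union> Ps)"
    unfolding u(2) using u(1) PS by (intro SU.mult_closed) (auto simp: series_unit_def)
  moreover have "w \<in> series_over K (xvars (Suc r) \<union> Ps)" using w(1) by (simp add: series_unit_def)
  ultimately show "discriminant_chain K Ps (Suc r) F"
    using P by (intro chain_of_system[OF K Ps, of "Suc r" P k0 "Suc r" F w]) auto
next
  assume "discriminant_chain K Ps (Suc r) F"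
  from system_of_chain[OF K Ps this] obtain k0 P u where P: "k0 \<le> Suc r" "\<forall>i\<le>Suc r. pseudopolynomial K Ps i (P i)"
    "series_unit K (xvars (Suc r) \<union> Ps) u" "F = u * poly (P (Suc r)) (mvar (X (Suc r)))"
    "\<forall>i. k0 \<le> i \<and> i < Suc r \<longrightarrow> linked K Ps P i" "\<forall>i\<le>k0. P i = 1"
    by blast
  have "weierstrass_polynomial_of K Ps (r + 1) F (P (r + 1))"
    unfolding weierstrass_polynomial_of_def
    using P(2)[rule_format, of "Suc r"] P(3,4)
    by (auto simp: pseudopolynomial_def vanishes_on_zero_def series_unit_subfield[OF K])
  then show "zariski_equisingular K r Ps F"
    unfolding zariski_equisingular_def using P by (intro exI[of _ k0] exI[of _ P]) (auto simp: linked_def less_Suc_eq_le)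
qed

section \<open>Polynomials in the parameters \<open>\<tau>\<close>\<close>

definition mono_val :: "('i \<Rightarrow> 'b::comm_ring_1) \<Rightarrow> ('i \<Rightarrow>\<^sub>0 nat) \<Rightarrow> 'b" where
  "mono_val v m = (\<Prod>i\<in>keys m. v i ^ lookup m i)"

lemma mono_val_superset: "finite I \<Longrightarrow> keys m \<subseteq> I \<Longrightarrow> mono_val v m = (\<Prod>i\<in>I. v i ^ lookup m i)"
  unfolding mono_val_def by (rule prod.mono_neutral_left) (auto simp: in_keys_iff)

lemma mono_val_add: "mono_val v (m + n) = mono_val v m * mono_val v n"
proof -
  have "mono_val v (m + n) = (\<Prod>i\<in>keys m \<union> keys n. v i ^ lookup (m + n) i)"
    by (rule mono_val_superset) (use keys_add[of m n] in auto)
  moreover have "mono_val v m = (\<Prod>i\<in>keys m \<union> keys n. v i ^ lookup m i)"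
    by (rule mono_val_superset) auto
  moreover have "mono_val v n = (\<Prod>i\<in>keys m \<union> keys n. v i ^ lookup n i)"
    by (rule mono_val_superset) auto
  ultimately show ?thesis by (simp add: lookup_add power_add prod.distrib)
qed

lemma mono_val_0 [simp]: "mono_val v 0 = 1"
  by (simp add: mono_val_def)

locale coefficient_hom =
  fixes h :: "'k::comm_ring_1 \<Rightarrow> 'b::comm_ring_1"
  assumes h_add: "h (a + b) = h a + h b" and h_mult: "h (a * b) = h a * h b" and h_one: "h 1 = 1"
begin

lemma h_zero [simp]: "h 0 = 0"
  using h_add[of 0 0] by (metis add_cancel_right_right add_0_right)

lemma eval_hom_superset:
  assumes "finite M" "keys p \<subseteq> M"
  shows "eval_hom h v p = (\<Sum>m\<in>M. h (lookup p m) * mono_val v m)"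
proof -
  have "(\<Sum>m\<in>keys p. h (lookup p m) * mono_val v m) = (\<Sum>m\<in>M. h (lookup p m) * mono_val v m)"
    by (rule sum.mono_neutral_left) (use assms in \<open>auto simp: in_keys_iff\<close>)
  then show ?thesis by (simp add: eval_hom_def mono_val_def)
qed

lemma eval_hom_add: "eval_hom h v (p + q) = eval_hom h v p + eval_hom h v q"
proof -
  let ?M = "keys p \<union> keys q"
  have "eval_hom h v (p + q) = (\<Sum>m\<in>?M. h (lookup (p + q) m) * mono_val v m)"
    by (rule eval_hom_superset) (use keys_add[of p q] in auto)
  moreover have "eval_hom h v p = (\<Sum>m\<in>?M. h (lookup p m) * mono_val v m)"
    by (rule eval_hom_superset) auto
  moreover have "eval_hom h v q = (\<Sum>m\<in>?M. h (lookup q m) * mono_val v m)"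
    by (rule eval_hom_superset) auto
  ultimately show ?thesis by (simp add: lookup_add h_add distrib_right sum.distrib)
qed

lemma eval_hom_zero [simp]: "eval_hom h v 0 = 0"
  by (simp add: eval_hom_def)

lemma eval_hom_single: "eval_hom h v (Poly_Mapping.single m a) = h a * mono_val v m"
  by (simp add: eval_hom_superset[of "{m}"])

lemma eval_hom_sum: "eval_hom h v (sum f I) = (\<Sum>i\<in>I. eval_hom h v (f i))"
  by (induction I rule: infinite_finite_induct) (auto simp: eval_hom_add)

end

lemma poly_mapping_sum_singles: "p = (\<Sum>m\<in>keys p. Poly_Mapping.single m (lookup p m))"
proof (rule poly_mapping_eqI)
  fix k
  have "lookup (\<Sum>m\<in>keys p. Poly_Mapping.single m (lookup p m)) k = (\<Sum>m\<in>keys p. if m = k then lookup p m else 0)"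
    by (simp add: lookup_sum lookup_single when_def)
  also have "\<dots> = lookup p k" by (simp add: in_keys_iff)
  finally show "lookup p k = lookup (\<Sum>m\<in>keys p. Poly_Mapping.single m (lookup p m)) k" by simp
qed

context coefficient_hom
begin

lemma eval_hom_mult: "eval_hom h v (p * q) = eval_hom h v p * eval_hom h v q"
proof -
  have "p * q = (\<Sum>m\<in>keys p. \<Sum>n\<in>keys q. Poly_Mapping.single (m + n) (lookup p m * lookup q n))"
    by (subst poly_mapping_sum_singles[of p], subst poly_mapping_sum_singles[of q])
      (simp add: sum_distrib_left sum_distrib_right mult_single sum.swap[of _ "keys q"])
  then have "eval_hom h v (p * q) = (\<Sum>m\<in>keys p. \<Sum>n\<in>keys q. (h (lookup p m) * mono_val v m) * (h (lookup q n) * mono_val v n))"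
    by (simp add: eval_hom_sum eval_hom_single h_mult mono_val_add mult_ac)
  also have "\<dots> = eval_hom h v p * eval_hom h v q"
    by (simp add: eval_hom_def mono_val_def sum_product)
  finally show ?thesis .
qed

lemma eval_hom_one: "eval_hom h v 1 = 1"
  using eval_hom_single[of v 0 1] by (simp add: h_one)

lemma eval_hom_compose:
  fixes g :: "'b \<Rightarrow> 'c::comm_ring_1"
  assumes "\<And>a b. g (a + b) = g a + g b" "\<And>a b. g (a * b) = g a * g b" "g 1 = 1"
  shows "g (eval_hom h v p) = eval_hom (\<lambda>a. g (h a)) (\<lambda>i. g (v i)) p"
proof -
  have z: "g 0 = 0" using assms(1)[of 0 0] by (metis add_cancel_right_right add_0_right)
  have s: "g (sum f I) = (\<Sum>i\<in>I. g (f i))" for f and I :: "(nat \<Rightarrow>\<^sub>0 nat) set"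
    by (induction I rule: infinite_finite_induct) (auto simp: assms(1) z)
  have pw: "g (a ^ n) = g a ^ n" for a and n :: nat
    by (induction n) (auto simp: assms)
  have pr: "g (prod f I) = (\<Prod>i\<in>I. g (f i))" for f and I :: "nat set"
    by (induction I rule: infinite_finite_induct) (auto simp: assms)
  show ?thesis by (simp add: eval_hom_def s pr pw assms)
qed

end

lemma peval_hom: "coefficient_hom (\<lambda>a :: 'k::comm_ring_1. a)"
  by standard auto

lemma mconst_coefficient_hom: "coefficient_hom (mconst :: 'k::comm_ring_1 \<Rightarrow> ('v, 'k) mps)"
  by standard (auto simp: mconst_hom)

lemmas peval_simps =
  coefficient_hom.eval_hom_add[OF peval_hom, folded peval_def]
  coefficient_hom.eval_hom_mult[OF peval_hom, folded peval_def]
  coefficient_hom.eval_hom_one[OF peval_hom, folded peval_def]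
  coefficient_hom.eval_hom_zero[OF peval_hom, folded peval_def]

lemma mcoeff_taylor_0: "mcoeff (taylor \<tau> p) 0 = peval \<tau> p"
proof -
  have "0 \<noteq> Poly_Mapping.single (S i) (1 :: nat)" for i
    by (metis lookup_single_eq lookup_zero zero_neq_one)
  then have "mcoeff (mconst (\<tau> i) + mvar (S i)) 0 = \<tau> i" for i
    by (simp add: mcoeff_mconst mvar_eq mcoeff_mmon del: One_nat_def)
  then show ?thesis
    unfolding taylor_def peval_def
    by (subst coefficient_hom.eval_hom_compose[OF mconst_coefficient_hom, of "\<lambda>f. mcoeff f 0"])
      (simp_all add: mcoeff_mult_0 mcoeff_one mcoeff_mconst)
qed

lemma peval_cong:
  assumes "p \<in> tau_polys s" "\<And>i. i \<in> {1..s} \<Longrightarrow> \<tau> i = \<tau>' i"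
  shows "peval \<tau> p = peval \<tau>' p"
  unfolding peval_def eval_hom_def
proof (rule sum.cong[OF refl])
  fix m assume "m \<in> keys p"
  then have "keys m \<subseteq> {1..s}" using assms(1) by (auto simp: tau_polys_def)
  then have "(\<Prod>i\<in>keys m. \<tau> i ^ lookup m i) = (\<Prod>i\<in>keys m. \<tau>' i ^ lookup m i)"
    by (intro prod.cong[OF refl]) (use assms(2) in auto)
  then show "lookup p m * (\<Prod>i\<in>keys m. \<tau> i ^ lookup m i) = lookup p m * (\<Prod>i\<in>keys m. \<tau>' i ^ lookup m i)" by simp
qed

text \<open>Reduction modulo \<open>B\<close> isolates the lowest digit. This makes the exponents in
  the Kronecker substitution distinct.\<close>

lemma digits_unique:
  fixes f g :: "nat \<Rightarrow> nat"
  assumes "\<And>i. f i < B" "\<And>i. g i < B" "(\<Sum>i<n. B ^ i * f i) = (\<Sum>i<n. B ^ i * g i)" "i < n"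
  shows "f i = g i"
  using assms
proof (induction n arbitrary: f g i)
  case (Suc n)
  let ?F = "\<lambda>f. \<Sum>i<n. B ^ i * f (Suc i)"
  have e: "(\<Sum>i<Suc n. B ^ i * f i) = f 0 + B * ?F f" for f
    by (simp add: sum.lessThan_Suc_shift sum_distrib_left mult_ac del: sum.lessThan_Suc)
  have eq: "f 0 + B * ?F f = g 0 + B * ?F g" using Suc.prems(3) unfolding e .
  have "(f 0 + B * ?F f) mod B = (g 0 + B * ?F g) mod B" by (simp only: eq)
  then have 0: "f 0 = g 0" using Suc.prems(1,2) by simp
  moreover have "B > 0" using Suc.prems(1)[of 0] by simp
  ultimately have "?F f = ?F g" using eq by simp
  then have "f (Suc j) = g (Suc j)" if "j < n" for j
    using Suc.IH[of "\<lambda>i. f (Suc i)" "\<lambda>i. g (Suc i)" j] Suc.prems(1,2) that by blast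
  then show ?case using 0 Suc.prems(4) by (cases i) auto
qed simp

text \<open>Kronecker substitution $\tau_i = z^{B^i}$ with \<open>B\<close> larger than all exponents.\<close>

lemma nonvanishing_point:
  fixes p :: "'k::{idom,ring_char_0} taupoly"
  assumes p: "p \<in> tau_polys s" "p \<noteq> 0"
  shows "\<exists>\<tau>\<in>affine_space s. peval \<tau> p \<noteq> 0"
proof -
  define B where "B = Suc (\<Sum>m\<in>keys p. \<Sum>i\<in>keys m. lookup m i)"
  have B: "lookup m i < B" if "m \<in> keys p" for m i
  proof -
    have "lookup m i \<le> (\<Sum>i\<in>keys m. lookup m i)" by (rule lookup_le_sum)
    also have "\<dots> \<le> (\<Sum>m\<in>keys p. \<Sum>i\<in>keys m. lookup m i)" by (rule member_le_sum) (use that in auto)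
    finally show ?thesis by (simp add: B_def)
  qed
  \<comment> \<open>The exponent of \<open>z\<close> to which the substitution sends
    \<open>m\<close>. Its base \<open>B\<close> digits are the exponents in \<open>m\<close>, so
    distinct monomials of \<open>p\<close> cannot cancel. The variable of index 0 does not occur in
    \<open>p\<close> and contributes the digit 0.\<close>
  define \<kappa> where "\<kappa> = (\<lambda>m :: nat \<Rightarrow>\<^sub>0 nat. \<Sum>i<Suc s. B ^ i * lookup m i)"
  have inj: "m = n" if "m \<in> keys p" "n \<in> keys p" "\<kappa> m = \<kappa> n" for m n
  proof (rule poly_mapping_eqI)
    fix i
    show "lookup m i = lookup n i"
    proof (cases "i < Suc s")
      case True
      show ?thesis
        by (rule digits_unique[where n = "Suc s" and B = B]) (use B that True in \<open>auto simp: \<kappa>_def\<close>)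
    next
      case False
      moreover have "keys m \<subseteq> {1..s}" "keys n \<subseteq> {1..s}" using p(1) that by (auto simp: tau_polys_def)
      ultimately have "i \<notin> keys m" "i \<notin> keys n" by (meson atLeastAtMost_iff less_Suc_eq_le subsetD)+
      then show ?thesis by (simp add: in_keys_iff)
    qed
  qed
  have hc: "coefficient_hom (\<lambda>a :: 'k. [:a:])" by standard simp_all
  define H where "H = eval_hom (\<lambda>a :: 'k. [:a:]) (\<lambda>i. monom 1 (B ^ i)) p"
  have mv: "mono_val (\<lambda>i. monom (1 :: 'k) (B ^ i)) m = monom 1 (\<kappa> m)" if "m \<in> keys p" for m
  proof -
    have "keys m \<subseteq> {1..s}" using p(1) that by (auto simp: tau_polys_def)
    then have "keys m \<subseteq> {..<Suc s}" by (auto dest: subsetD)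
    then have "mono_val (\<lambda>i. monom (1 :: 'k) (B ^ i)) m = (\<Prod>i<Suc s. monom 1 (B ^ i) ^ lookup m i)"
      by (intro mono_val_superset) auto
    also have "\<dots> = (\<Prod>i<Suc s. monom 1 (B ^ i * lookup m i))"
      by (simp add: monom_power mult.commute)
    also have "\<dots> = monom 1 (\<Sum>i<Suc s. B ^ i * lookup m i)"
      by (induction s) (simp_all add: mult_monom)
    finally show ?thesis by (simp add: \<kappa>_def)
  qed
  obtain m where m: "m \<in> keys p" using p(2) by (metis all_not_in_conv keys_eq_empty)
  have "H = (\<Sum>n\<in>keys p. monom (lookup p n) (\<kappa> n))"
    unfolding H_def coefficient_hom.eval_hom_superset[OF hc finite_keys order_refl]
    by (rule sum.cong[OF refl]) (simp add: mv smult_monom)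
  then have "coeff H (\<kappa> m) = (\<Sum>n\<in>keys p. if \<kappa> n = \<kappa> m then lookup p n else 0)"
    by (simp add: coeff_sum)
  also have "\<dots> = (\<Sum>n\<in>keys p. if n = m then lookup p n else 0)"
    by (rule sum.cong[OF refl]) (use inj m in auto)
  also have "\<dots> = lookup p m" using m by simp
  finally have "H \<noteq> 0" using m by (auto simp: in_keys_iff)
  then have "finite {z. poly H z = 0}" by (rule poly_roots_finite)
  then have "{z. poly H z = 0} \<noteq> UNIV" using infinite_UNIV_char_0 by metis
  then obtain z where z: "poly H z \<noteq> 0" by blast
  \<comment> \<open>Points of \<open>affine_space s\<close> are functions that are undefined outside
    \<open>{1..s}\<close>.\<close>
  let ?\<tau> = "restrict (\<lambda>i. z ^ (B ^ i)) {1..s}"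
  have "poly H z = peval (\<lambda>i. z ^ (B ^ i)) p"
    unfolding H_def peval_def
    by (subst coefficient_hom.eval_hom_compose[OF hc, of "\<lambda>q. poly q z"]) (simp_all add: poly_monom)
  also have "\<dots> = peval ?\<tau> p" by (rule peval_cong[OF p(1)]) simp
  finally show ?thesis using z by (intro bexI[of _ ?\<tau>]) (auto simp: affine_space_def)
qed

text \<open>The expansion is the translated polynomial \<open>q\<close>, read as a series, and the
  series determines \<open>q\<close>. Evaluating \<open>q\<close> at \<open>\<tau>' - \<tau>\<close>
  recovers the value of \<open>p\<close> at a point \<open>\<tau>'\<close> where \<open>p\<close>
  does not vanish, so \<open>q\<close> is not 0.\<close>

lemma taylor_injective:
  fixes p :: "'k::{idom,ring_char_0} taupoly"
  assumes p: "p \<in> tau_polys s" "p \<noteq> 0"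
  shows "taylor \<tau> p \<noteq> 0"
proof
  assume t0: "taylor \<tau> p = 0"
  let ?const = "Poly_Mapping.single 0 :: 'k \<Rightarrow> 'k taupoly"
  let ?var = "\<lambda>i. Poly_Mapping.single (Poly_Mapping.single i 1) 1 :: 'k taupoly"
  have hc: "coefficient_hom ?const" by standard (simp_all add: single_add mult_single)
  define q where "q = eval_hom ?const (\<lambda>i. ?const (\<tau> i) + ?var i) p"
  define e0 where "e0 = eval_hom (mconst :: 'k \<Rightarrow> (var, 'k) mps) (\<lambda>i. mvar (S i))"
  have e0: "e0 (a + b) = e0 a + e0 b" "e0 (a * b) = e0 a * e0 b" "e0 1 = 1" for a b
    unfolding e0_def using coefficient_hom.eval_hom_add[OF mconst_coefficient_hom]
      coefficient_hom.eval_hom_mult[OF mconst_coefficient_hom] coefficient_hom.eval_hom_one[OF mconst_coefficient_hom] by blast+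
  have e0c: "e0 (?const a) = mconst a" "e0 (?var i) = mvar (S i)" for a i
    unfolding e0_def by (simp_all add: coefficient_hom.eval_hom_single[OF mconst_coefficient_hom] mconst_hom mono_val_def)
  have "e0 q = taylor \<tau> p"
    unfolding q_def taylor_def by (subst coefficient_hom.eval_hom_compose[OF hc e0]) (simp only: e0 e0c)
  then have e0q: "e0 q = 0" using t0 by simp
  \<comment> \<open>Renames the variable of index \<open>i\<close> to \<open>S i\<close> in a
    monomial.\<close>
  define \<sigma> where "\<sigma> = (\<lambda>m :: nat \<Rightarrow>\<^sub>0 nat. \<Sum>i\<in>keys m. Poly_Mapping.single (S i) (lookup m i))"
  have lsig: "lookup (\<sigma> m) (S i) = lookup m i" for m i
  proof -
    have "lookup (\<sigma> m) (S i) = (\<Sum>j\<in>keys m. if j = i then lookup m j else 0)"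
      unfolding \<sigma>_def lookup_sum by (rule sum.cong) (auto simp: lookup_single when_def)
    then show ?thesis by (simp add: in_keys_iff)
  qed
  have sinj: "\<sigma> m = \<sigma> n \<longleftrightarrow> m = n" for m n
    by (metis lsig poly_mapping_eqI)
  have mv: "mono_val (\<lambda>i. mvar (S i)) m = (mmon (\<sigma> m) :: (var, 'k) mps)" for m
  proof -
    have "(\<Prod>i\<in>I. mvar (S i) ^ lookup m i) = (mmon (\<Sum>i\<in>I. Poly_Mapping.single (S i) (lookup m i)) :: (var, 'k) mps)" if "finite I" for I
      using that
    proof (induction I rule: finite_induct)
      case empty
      show ?case by (auto intro!: mps_eqI simp: mcoeff_mmon mcoeff_one)
    qed (simp add: mvar_power mmon_mult)
    then show ?thesis by (simp add: mono_val_def \<sigma>_def)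
  qed
  have cf: "mcoeff (mconst a * mmon k) m = (if m = k then a else 0)" for a :: 'k and k m :: "var \<Rightarrow>\<^sub>0 nat"
    by (subst mcoeff_mult_single[of 0 m]) (auto simp: mcoeff_mconst mcoeff_mmon)
  have "lookup q m = 0" for m
  proof -
    have "e0 q = (\<Sum>n\<in>keys q. mconst (lookup q n) * mmon (\<sigma> n))"
      unfolding e0_def coefficient_hom.eval_hom_superset[OF mconst_coefficient_hom finite_keys order_refl] mv ..
    then have "mcoeff (e0 q) (\<sigma> m) = (\<Sum>n\<in>keys q. if n = m then lookup q n else 0)"
      by (simp add: mcoeff_sum cf sinj eq_commute)
    then show ?thesis using e0q by (simp add: in_keys_iff split: if_splits)
  qed
  then have "q = 0" by (intro poly_mapping_eqI) simp
  obtain \<tau>' where "peval \<tau>' p \<noteq> 0" using nonvanishing_point[OF p] by blast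
  moreover have "peval (\<lambda>i. \<tau>' i - \<tau> i) q = peval \<tau>' p"
    unfolding q_def
    by (subst coefficient_hom.eval_hom_compose[OF hc, of "peval (\<lambda>i. \<tau>' i - \<tau> i)"])
      (simp_all add: peval_simps, simp add: peval_def coefficient_hom.eval_hom_single[OF peval_hom] mono_val_def)
  ultimately show False using \<open>q = 0\<close> by (simp add: peval_simps)
qed

section \<open>The polynomials in \<tau> and their field of fractions\<close>

lemma tau_polys_closed:
  "0 \<in> tau_polys s" "1 \<in> tau_polys s"
  "p \<in> tau_polys s \<Longrightarrow> q \<in> tau_polys s \<Longrightarrow> p + q \<in> tau_polys s"
  "p \<in> tau_polys s \<Longrightarrow> - p \<in> tau_polys s"
  "p \<in> tau_polys s \<Longrightarrow> q \<in> tau_polys s \<Longrightarrow> p * q \<in> tau_polys s"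
  for p q :: "'k::idom taupoly"
proof -
  show "1 \<in> tau_polys s" by (simp add: tau_polys_def)
  assume p: "p \<in> tau_polys s"
  show "- p \<in> tau_polys s" using p by (simp add: tau_polys_def)
  assume q: "q \<in> tau_polys s"
  show "p + q \<in> tau_polys s" using p q keys_add[of p q] by (auto simp: tau_polys_def)
  show "p * q \<in> tau_polys s"
    unfolding tau_polys_def
  proof clarify
    fix m i assume "m \<in> keys (p * q)" "i \<in> keys m"
    then obtain a b where "m = a + b" "a \<in> keys p" "b \<in> keys q" using keys_mult[of p q] by blast
    then show "i \<in> {1..s}" using p q keys_add[of a b] \<open>i \<in> keys m\<close> unfolding tau_polys_def by blast
  qed
qed (simp add: tau_polys_def)

lemma unital_subring_tau_polys: "unital_subring (tau_polys s :: 'k::idom taupoly set)"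
  by standard (rule tau_polys_closed; assumption?)+

lemma subfield_tau_ratfuns: "subfield_set (tau_ratfuns s :: 'k::idom taupoly fract set)"
proof -
  interpret tp: unital_subring "tau_polys s :: 'k taupoly set" by (rule unital_subring_tau_polys)
  have I: "Fract p q \<in> tau_ratfuns s" if "p \<in> tau_polys s" "q \<in> tau_polys s" "q \<noteq> 0" for p q :: "'k taupoly"
    using that unfolding tau_ratfuns_def by blast
  have "unital_subring (tau_ratfuns s :: 'k taupoly fract set)"
  proof
    show "0 \<in> (tau_ratfuns s :: 'k taupoly fract set)" unfolding Zero_fract_def by (rule I) auto
    show "1 \<in> (tau_ratfuns s :: 'k taupoly fract set)" unfolding One_fract_def by (rule I) auto
    fix a b :: "'k taupoly fract" assume "a \<in> tau_ratfuns s" "b \<in> tau_ratfuns s"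
    then obtain p q p' q' where pq: "p \<in> tau_polys s" "q \<in> tau_polys s" "q \<noteq> 0" "a = Fract p q"
      "p' \<in> tau_polys s" "q' \<in> tau_polys s" "q' \<noteq> 0" "b = Fract p' q'"
      unfolding tau_ratfuns_def by blast
    show "a + b \<in> tau_ratfuns s" unfolding pq(4,8) add_fract[OF pq(3,7)]
      by (rule I) (use pq in \<open>auto intro!: tp.add_closed tp.mult_closed\<close>)
    show "- a \<in> tau_ratfuns s" unfolding pq(4) minus_fract by (rule I) (use pq in \<open>auto intro!: tp.uminus_closed\<close>)
    show "a * b \<in> tau_ratfuns s" unfolding pq(4,8) mult_fract by (rule I) (use pq in \<open>auto intro!: tp.mult_closed\<close>)
  qed
  moreover have "inverse a \<in> tau_ratfuns s" if "a \<in> tau_ratfuns s" for a :: "'k taupoly fract"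
  proof -
    obtain p q where pq: "p \<in> tau_polys s" "q \<in> tau_polys s" "q \<noteq> 0" "a = Fract p q"
      using \<open>a \<in> tau_ratfuns s\<close> unfolding tau_ratfuns_def by blast
    show ?thesis
    proof (cases "p = 0")
      case True
      then show ?thesis using pq calculation by (simp add: unital_subring.zero_closed flip: Zero_fract_def) (simp add: fract_collapse unital_subring.zero_closed)
    next
      case False
      then show ?thesis unfolding pq(4) inverse_fract using pq by (intro I)
    qed
  qed
  ultimately show ?thesis by (simp add: subfield_set_def)
qed

section \<open>Specialization and expansion of power series\<close>

text \<open>Separates the exponents of the local parameters \<open>S i\<close> from the others, so
  that a series can be read as one in the remaining variables with coefficients in
  \<open>k[[S]]\<close>.\<close>

definition part :: "'v set \<Rightarrow> ('v \<Rightarrow>\<^sub>0 nat) \<Rightarrow> ('v \<Rightarrow>\<^sub>0 nat)" where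
  "part Z m = (\<Sum>v\<in>keys m \<inter> Z. Poly_Mapping.single v (lookup m v))"

lemma lookup_part: "lookup (part Z m) v = (if v \<in> Z then lookup m v else 0)"
proof -
  have "lookup (part Z m) v = (\<Sum>u\<in>keys m \<inter> Z. if u = v then lookup m u else 0)"
    unfolding part_def lookup_sum by (rule sum.cong) (auto simp: lookup_single when_def)
  then show ?thesis by (auto simp: in_keys_iff)
qed

lemma keys_part: "keys (part Z m) = keys m \<inter> Z"
  by (auto simp: in_keys_iff lookup_part split: if_splits)

lemma part_disjoint_add:
  assumes "keys a \<inter> Z = {}" "keys b \<subseteq> Z"
  shows "part (- Z) (a + b) = a" "part Z (a + b) = b"
proof -
  have "lookup a v = 0" if "v \<in> Z" for v using assms(1) that by (auto simp: in_keys_iff)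
  moreover have "lookup b v = 0" if "v \<notin> Z" for v using assms(2) that by (auto simp: in_keys_iff)
  ultimately show "part (- Z) (a + b) = a" "part Z (a + b) = b"
    by (auto intro!: poly_mapping_eqI simp: lookup_part lookup_add)
qed

lemma part_add: "part Z (p + q) = part Z p + part Z q"
  by (rule poly_mapping_eqI) (simp add: lookup_part lookup_add)

lemma part_part: "part (- Z) m + part Z m = m"
  by (rule poly_mapping_eqI) (simp add: lookup_part lookup_add)

lemma part_id: "keys m \<subseteq> Z \<Longrightarrow> part Z m = m"
  by (rule poly_mapping_eqI) (auto simp: lookup_part in_keys_iff)

lemma part_zero: "keys m \<inter> Z = {} \<Longrightarrow> part Z m = 0"
  by (rule poly_mapping_eqI) (auto simp: lookup_part in_keys_iff)

lemma mcoeff_s_coeff: "mcoeff (s_coeff g \<alpha>) \<beta> = (if keys \<beta> \<subseteq> range S then mcoeff g (\<alpha> + \<beta>) else 0)"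
  by (simp add: s_coeff_def)

lemma s_coeff_eqI:
  assumes "\<And>\<alpha>. keys \<alpha> \<inter> range S = {} \<Longrightarrow> s_coeff f \<alpha> = s_coeff g \<alpha>"
  shows "f = g"
proof (rule mps_eqI)
  fix m
  have "keys (part (- range S) m) \<inter> range S = {}" by (auto simp: keys_part)
  from assms[OF this] have "mcoeff (s_coeff f (part (- range S) m)) (part (range S) m) = mcoeff (s_coeff g (part (- range S) m)) (part (range S) m)"
    by simp
  then show "mcoeff f m = mcoeff g m" by (simp add: mcoeff_s_coeff keys_part part_part)
qed

lemma s_coeff_add: "s_coeff (f + g) \<alpha> = s_coeff f \<alpha> + s_coeff g \<alpha>"
  by (rule mps_eqI) (simp add: mcoeff_s_coeff)

text \<open>The Cauchy product with coefficients in \<open>k[[S]]\<close>: a decomposition of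
  \<open>\<alpha> + \<beta>\<close> amounts to one of \<open>\<alpha>\<close> together with one of
  \<open>\<beta>\<close>.\<close>

lemma s_coeff_mult:
  assumes \<alpha>: "keys \<alpha> \<inter> range S = {}"
  shows "s_coeff (f * g) \<alpha> = (\<Sum>(a, b)\<in>splits \<alpha>. s_coeff f a * s_coeff g b)"
proof (rule mps_eqI)
  fix \<beta>
  have rhs: "mcoeff (\<Sum>(a, b)\<in>splits \<alpha>. s_coeff f a * s_coeff g b) \<beta> =
    (\<Sum>x\<in>splits \<alpha>. \<Sum>y\<in>splits \<beta>. mcoeff (s_coeff f (fst x)) (fst y) * mcoeff (s_coeff g (snd x)) (snd y))"
    by (simp add: mcoeff_sum mcoeff_mult case_prod_unfold)
  show "mcoeff (s_coeff (f * g) \<alpha>) \<beta> = mcoeff (\<Sum>(a, b)\<in>splits \<alpha>. s_coeff f a * s_coeff g b) \<beta>"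
  proof (cases "keys \<beta> \<subseteq> range S")
    case True
    have "(\<Sum>x\<in>splits \<alpha>. \<Sum>y\<in>splits \<beta>. mcoeff (s_coeff f (fst x)) (fst y) * mcoeff (s_coeff g (snd x)) (snd y)) =
      (\<Sum>x\<in>splits \<alpha>. \<Sum>y\<in>splits \<beta>. mcoeff f (fst x + fst y) * mcoeff g (snd x + snd y))"
    proof (intro sum.cong refl)
      fix x y assume "x \<in> splits \<alpha>" and y: "y \<in> splits \<beta>"
      obtain c d where cd: "y = (c, d)" by (cases y)
      have "c + d = \<beta>" using y cd by simp
      then have "keys c \<subseteq> range S" "keys d \<subseteq> range S"
        using True keys_subset_add_left[of c d] keys_subset_add_right[of d c] by auto
      then show "mcoeff (s_coeff f (fst x)) (fst y) * mcoeff (s_coeff g (snd x)) (snd y) =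
          mcoeff f (fst x + fst y) * mcoeff g (snd x + snd y)" by (simp add: mcoeff_s_coeff cd)
    qed
    also have "\<dots> = (\<Sum>z\<in>splits \<alpha> \<times> splits \<beta>. mcoeff f (fst (fst z) + fst (snd z)) * mcoeff g (snd (fst z) + snd (snd z)))"
      by (simp add: sum.cartesian_product case_prod_unfold)
    also have "\<dots> = (\<Sum>w\<in>splits (\<alpha> + \<beta>). mcoeff f (fst w) * mcoeff g (snd w))"
    proof (rule sum.reindex_bij_witness[of _
        "\<lambda>w. ((part (- range S) (fst w), part (- range S) (snd w)), (part (range S) (fst w), part (range S) (snd w)))"
        "\<lambda>z. (fst (fst z) + fst (snd z), snd (fst z) + snd (snd z))"])
      fix z assume z: "z \<in> splits \<alpha> \<times> splits \<beta>"
      obtain a b c d where zz: "z = ((a, b), (c, d))" by (metis surj_pair)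
      have ab: "a + b = \<alpha>" "c + d = \<beta>" using z zz by auto
      then have k: "keys a \<inter> range S = {}" "keys b \<inter> range S = {}" "keys c \<subseteq> range S" "keys d \<subseteq> range S"
        using True \<alpha> keys_subset_add_left[of a b] keys_subset_add_right[of b a]
          keys_subset_add_left[of c d] keys_subset_add_right[of d c] by auto
      show "((part (- range S) (fst (fst (fst z) + fst (snd z), snd (fst z) + snd (snd z))),
          part (- range S) (snd (fst (fst z) + fst (snd z), snd (fst z) + snd (snd z)))),
         part (range S) (fst (fst (fst z) + fst (snd z), snd (fst z) + snd (snd z))),
         part (range S) (snd (fst (fst z) + fst (snd z), snd (fst z) + snd (snd z)))) = z"
        using k by (simp add: zz part_disjoint_add)
      show "(fst (fst z) + fst (snd z), snd (fst z) + snd (snd z)) \<in> splits (\<alpha> + \<beta>)"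
        using ab by (simp add: zz algebra_simps)
      show "mcoeff f (fst (fst (fst z) + fst (snd z), snd (fst z) + snd (snd z))) *
         mcoeff g (snd (fst (fst z) + fst (snd z), snd (fst z) + snd (snd z))) =
         mcoeff f (fst (fst z) + fst (snd z)) * mcoeff g (snd (fst z) + snd (snd z))" by simp
    next
      fix w assume w: "w \<in> splits (\<alpha> + \<beta>)"
      obtain p q where pq: "w = (p, q)" by (cases w)
      have "p + q = \<alpha> + \<beta>" using w pq by simp
      then have "part Z p + part Z q = part Z \<alpha> + part Z \<beta>" for Z by (metis part_add)
      moreover have "part (- range S) \<alpha> = \<alpha>" "part (range S) \<alpha> = 0" "part (- range S) \<beta> = 0" "part (range S) \<beta> = \<beta>"
        using \<alpha> True by (auto intro!: part_id part_zero)
      ultimately show "((part (- range S) (fst w), part (- range S) (snd w)), (part (range S) (fst w), part (range S) (snd w)))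
          \<in> splits \<alpha> \<times> splits \<beta>" by (simp add: pq)
      show "(fst (fst ((part (- range S) (fst w), part (- range S) (snd w)), part (range S) (fst w), part (range S) (snd w))) +
           fst (snd ((part (- range S) (fst w), part (- range S) (snd w)), part (range S) (fst w), part (range S) (snd w))),
           snd (fst ((part (- range S) (fst w), part (- range S) (snd w)), part (range S) (fst w), part (range S) (snd w))) +
           snd (snd ((part (- range S) (fst w), part (- range S) (snd w)), part (range S) (fst w), part (range S) (snd w)))) = w"
        by (simp add: pq part_part)
    qed
    also have "\<dots> = mcoeff (s_coeff (f * g) \<alpha>) \<beta>"
      using True by (simp add: mcoeff_s_coeff mcoeff_mult case_prod_unfold)
    finally show ?thesis unfolding rhs ..
  next
    case False
    have "mcoeff (s_coeff f (fst x)) (fst y) * mcoeff (s_coeff g (snd x)) (snd y) = 0"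
      if y: "y \<in> splits \<beta>" for x y :: "(var \<Rightarrow>\<^sub>0 nat) \<times> (var \<Rightarrow>\<^sub>0 nat)"
    proof -
      obtain c d where cd: "y = (c, d)" by (cases y)
      have "c + d = \<beta>" using y cd by simp
      then have "\<not> (keys c \<subseteq> range S \<and> keys d \<subseteq> range S)" using False keys_add[of c d] by blast
      then show ?thesis by (auto simp: mcoeff_s_coeff cd)
    qed
    then show ?thesis unfolding rhs using False by (simp add: mcoeff_s_coeff)
  qed
qed

text \<open>
  A homomorphism \<open>h\<close> from $k[\tau]$ to $k[[\Sigma]]$ extends to those fractions \<open>p/q\<close> for which
  \<open>h q\<close> divides \<open>h p\<close>, and then to power series with such coefficients. Specialization at \<open>\<tau>\<close> is the
  case \<open>\<Sigma> = {}\<close>, expansion at \<open>\<tau>\<close> the case of the Taylor homomorphism.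
\<close>

definition localization :: "nat \<Rightarrow> var set \<Rightarrow> ('k::field taupoly \<Rightarrow> (var, 'k) mps) \<Rightarrow> 'k taupoly fract set" where
  "localization s \<Sigma> h = {Fract p q | p q. p \<in> tau_polys s \<and> q \<in> tau_polys s \<and> h q \<noteq> 0 \<and>
     (\<exists>y\<in>series_over UNIV \<Sigma>. h p = h q * y)}"

definition fract_value :: "nat \<Rightarrow> ('k::field taupoly \<Rightarrow> (var, 'k) mps) \<Rightarrow> 'k taupoly fract \<Rightarrow> (var, 'k) mps" where
  "fract_value s h a = (THE y. \<exists>p q. p \<in> tau_polys s \<and> q \<in> tau_polys s \<and> h q \<noteq> 0 \<and> a = Fract p q \<and> h p = h q * y)"

definition map_series :: "nat \<Rightarrow> ('k::field taupoly \<Rightarrow> (var, 'k) mps) \<Rightarrow> (var, 'k taupoly fract) mps \<Rightarrow> (var, 'k) mps" where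
  "map_series s h F = Abs_mps (\<lambda>m. mcoeff (fract_value s h (mcoeff F (part (- range S) m))) (part (range S) m))"

text \<open>Evaluation and Taylor expansion are treated together. The constant term required by
  \<open>h_0\<close> makes \<open>h c\<close> a unit wherever \<open>c\<close> does not
  vanish.\<close>

locale specialization =
  fixes s :: nat and \<Sigma> :: "var set" and \<tau> :: "nat \<Rightarrow> 'k::field_char_0" and h :: "'k taupoly \<Rightarrow> (var, 'k) mps"
  assumes Sig: "\<Sigma> \<subseteq> range S"
    and h_add: "h (p + q) = h p + h q" and h_mult: "h (p * q) = h p * h q" and h_one: "h 1 = 1"
    and h_0: "mcoeff (h p) 0 = peval \<tau> p"
    and h_closed: "p \<in> tau_polys s \<Longrightarrow> h p \<in> series_over UNIV \<Sigma>"
begin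

abbreviation "L \<equiv> localization s \<Sigma> h"
abbreviation "\<phi> \<equiv> fract_value s h"
abbreviation "\<Phi> \<equiv> map_series s h"
abbreviation "KS \<equiv> series_over UNIV \<Sigma> :: (var, 'k) mps set"

interpretation tp: unital_subring "tau_polys s :: 'k taupoly set" by (rule unital_subring_tau_polys)
interpretation KS: unital_subring KS by (rule unital_subring_series_over[OF unital_subring_UNIV])

lemma h_zero: "h 0 = 0"
  using h_add[of 0 0] by (metis add_cancel_right_right add_0_right)

lemma h_uminus: "h (- p) = - h p"
  using h_add[of p "- p"] by (simp add: h_zero eq_neg_iff_add_eq_0 add.commute)

lemma h_power: "h (p ^ n) = h p ^ n"
  by (induction n) (simp_all add: h_one h_mult)

lemma fract_valueI:
  assumes "p \<in> tau_polys s" "q \<in> tau_polys s" "h q \<noteq> 0" "h p = h q * y"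
  shows "\<phi> (Fract p q) = y"
  unfolding fract_value_def
proof (rule the_equality)
  show "\<exists>p' q'. p' \<in> tau_polys s \<and> q' \<in> tau_polys s \<and> h q' \<noteq> 0 \<and> Fract p q = Fract p' q' \<and> h p' = h q' * y"
    using assms by blast
  fix y' assume "\<exists>p' q'. p' \<in> tau_polys s \<and> q' \<in> tau_polys s \<and> h q' \<noteq> 0 \<and> Fract p q = Fract p' q' \<and> h p' = h q' * y'"
  then obtain p' q' where *: "h q' \<noteq> 0" "Fract p q = Fract p' q'" "h p' = h q' * y'" by blast
  have "q \<noteq> 0" "q' \<noteq> 0" using assms(3) *(1) h_zero by auto
  then have "p * q' = p' * q" using *(2) by (simp add: eq_fract)
  then have "h p * h q' = h p' * h q" by (metis h_mult)
  then have "(h q * h q') * y' = (h q * h q') * y" by (simp only: assms(4) *(3) mult_ac)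
  then show "y' = y" using assms(3) *(1) by simp
qed

lemma localizationI:
  assumes "p \<in> tau_polys s" "q \<in> tau_polys s" "h q \<noteq> 0" "h p = h q * y" "y \<in> KS"
  shows "Fract p q \<in> L"
  using assms unfolding localization_def by blast

lemma localizationE:
  assumes "a \<in> L"
  obtains p q where "p \<in> tau_polys s" "q \<in> tau_polys s" "h q \<noteq> 0" "q \<noteq> 0" "a = Fract p q" "h p = h q * \<phi> a" "\<phi> a \<in> KS"
proof -
  obtain p q y where *: "p \<in> tau_polys s" "q \<in> tau_polys s" "h q \<noteq> 0" "a = Fract p q" "h p = h q * y" "y \<in> KS"
    using assms unfolding localization_def by blast
  then have "\<phi> a = y" using fract_valueI by blast
  then show ?thesis using that[of p q] * h_zero by auto
qed

lemma value_closed: "a \<in> L \<Longrightarrow> \<phi> a \<in> KS"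
  by (elim localizationE)

lemma localization_0: "0 \<in> L" "\<phi> 0 = 0"
  using localizationI[of 0 1 0] fract_valueI[of 0 1 0] by (simp_all add: h_one h_zero Zero_fract_def)

lemma localization_1: "1 \<in> L" "\<phi> 1 = 1"
  using localizationI[of 1 1 1] fract_valueI[of 1 1 1] by (simp_all add: h_one One_fract_def)

lemma localization_add:
  assumes "a \<in> L" "b \<in> L"
  shows "a + b \<in> L \<and> \<phi> (a + b) = \<phi> a + \<phi> b"
proof -
  obtain p q where a: "p \<in> tau_polys s" "q \<in> tau_polys s" "h q \<noteq> 0" "q \<noteq> 0" "a = Fract p q" "h p = h q * \<phi> a" "\<phi> a \<in> KS"
    using assms(1) by (rule localizationE)
  obtain p' q' where b: "p' \<in> tau_polys s" "q' \<in> tau_polys s" "h q' \<noteq> 0" "q' \<noteq> 0" "b = Fract p' q'" "h p' = h q' * \<phi> b" "\<phi> b \<in> KS"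
    using assms(2) by (rule localizationE)
  have ab: "a + b = Fract (p * q' + p' * q) (q * q')" unfolding a(5) b(5) using a(4) b(4) by (rule add_fract)
  have eq: "h (p * q' + p' * q) = h (q * q') * (\<phi> a + \<phi> b)"
    unfolding h_add h_mult using a(6) b(6) by (simp add: algebra_simps)
  have m: "p * q' + p' * q \<in> tau_polys s" "q * q' \<in> tau_polys s" "h (q * q') \<noteq> 0"
    using a b by (auto simp: h_mult intro!: tp.add_closed tp.mult_closed)
  show ?thesis unfolding ab
    using localizationI[OF m eq KS.add_closed[OF a(7) b(7)]] fract_valueI[OF m eq] by blast
qed

lemma localization_mult:
  assumes "a \<in> L" "b \<in> L"
  shows "a * b \<in> L \<and> \<phi> (a * b) = \<phi> a * \<phi> b"
proof -
  obtain p q where a: "p \<in> tau_polys s" "q \<in> tau_polys s" "h q \<noteq> 0" "q \<noteq> 0" "a = Fract p q" "h p = h q * \<phi> a" "\<phi> a \<in> KS"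
    using assms(1) by (rule localizationE)
  obtain p' q' where b: "p' \<in> tau_polys s" "q' \<in> tau_polys s" "h q' \<noteq> 0" "q' \<noteq> 0" "b = Fract p' q'" "h p' = h q' * \<phi> b" "\<phi> b \<in> KS"
    using assms(2) by (rule localizationE)
  have ab: "a * b = Fract (p * p') (q * q')" unfolding a(5) b(5) by (rule mult_fract)
  have "h (p * p') = (h q * \<phi> a) * (h q' * \<phi> b)" unfolding h_mult using a(6) b(6) by simp
  then have eq: "h (p * p') = h (q * q') * (\<phi> a * \<phi> b)" by (simp only: h_mult mult_ac)
  have m: "p * p' \<in> tau_polys s" "q * q' \<in> tau_polys s" "h (q * q') \<noteq> 0"
    using a b by (auto simp: h_mult intro!: tp.mult_closed)
  show ?thesis unfolding ab
    using localizationI[OF m eq KS.mult_closed[OF a(7) b(7)]] fract_valueI[OF m eq] by blast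
qed

lemma localization_uminus:
  assumes "a \<in> L"
  shows "- a \<in> L"
proof -
  obtain p q where a: "p \<in> tau_polys s" "q \<in> tau_polys s" "h q \<noteq> 0" "q \<noteq> 0" "a = Fract p q" "h p = h q * \<phi> a" "\<phi> a \<in> KS"
    using assms(1) by (rule localizationE)
  have "h (- p) = h q * (- \<phi> a)" using a(6) by (simp add: h_uminus)
  then show ?thesis unfolding a(5) minus_fract
    using localizationI[of "- p" q "- \<phi> a"] a by (auto intro: tp.uminus_closed KS.uminus_closed)
qed

lemma partial_hom_value: "partial_hom L \<phi>"
  by standard (auto simp: localization_0 localization_1 localization_add localization_mult localization_uminus)

sublocale val: partial_hom L \<phi> by (rule partial_hom_value)

lemma subring_L: "unital_subring L" by (rule val.unital_subring_axioms)

lemma localization_ratfun: "a \<in> L \<Longrightarrow> a \<in> tau_ratfuns s"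
  by (elim localizationE) (auto simp: tau_ratfuns_def)

lemma mcoeff_map_series: "mcoeff (\<Phi> F) m = mcoeff (\<phi> (mcoeff F (part (- range S) m))) (part (range S) m)"
  by (simp add: map_series_def)

abbreviation "D \<equiv> series_over L (- range S)"

sublocale D: unital_subring D by (rule unital_subring_series_over[OF subring_L])

lemma s_coeff_map_series:
  assumes "F \<in> D" "keys \<alpha> \<inter> range S = {}"
  shows "s_coeff (\<Phi> F) \<alpha> = \<phi> (mcoeff F \<alpha>)"
proof (rule mps_eqI)
  fix \<beta>
  have F: "mcoeff F \<alpha> \<in> L" using assms(1) by (rule series_overD)
  show "mcoeff (s_coeff (\<Phi> F) \<alpha>) \<beta> = mcoeff (\<phi> (mcoeff F \<alpha>)) \<beta>"
  proof (cases "keys \<beta> \<subseteq> range S")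
    case True
    have "part (- range S) (\<alpha> + \<beta>) = \<alpha>" "part (range S) (\<alpha> + \<beta>) = \<beta>"
      using part_disjoint_add[OF assms(2) True] by blast+
    then show ?thesis using True by (simp add: mcoeff_s_coeff mcoeff_map_series)
  next
    case False
    then have "\<not> keys \<beta> \<subseteq> \<Sigma>" using Sig by blast
    then have "mcoeff (\<phi> (mcoeff F \<alpha>)) \<beta> = 0" using series_overD(2)[OF value_closed[OF F]] by blast
    then show ?thesis using False by (simp add: mcoeff_s_coeff)
  qed
qed

lemma partial_hom_map_series: "partial_hom D \<Phi>"
proof
  fix F G assume F: "F \<in> D" and G: "G \<in> D"
  show "\<Phi> (F + G) = \<Phi> F + \<Phi> G"
  proof (rule s_coeff_eqI)
    fix \<alpha> :: "var \<Rightarrow>\<^sub>0 nat" assume \<alpha>: "keys \<alpha> \<inter> range S = {}"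
    show "s_coeff (\<Phi> (F + G)) \<alpha> = s_coeff (\<Phi> F + \<Phi> G) \<alpha>"
      using F G series_overD(1)[OF F] series_overD(1)[OF G]
      by (simp add: s_coeff_add s_coeff_map_series[OF _ \<alpha>] D.add_closed val.hom_add)
  qed
  show "\<Phi> (F * G) = \<Phi> F * \<Phi> G"
  proof (rule s_coeff_eqI)
    fix \<alpha> :: "var \<Rightarrow>\<^sub>0 nat" assume \<alpha>: "keys \<alpha> \<inter> range S = {}"
    have sub: "keys a \<inter> range S = {} \<and> keys b \<inter> range S = {}" if "a + b = \<alpha>" for a b
      using that \<alpha> keys_subset_add_left[of a b] keys_subset_add_right[of b a] by blast
    have "s_coeff (\<Phi> (F * G)) \<alpha> = \<phi> (\<Sum>(a, b)\<in>splits \<alpha>. mcoeff F a * mcoeff G b)"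
      using F G by (simp add: s_coeff_map_series[OF _ \<alpha>] D.mult_closed mcoeff_mult)
    also have "\<dots> = (\<Sum>x\<in>splits \<alpha>. \<phi> (case x of (a, b) \<Rightarrow> mcoeff F a * mcoeff G b))"
      by (rule val.hom_sum) (use series_overD(1)[OF F] series_overD(1)[OF G] in \<open>auto intro: val.mult_closed\<close>)
    also have "\<dots> = (\<Sum>(a, b)\<in>splits \<alpha>. s_coeff (\<Phi> F) a * s_coeff (\<Phi> G) b)"
    proof (rule sum.cong[OF refl])
      fix x assume x: "x \<in> splits \<alpha>"
      obtain a b where ab: "x = (a, b)" by (cases x)
      have "keys a \<inter> range S = {}" "keys b \<inter> range S = {}" using sub[of a b] x ab by auto
      then show "\<phi> (case x of (a, b) \<Rightarrow> mcoeff F a * mcoeff G b) = (case x of (a, b) \<Rightarrow> s_coeff (\<Phi> F) a * s_coeff (\<Phi> G) b)"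
        using series_overD(1)[OF F] series_overD(1)[OF G]
        by (simp add: ab s_coeff_map_series[OF F] s_coeff_map_series[OF G] val.hom_mult)
    qed
    finally show "s_coeff (\<Phi> (F * G)) \<alpha> = s_coeff (\<Phi> F * \<Phi> G) \<alpha>" by (simp add: s_coeff_mult[OF \<alpha>])
  qed
next
  show "\<Phi> 1 = 1"
  proof (rule mps_eqI)
    fix m
    show "mcoeff (\<Phi> 1) m = mcoeff 1 m"
    proof (cases "m = 0")
      case True
      then show ?thesis by (simp add: mcoeff_map_series mcoeff_one part_zero localization_1)
    next
      case False
      then have "part (- range S) m \<noteq> 0 \<or> part (range S) m \<noteq> 0" using part_part[of "range S" m] by auto
      then show ?thesis using False by (auto simp: mcoeff_map_series mcoeff_one localization_0 localization_1)
    qed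
  qed
qed

sublocale ser: partial_hom D \<Phi> by (rule partial_hom_map_series)

lemma series_D: "V \<inter> range S = {} \<Longrightarrow> F \<in> series_over L V \<Longrightarrow> F \<in> D"
  using series_over_mono[of L L V "- range S"] by blast

lemma partial_hom_series:
  assumes "V \<inter> range S = {}"
  shows "partial_hom (series_over L V) \<Phi>"
proof -
  interpret R: unital_subring "series_over L V" by (rule unital_subring_series_over[OF subring_L])
  show ?thesis
    by standard (use series_D[OF assms] in \<open>auto simp: ser.hom_add ser.hom_mult\<close>)
qed

lemma map_series_closed:
  assumes "V \<inter> range S = {}" "F \<in> series_over L V"
  shows "\<Phi> F \<in> series_over UNIV (V \<union> \<Sigma>)"
proof (rule series_overI)
  fix m :: "var \<Rightarrow>\<^sub>0 nat" assume nz: "mcoeff (\<Phi> F) m \<noteq> 0"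
  let ?a = "mcoeff F (part (- range S) m)"
  have "?a \<in> L" using assms(2) by (rule series_overD)
  then have "keys (part (range S) m) \<subseteq> \<Sigma>"
    using nz series_overD(2)[OF value_closed] by (simp add: mcoeff_map_series)
  moreover have "?a \<noteq> 0" using nz by (auto simp: mcoeff_map_series localization_0)
  then have "keys (part (- range S) m) \<subseteq> V" using assms(2) by (rule series_overD(2)[rotated])
  ultimately show "keys m \<subseteq> V \<union> \<Sigma>" by (auto simp: keys_part)
qed simp

lemma map_series_mvar:
  assumes "v \<notin> range S"
  shows "\<Phi> (mvar v) = mvar v"
proof (rule mps_eqI)
  fix m
  let ?v = "Poly_Mapping.single v (1 :: nat)"
  have v: "part (- range S) ?v = ?v" "part (range S) ?v = 0" using assms by (auto intro!: part_id part_zero)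
  show "mcoeff (\<Phi> (mvar v)) m = mcoeff (mvar v) m"
  proof (cases "m = ?v")
    case True
    then show ?thesis using v by (simp add: mcoeff_map_series mvar_eq mcoeff_mmon localization_1 mcoeff_one del: One_nat_def)
  next
    case False
    then have "part (- range S) m \<noteq> ?v \<or> part (range S) m \<noteq> 0" using part_part[of "range S" m] by auto
    then show ?thesis using False by (auto simp: mcoeff_map_series mvar_eq mcoeff_mmon localization_0 localization_1 mcoeff_one simp del: One_nat_def)
  qed
qed

lemma map_series_vanishes:
  assumes "vanishes_on_zero W F"
  shows "vanishes_on_zero W (\<Phi> F)"
  unfolding vanishes_on_zero_def
proof (intro allI impI)
  fix m :: "var \<Rightarrow>\<^sub>0 nat" assume "keys m \<inter> W = {}"
  then have "keys (part (- range S) m) \<inter> W = {}" by (auto simp: keys_part)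
  then show "mcoeff (\<Phi> F) m = 0"
    using assms by (simp add: mcoeff_map_series vanishes_on_zero_def localization_0)
qed

lemma map_series_unit:
  assumes "V \<inter> range S = {}" "series_unit L V u"
  shows "series_unit UNIV (V \<union> \<Sigma>) (\<Phi> u)"
proof -
  obtain w where w: "series_unit L V w" "u * w = 1" using series_unit_inverse[OF subring_L assms(2)] by blast
  have "u \<in> series_over L V" "w \<in> series_over L V" using assms(2) w(1) by (auto simp: series_unit_def)
  then have "\<Phi> u * \<Phi> w = 1" using series_D[OF assms(1)] w(2) by (metis ser.hom_mult ser.hom_one)
  then show ?thesis
    using map_series_closed[OF assms(1)] \<open>u \<in> series_over L V\<close> \<open>w \<in> series_over L V\<close> by (intro series_unit_if_dvd_one) auto
qed

lemma map_poly_series_closed: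
  assumes "V \<inter> range S = {}" "P \<in> poly_over (series_over L V)"
  shows "map_poly \<Phi> P \<in> poly_over (series_over UNIV (V \<union> \<Sigma>))"
proof -
  interpret R: unital_subring "series_over L V" by (rule unital_subring_series_over[OF subring_L])
  interpret R': unital_subring "series_over UNIV (V \<union> \<Sigma>) :: (var, 'k) mps set"
    by (rule unital_subring_series_over[OF unital_subring_UNIV])
  show ?thesis
    using map_series_closed[OF assms(1)] assms(2) by (simp add: R.poly_over_iff R'.poly_over_iff)
qed

lemma map_weierstrass_form:
  assumes V: "V \<inter> range S = {}" "v \<notin> range S" and F: "weierstrass_form L W V v F P"
  shows "weierstrass_form UNIV W (V \<union> \<Sigma>) v (\<Phi> F) (map_poly \<Phi> P)"
proof -
  have iV: "insert v V \<inter> range S = {}" using V by blast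
  interpret V: partial_hom "series_over L V" \<Phi> by (rule partial_hom_series[OF V(1)])
  interpret U: partial_hom "series_over L (insert v V)" \<Phi> by (rule partial_hom_series[OF iV])
  obtain u where P: "P \<in> poly_over (series_over L V)" "lead_coeff P = 1"
      "\<forall>j<degree P. vanishes_on_zero W (coeff P j)"
    and u: "series_unit L (insert v V) u" "F = u * poly P (mvar v)"
    using F unfolding weierstrass_form_def by blast
  have PU: "P \<in> poly_over (series_over L (insert v V))"
    using P(1) poly_over_mono[OF series_over_mono[of L L V "insert v V"]] by blast
  have m: "mvar v \<in> series_over L (insert v V)" by (rule mvar_closed[OF subring_L]) simp
  have "\<Phi> F = \<Phi> u * \<Phi> (poly P (mvar v))"
    unfolding u(2) using u(1) PU m by (intro U.hom_mult U.poly_closed) (auto simp: series_unit_def)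
  also have "\<Phi> (poly P (mvar v)) = poly (map_poly \<Phi> P) (mvar v)"
    using U.poly_map_poly[OF PU m] map_series_mvar[OF V(2)] by simp
  finally have "\<Phi> F = \<Phi> u * poly (map_poly \<Phi> P) (mvar v)" .
  moreover have "series_unit UNIV (insert v (V \<union> \<Sigma>)) (\<Phi> u)" using map_series_unit[OF iV u(1)] by simp
  moreover have "\<forall>j<degree (map_poly \<Phi> P). vanishes_on_zero W (coeff (map_poly \<Phi> P) j)"
    using P(3) map_series_vanishes V.monic_map_poly(1)[OF P(2)] by simp
  ultimately show ?thesis
    unfolding weierstrass_form_def
    using map_poly_series_closed[OF V(1) P(1)] V.monic_map_poly(2)[OF P(2)] by blast
qed

text \<open>With \<open>a = p / q\<close>, injectivity gives \<open>h p \<noteq> 0\<close>, but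
  \<open>h p\<close> may be a nonunit; the required division is provided by \<open>y\<close>. This
  is the reason for admitting in \<open>L\<close> every fraction with a value, and not just those
  whose denominator is nonzero at the point.\<close>

lemma localization_quotient:
  assumes inj: "\<And>p. p \<in> tau_polys s \<Longrightarrow> p \<noteq> 0 \<Longrightarrow> h p \<noteq> 0"
    and a: "a \<in> L" "a \<noteq> 0" and x: "x \<in> tau_ratfuns s" "a * x \<in> L" and y: "y \<in> KS" "\<phi> (a * x) = \<phi> a * y"
  shows "x \<in> L \<and> \<phi> x = y"
proof -
  obtain p q where p: "p \<in> tau_polys s" "q \<in> tau_polys s" "h q \<noteq> 0" "q \<noteq> 0" "a = Fract p q" "h p = h q * \<phi> a" "\<phi> a \<in> KS"
    using a(1) by (rule localizationE)
  obtain p' q' where p': "p' \<in> tau_polys s" "q' \<in> tau_polys s" "h q' \<noteq> 0" "q' \<noteq> 0" "a * x = Fract p' q'" "h p' = h q' * \<phi> (a * x)" "\<phi> (a * x) \<in> KS"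
    using x(2) by (rule localizationE)
  have p0: "p \<noteq> 0" using a(2) p(4,5) by (auto simp: fract_collapse)
  have "x = inverse a * (a * x)" using a(2) by (simp flip: mult.assoc)
  also have "\<dots> = Fract (q * p') (p * q')" unfolding p'(5) unfolding p(5) by simp
  finally have xe: "x = Fract (q * p') (p * q')" .
  have "h (q * p') = h q * (h q' * (\<phi> a * y))" by (simp only: h_mult p'(6) y(2))
  also have "\<dots> = (h q * \<phi> a) * h q' * y" by (simp only: mult_ac)
  also have "\<dots> = h (p * q') * y" by (simp only: p(6)[symmetric] h_mult)
  finally have eq: "h (q * p') = h (p * q') * y" .
  have m: "q * p' \<in> tau_polys s" "p * q' \<in> tau_polys s" "h (p * q') \<noteq> 0"
    using p p' inj[OF p(1) p0] by (auto simp: h_mult intro!: tp.mult_closed)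
  show ?thesis unfolding xe using localizationI[OF m eq y(1)] fract_valueI[OF m eq] by blast
qed

lemma value_injective:
  assumes inj: "\<And>p. p \<in> tau_polys s \<Longrightarrow> p \<noteq> 0 \<Longrightarrow> h p \<noteq> 0" and a: "a \<in> L" "\<phi> a = 0"
  shows "a = 0"
proof -
  obtain p q where p: "p \<in> tau_polys s" "q \<noteq> 0" "a = Fract p q" "h p = h q * \<phi> a"
    using a(1) by (rule localizationE)
  have "p = 0" using inj[OF p(1)] p(4) a(2) by auto
  then show ?thesis using p by (simp add: fract_collapse)
qed

lemma map_series_injective:
  assumes inj: "\<And>p. p \<in> tau_polys s \<Longrightarrow> p \<noteq> 0 \<Longrightarrow> h p \<noteq> 0" and F: "F \<in> D" "\<Phi> F = 0"
  shows "F = 0"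
proof (rule mps_eqI)
  fix m
  show "mcoeff F m = mcoeff 0 m"
  proof (cases "keys m \<inter> range S = {}")
    case True
    have "\<phi> (mcoeff F m) = s_coeff (\<Phi> F) m" by (rule s_coeff_map_series[OF F(1) True, symmetric])
    also have "\<dots> = 0" unfolding F(2) by (rule mps_eqI) (simp add: mcoeff_s_coeff)
    finally show ?thesis using value_injective[OF inj series_overD(1)[OF F(1)]] by simp
  next
    case False
    then show ?thesis using series_overD(2)[OF F(1)] by (metis Compl_disjoint2 disjoint_eq_subset_Compl mcoeff_zero)
  qed
qed

text \<open>Compare coefficients of \<open>l * g\<close> at \<open>k + m\<close>, where
  \<open>k\<close> is the leading monomial of \<open>l\<close>: apart from the product of the
  coefficients of \<open>l\<close> at \<open>k\<close> and of \<open>g\<close> at \<open>m\<close>,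
  only coefficients of \<open>g\<close> below \<open>m\<close> occur. The same relation holds for
  \<open>g'\<close> after applying \<open>\<phi>\<close>, so the quotient needed in \<open>L\<close>
  has the value \<open>s_coeff g' m\<close>.\<close>

lemma series_quotient_descent:
  assumes inj: "\<And>p. p \<in> tau_polys s \<Longrightarrow> p \<noteq> 0 \<Longrightarrow> h p \<noteq> 0"
    and V: "finite V" "V \<inter> range S = {}"
    and l: "l \<in> series_over L V" "l \<noteq> 0" and g: "g \<in> series_over (tau_ratfuns s) V"
    and lg: "l * g \<in> series_over L V" and g': "g' \<in> series_over UNIV (V \<union> \<Sigma>)" "\<Phi> (l * g) = \<Phi> l * g'"
  shows "g \<in> series_over L V \<and> \<Phi> g = g'"
proof -
  obtain k where k: "leading_monomial V l k" using leading_monomial_exists[OF V(1) l] by blast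
  have kV: "keys k \<subseteq> V" and lk: "mcoeff l k \<noteq> 0" using k by (auto simp: leading_monomial_def)
  have lL: "mcoeff l a \<in> L" for a by (rule series_overD(1)[OF l(1)])
  have lD: "l \<in> D" "l * g \<in> D" using series_D[OF V(2)] l(1) lg by blast+
  have g'KS: "s_coeff g' m \<in> KS" if "keys m \<subseteq> V" for m
  proof (rule series_overI)
    fix \<beta> assume "mcoeff (s_coeff g' m) \<beta> \<noteq> 0"
    then have "keys \<beta> \<subseteq> range S" "mcoeff g' (m + \<beta>) \<noteq> 0" by (auto simp: mcoeff_s_coeff split: if_splits)
    then have "keys \<beta> \<subseteq> V \<union> \<Sigma>" using series_overD(2)[OF g'(1)] keys_subset_add_right[of \<beta> m] by blast
    then show "keys \<beta> \<subseteq> \<Sigma>" using \<open>keys \<beta> \<subseteq> range S\<close> V(2) by blast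
  qed simp
  have main: "keys m \<subseteq> V \<longrightarrow> mcoeff g m \<in> L \<and> \<phi> (mcoeff g m) = s_coeff g' m" for m
  proof (induction m rule: wf_induct_rule[OF wf_mlt[OF V(1)]])
    case (1 m)
    show ?case
    proof
      assume m: "keys m \<subseteq> V"
      let ?A = "splits (k + m) - {(k, m)}"
      have kmV: "keys (k + m) \<subseteq> V" using keys_add[of k m] kV m by blast
      have IH: "mcoeff l a = 0 \<or> mcoeff g b \<in> L \<and> \<phi> (mcoeff g b) = s_coeff g' b" if ab: "(a, b) \<in> ?A" for a b
      proof (cases "mcoeff l a = 0")
        case False
        have s: "a + b = k + m" "(a, b) \<noteq> (k, m)" using ab by auto
        have b: "keys b \<subseteq> V" using kmV keys_subset_add_right[of b a] s(1) by auto
        have ka: "k = a \<or> (k, a) \<in> mlt V" using k False by (auto simp: leading_monomial_def)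
        have "(b, m) \<in> mlt V"
        proof (rule ccontr)
          assume "(b, m) \<notin> mlt V"
          then have "m = b \<or> (m, b) \<in> mlt V" using mlt_total[OF b m] by blast
          moreover have "keys a \<subseteq> V" using kmV keys_subset_add_left[of a b] s(1) by auto
          ultimately have "(k + m, a + b) \<in> mlt V" using mlt_add_strict[OF ka, of m b] s(2) m by auto
          then show False using s(1) mlt_irrefl[of "k + m" V] by simp
        qed
        then show ?thesis using 1 b by blast
      qed simp
      have split: "(\<Sum>x\<in>splits (k + m). f x) = f (k, m) + (\<Sum>x\<in>?A. f x)" for f :: "_ \<Rightarrow> 'z::comm_ring_1"
        by (rule sum.remove) auto
      define E where "E = (\<Sum>x\<in>?A. case x of (a, b) \<Rightarrow> mcoeff l a * mcoeff g b)"
      have t: "(case x of (a, b) \<Rightarrow> mcoeff l a * mcoeff g b) \<in> L \<and>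
          \<phi> (case x of (a, b) \<Rightarrow> mcoeff l a * mcoeff g b) = (case x of (a, b) \<Rightarrow> \<phi> (mcoeff l a) * s_coeff g' b)"
        if "x \<in> ?A" for x
      proof -
        obtain a b where x: "x = (a, b)" by (cases x)
        show ?thesis using IH[of a b] that lL[of a] by (auto simp: x localization_0 val.hom_mult val.mult_closed)
      qed
      have E: "E \<in> L" "\<phi> E = (\<Sum>x\<in>?A. case x of (a, b) \<Rightarrow> \<phi> (mcoeff l a) * s_coeff g' b)"
      proof -
        show "E \<in> L" unfolding E_def by (rule val.sum_closed) (rule conjunct1[OF t])
        have "\<phi> E = (\<Sum>x\<in>?A. \<phi> (case x of (a, b) \<Rightarrow> mcoeff l a * mcoeff g b))"
          unfolding E_def by (rule val.hom_sum) (rule conjunct1[OF t])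
        also have "\<dots> = (\<Sum>x\<in>?A. case x of (a, b) \<Rightarrow> \<phi> (mcoeff l a) * s_coeff g' b)"
          by (rule sum.cong[OF refl]) (rule conjunct2[OF t])
        finally show "\<phi> E = (\<Sum>x\<in>?A. case x of (a, b) \<Rightarrow> \<phi> (mcoeff l a) * s_coeff g' b)" .
      qed
      have lgm: "mcoeff (l * g) (k + m) = mcoeff l k * mcoeff g m + E"
        unfolding mcoeff_mult E_def by (subst split) simp
      then have ag: "mcoeff l k * mcoeff g m = mcoeff (l * g) (k + m) - E" by simp
      have lgL: "mcoeff (l * g) (k + m) \<in> L" by (rule series_overD(1)[OF lg])
      have km: "keys (k + m) \<inter> range S = {}" using kmV V(2) by blast
      have "\<phi> (mcoeff (l * g) (k + m)) = s_coeff (\<Phi> l * g') (k + m)"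
        unfolding g'(2)[symmetric] by (rule s_coeff_map_series[OF lD(2) km, symmetric])
      also have "\<dots> = (\<Sum>x\<in>splits (k + m). case x of (a, b) \<Rightarrow> \<phi> (mcoeff l a) * s_coeff g' b)"
        unfolding s_coeff_mult[OF km]
      proof (rule sum.cong[OF refl])
        fix x assume x: "x \<in> splits (k + m)"
        obtain a b where ab: "x = (a, b)" by (cases x)
        have "keys a \<inter> range S = {}" using x ab km keys_subset_add_left[of a b] by auto
        then show "(case x of (a, b) \<Rightarrow> s_coeff (\<Phi> l) a * s_coeff g' b) = (case x of (a, b) \<Rightarrow> \<phi> (mcoeff l a) * s_coeff g' b)"
          by (simp add: ab s_coeff_map_series[OF lD(1)])
      qed
      also have "\<dots> = \<phi> (mcoeff l k) * s_coeff g' m + \<phi> E"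
        by (subst split) (simp add: E(2))
      finally have "\<phi> (mcoeff l k * mcoeff g m) = \<phi> (mcoeff l k) * s_coeff g' m"
        unfolding ag using lgL E(1) by (simp add: val.hom_diff)
      moreover have "mcoeff l k * mcoeff g m \<in> L" unfolding ag by (intro val.diff_closed lgL E(1))
      ultimately show "mcoeff g m \<in> L \<and> \<phi> (mcoeff g m) = s_coeff g' m"
        using localization_quotient[OF inj lL lk series_overD(1)[OF g]] g'KS[OF m] by blast
    qed
  qed
  have gL: "g \<in> series_over L V"
  proof (rule series_overI)
    fix m
    show "mcoeff g m \<in> L" using main[of m] series_overD(2)[OF g, of m] localization_0(1) by metis
  qed (rule series_overD(2)[OF g])
  moreover have "\<Phi> g = g'"
  proof (rule s_coeff_eqI)
    fix \<alpha> :: "var \<Rightarrow>\<^sub>0 nat" assume \<alpha>: "keys \<alpha> \<inter> range S = {}"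
    have eq: "s_coeff (\<Phi> g) \<alpha> = \<phi> (mcoeff g \<alpha>)" by (rule s_coeff_map_series[OF series_D[OF V(2) gL] \<alpha>])
    show "s_coeff (\<Phi> g) \<alpha> = s_coeff g' \<alpha>"
    proof (cases "keys \<alpha> \<subseteq> V")
      case True
      then show ?thesis using main[of \<alpha>] eq by simp
    next
      case False
      have "mcoeff g \<alpha> = 0" using series_overD(2)[OF g] False by blast
      moreover have "mcoeff (s_coeff g' \<alpha>) \<beta> = 0" for \<beta>
      proof (rule ccontr)
        assume "mcoeff (s_coeff g' \<alpha>) \<beta> \<noteq> 0"
        then have "keys (\<alpha> + \<beta>) \<subseteq> V \<union> \<Sigma>" using series_overD(2)[OF g'(1)] by (auto simp: mcoeff_s_coeff split: if_splits)
        then show False using False \<alpha> Sig keys_subset_add_left[of \<alpha> \<beta>] by blast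
      qed
      then have "s_coeff g' \<alpha> = 0" by (intro mps_eqI) simp
      ultimately show ?thesis using eq localization_0 by simp
    qed
  qed
  ultimately show ?thesis by blast
qed

end

section \<open>Inverting finitely many elements\<close>

definition localized :: "nat \<Rightarrow> 'k::idom taupoly \<Rightarrow> 'k taupoly fract set" where
  "localized s c = {Fract p (c ^ n) | p n. p \<in> tau_polys s}"

lemma localizedI: "p \<in> tau_polys s \<Longrightarrow> Fract p (c ^ n) \<in> localized s c"
  by (auto simp: localized_def)

lemma localized_subset_ratfuns:
  assumes "c \<in> tau_polys s" "c \<noteq> (0 :: 'k::idom taupoly)"
  shows "localized s c \<subseteq> tau_ratfuns s"
proof -
  interpret tp: unital_subring "tau_polys s :: 'k taupoly set" by (rule unital_subring_tau_polys)
  have "c ^ n \<in> tau_polys s" "c ^ n \<noteq> 0" for n using assms by auto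
  then show ?thesis unfolding localized_def tau_ratfuns_def by blast
qed

lemma unital_subring_localized:
  assumes "c \<in> tau_polys s" "c \<noteq> (0 :: 'k::idom taupoly)"
  shows "unital_subring (localized s c)"
proof -
  interpret tp: unital_subring "tau_polys s :: 'k taupoly set" by (rule unital_subring_tau_polys)
  have c: "c ^ n \<in> tau_polys s" "c ^ n \<noteq> 0" for n using assms by auto
  show ?thesis
  proof
    show "0 \<in> localized s c" unfolding Zero_fract_def using localizedI[of 0 s c 0] by simp
    show "1 \<in> localized s c" unfolding One_fract_def using localizedI[of 1 s c 0] by simp
    fix a b :: "'k taupoly fract" assume "a \<in> localized s c" "b \<in> localized s c"
    then obtain p n q m where p: "p \<in> tau_polys s" "a = Fract p (c ^ n)" and q: "q \<in> tau_polys s" "b = Fract q (c ^ m)"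
      unfolding localized_def by blast
    show "a + b \<in> localized s c"
      unfolding p(2) q(2) add_fract[OF c(2) c(2)] power_add[symmetric]
      using p q c by (intro localizedI tp.add_closed tp.mult_closed)
    show "- a \<in> localized s c" unfolding p(2) minus_fract using p by (intro localizedI tp.uminus_closed)
    show "a * b \<in> localized s c"
      unfolding p(2) q(2) mult_fract power_add[symmetric] using p q by (intro localizedI tp.mult_closed)
  qed
qed

lemma localized_mono:
  assumes "c \<noteq> (0 :: 'k::idom taupoly)" "d \<in> tau_polys s" "d \<noteq> 0"
  shows "localized s c \<subseteq> localized s (c * d)"
proof
  interpret tp: unital_subring "tau_polys s :: 'k taupoly set" by (rule unital_subring_tau_polys)
  fix a assume "a \<in> localized s c"
  then obtain p n where p: "p \<in> tau_polys s" "a = Fract p (c ^ n)" unfolding localized_def by blast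
  have "a = Fract (p * d ^ n) ((c * d) ^ n)"
    using assms by (simp add: p(2) eq_fract power_mult_distrib mult_ac)
  then show "a \<in> localized s (c * d)"
    using localizedI[of "p * d ^ n" s "c * d" n] p(1) assms(2) by auto
qed

context specialization
begin

lemma localized_value:
  assumes "c \<in> tau_polys s" "peval \<tau> c \<noteq> 0" "p \<in> tau_polys s"
  shows "Fract p (c ^ n) \<in> L" "h p = h c ^ n * \<phi> (Fract p (c ^ n))"
    "mcoeff (\<phi> (Fract p (c ^ n))) 0 = peval \<tau> p / peval \<tau> c ^ n"
proof -
  interpret tp: unital_subring "tau_polys s :: 'k taupoly set" by (rule unital_subring_tau_polys)
  interpret KS: unital_subring KS by (rule unital_subring_series_over[OF unital_subring_UNIV])
  have "series_unit UNIV \<Sigma> (h c)"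
    unfolding series_unit_def using h_closed[OF assms(1)] assms(2)
    by (auto simp: h_0 intro!: exI[of _ "inverse (peval \<tau> c)"])
  then obtain w where w: "series_unit UNIV \<Sigma> w" "h c * w = 1"
    using series_unit_inverse[OF unital_subring_UNIV] by blast
  have wK: "w \<in> KS" using w(1) by (simp add: series_unit_def)
  have hc: "h (c ^ n) \<noteq> 0" using w(2) by (auto simp: h_power)
  have eq: "h p = h (c ^ n) * (w ^ n * h p)"
    using w(2) by (simp add: h_power flip: mult.assoc power_mult_distrib)
  have cn: "c ^ n \<in> tau_polys s" using assms(1) by auto
  show "Fract p (c ^ n) \<in> L"
    by (rule localizationI[OF assms(3) cn hc eq]) (use wK h_closed[OF assms(3)] in auto)
  have v: "\<phi> (Fract p (c ^ n)) = w ^ n * h p" by (rule fract_valueI[OF assms(3) cn hc eq])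
  then show e: "h p = h c ^ n * \<phi> (Fract p (c ^ n))" using eq by (simp add: h_power)
  have "mcoeff (f ^ n) 0 = mcoeff f 0 ^ n" for f :: "(var, 'k) mps"
    by (induction n) (simp_all add: mcoeff_mult_0 mcoeff_one)
  then have "peval \<tau> p = peval \<tau> c ^ n * mcoeff (\<phi> (Fract p (c ^ n))) 0"
    using arg_cong[OF e, of "\<lambda>f. mcoeff f 0"] by (simp add: mcoeff_mult_0 h_0)
  then show "mcoeff (\<phi> (Fract p (c ^ n))) 0 = peval \<tau> p / peval \<tau> c ^ n" using assms(2) by simp
qed

lemma localized_subset:
  assumes "c \<in> tau_polys s" "peval \<tau> c \<noteq> 0"
  shows "localized s c \<subseteq> L"
  using localized_value(1)[OF assms] by (auto simp: localized_def)

end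

text \<open>\<open>d\<close> is the numerator of \<open>a\<close>. The last conclusion covers all
  specializations at once, so \<open>d\<close> is chosen before any point.\<close>

lemma localized_unit:
  fixes a :: "'k::field_char_0 taupoly fract"
  assumes "a \<in> localized s c" "a \<noteq> 0" "c \<in> tau_polys s" "c \<noteq> 0"
  obtains d b where "d \<in> tau_polys s" "d \<noteq> 0" "b \<in> localized s (c * d)" "a * b = 1"
    "\<And>\<Sigma> \<tau> h. specialization s \<Sigma> \<tau> h \<Longrightarrow> peval \<tau> (c * d) \<noteq> 0 \<Longrightarrow> mcoeff (fract_value s h a) 0 \<noteq> 0"
proof -
  interpret tp: unital_subring "tau_polys s :: 'k taupoly set" by (rule unital_subring_tau_polys)
  obtain p n where p: "p \<in> tau_polys s" "a = Fract p (c ^ n)" using assms(1) unfolding localized_def by blast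
  have p0: "p \<noteq> 0" using assms(2) p(2) by (auto simp: fract_collapse)
  \<comment> \<open>The inverse of \<open>p / c ^ n\<close>, extended by \<open>c\<close> so that
    its denominator is a power of \<open>c * p\<close>.\<close>
  have "Fract (c ^ Suc n) ((c * p) ^ 1) \<in> localized s (c * p)"
    using assms(3) by (intro localizedI tp.power_closed)
  moreover have "a * Fract (c ^ Suc n) ((c * p) ^ 1) = 1"
    using p0 assms(4) by (simp add: p(2) One_fract_def eq_fract mult_ac)
  moreover have "mcoeff (fract_value s h a) 0 \<noteq> 0"
    if "specialization s \<Sigma> \<tau> h" "peval \<tau> (c * p) \<noteq> 0" for \<Sigma> \<tau> h
  proof -
    interpret specialization s \<Sigma> \<tau> h by fact
    have "peval \<tau> c \<noteq> 0" "peval \<tau> p \<noteq> 0" using that(2) by (auto simp: peval_simps)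
    then show ?thesis using localized_value(3)[OF assms(3) _ p(1)] by (simp add: p(2))
  qed
  ultimately show ?thesis using that[of p] p(1) p0 by blast
qed

lemma weierstrass_form_mono:
  assumes "weierstrass_form A W V v F P" "A \<subseteq> B"
  shows "weierstrass_form B W V v F P"
  using assms series_unit_mono[OF _ assms(2) order_refl] poly_over_mono[OF series_over_mono[OF assms(2) order_refl]]
  unfolding weierstrass_form_def by blast

text \<open>\<open>d\<close> is the product of three numerators: of the coefficient of
  \<open>F\<close> that Weierstrass preparation inverts; of the leading coefficient of a series
  \<open>l\<close> clearing the denominators of \<open>G\<close>; and of one nonzero coefficient of
  the discriminant, which keeps the discriminant nonzero after specialization.\<close>

lemma generic_localization:
  fixes F :: "(var, 'k::field_char_0 taupoly fract) mps"
  assumes c: "c \<in> tau_polys s" "c \<noteq> 0" and V: "finite V" "finite W" "W \<subseteq> V" "v \<notin> V" "V \<inter> range S = {}"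
    and F: "F \<in> series_over (localized s c) (insert v V)" "weierstrass_form (tau_ratfuns s) W V v F P"
    and G: "G \<in> poly_over (series_over (tau_ratfuns s) V)" "monic_radical P G"
  obtains d where "d \<in> tau_polys s" "d \<noteq> 0" "weierstrass_form (localized s (c * d)) W V v F P"
    "G \<in> poly_over (series_over (localized s (c * d)) V)"
    "\<And>\<Sigma> \<tau> h. specialization s \<Sigma> \<tau> h \<Longrightarrow> peval \<tau> (c * d) \<noteq> 0 \<Longrightarrow> map_series s h (discriminant G) \<noteq> 0"
proof -
  interpret tp: unital_subring "tau_polys s :: 'k taupoly set" by (rule unital_subring_tau_polys)
  have K: "unital_subring (tau_ratfuns s :: 'k taupoly fract set)" by (rule subfield_setD(1)[OF subfield_tau_ratfuns])
  interpret wK: weierstrass "tau_ratfuns s :: 'k taupoly fract set" W V v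
    using K V by (simp add: weierstrass_def weierstrass_axioms_def)
  have reg: "regular_at (tau_ratfuns s) W v (degree P) F" by (rule wK.regular_if_weierstrass_form[OF F(2)])
  let ?a = "mcoeff F (Poly_Mapping.single v (degree P))"
  have a0: "?a \<noteq> 0" using reg by (auto simp: regular_at_def)
  obtain d1 b1 where d1: "d1 \<in> tau_polys s" "d1 \<noteq> 0" "b1 \<in> localized s (c * d1)" "?a * b1 = 1"
    by (rule localized_unit[OF series_overD(1)[OF F(1)] a0 c]) (rule that; assumption)
  define c1 where "c1 = c * d1"
  have c1: "c1 \<in> tau_polys s" "c1 \<noteq> 0" using c d1 by (auto simp: c1_def)
  interpret w1: weierstrass "localized s c1" W V v
    using unital_subring_localized[OF c1] V by (simp add: weierstrass_def weierstrass_axioms_def)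
  have F1: "F \<in> series_over (localized s c1) (insert v V)"
    using F(1) series_over_mono[OF localized_mono[OF c(2) d1(1,2)] order_refl] unfolding c1_def by blast
  have "regular_at (localized s c1) W v (degree P) F"
    using reg d1(3,4) unfolding regular_at_def c1_def by blast
  then obtain P' where P': "weierstrass_form (localized s c1) W V v F P'" using w1.weierstrass_exists[OF F1] by blast
  \<comment> \<open>Both are Weierstrass polynomials of \<open>F\<close> over
    \<open>k(\<tau>)\<close>. So \<open>P\<close> has its coefficients in the localization.\<close>
  have "P' = P"
    by (rule wK.weierstrass_form_unique[OF weierstrass_form_mono[OF P' localized_subset_ratfuns[OF c1]] F(2)])
  then have P1: "weierstrass_form (localized s c1) W V v F P" using P' by simp
  then have P: "P \<in> poly_over (series_over (localized s c1) V)" "lead_coeff P = 1" by (auto simp: weierstrass_form_def)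
  have G1: "lead_coeff G = 1" using G(2) by (simp add: monic_radical_def)
  have idh: "partial_hom (series_over (localized s c1) V) (\<lambda>f. f)"
    using w1.subring_SV by (simp add: partial_hom_def partial_hom_axioms_def)
  have mid: "map_poly (\<lambda>f. f) p = p" for p :: "(var, 'k taupoly fract) mps poly" by (rule poly_eqI) (simp add: coeff_map_poly)
  \<comment> \<open>For the identity homomorphism both radicals of the denominator lemma are
    \<open>G\<close>.\<close>
  obtain l where l: "l \<in> series_over (localized s c1) V" "l \<noteq> 0" "smult l G \<in> poly_over (series_over (localized s c1) V)"
    using monic_radical_denominator[OF idh _ P G(2), of G] G(2) by (auto simp: mid)
  obtain k where k: "leading_monomial V l k" using leading_monomial_exists[OF V(1) l(1,2)] by blast
  then have lk0: "mcoeff l k \<noteq> 0" by (simp add: leading_monomial_def)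
  obtain d2 b2 where d2: "d2 \<in> tau_polys s" "d2 \<noteq> 0" "b2 \<in> localized s (c1 * d2)" "mcoeff l k * b2 = 1"
    by (rule localized_unit[OF series_overD(1)[OF l(1)] lk0 c1, folded c1_def]) (rule that; assumption)
  define c2 where "c2 = c1 * d2"
  have c2: "c2 \<in> tau_polys s" "c2 \<noteq> 0" using c1 d2 by (auto simp: c2_def)
  have sub12: "series_over (localized s c1) V \<subseteq> series_over (localized s c2) V"
    using series_over_mono[OF localized_mono[OF c1(2) d2(1,2)] order_refl] by (simp add: c2_def)
  have L2: "unital_subring (localized s c2)" by (rule unital_subring_localized[OF c2])
  have "coeff G i \<in> series_over (localized s c2) V" for i
  proof (rule exact_quotient_closed[OF V(1) L2 k])
    show "l \<in> series_over (localized s c2) V" using l(1) sub12 by blast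
    show "b2 \<in> localized s c2" using d2(3) by (simp add: c2_def)
    show "mcoeff l k * b2 = 1" by fact
    show "coeff G i \<in> series_over (tau_ratfuns s) V"
      using G(1) unital_subring.coeff_closed[OF wK.subring_SV] by blast
    have "coeff (smult l G) i \<in> series_over (localized s c1) V"
      using l(3) unital_subring.coeff_closed[OF w1.subring_SV] by blast
    then show "l * coeff G i \<in> series_over (localized s c2) V" using sub12 by auto
  qed
  then have G2: "G \<in> poly_over (series_over (localized s c2) V)"
    using unital_subring.poly_over_iff[OF unital_subring_series_over[OF L2]] by blast
  have disc: "discriminant G \<in> series_over (localized s c2) V"
    by (rule discriminant_in[OF unital_subring_series_over[OF L2] G2])
  have "discriminant G \<noteq> 0" using G(2) by (simp add: monic_radical_def)
  then obtain \<alpha> where \<alpha>: "mcoeff (discriminant G) \<alpha> \<noteq> 0" by (metis mcoeff_zero mps_eqI)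
  obtain d3 where d3: "d3 \<in> tau_polys s" "d3 \<noteq> 0"
    "\<And>\<Sigma> \<tau> h. specialization s \<Sigma> \<tau> h \<Longrightarrow> peval \<tau> (c2 * d3) \<noteq> 0 \<Longrightarrow> mcoeff (fract_value s h (mcoeff (discriminant G) \<alpha>)) 0 \<noteq> 0"
    by (rule localized_unit[OF series_overD(1)[OF disc] \<alpha> c2]) (rule that; assumption)
  have sub3: "localized s c1 \<subseteq> localized s (c2 * d3)" "localized s c2 \<subseteq> localized s (c2 * d3)"
    using localized_mono[OF c1(2) d2(1,2)] localized_mono[OF c2(2) d3(1,2)] unfolding c2_def by blast+
  have cd: "c2 * d3 = c * (d1 * d2 * d3)" by (simp add: c2_def c1_def mult_ac)
  show ?thesis
  proof (rule that[of "d1 * d2 * d3", folded cd])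
    show "d1 * d2 * d3 \<in> tau_polys s" "d1 * d2 * d3 \<noteq> 0" using d1 d2 d3 by auto
    show "weierstrass_form (localized s (c2 * d3)) W V v F P" by (rule weierstrass_form_mono[OF P1 sub3(1)])
    show "G \<in> poly_over (series_over (localized s (c2 * d3)) V)"
      using G2 poly_over_mono[OF series_over_mono[OF sub3(2) order_refl]] by blast
    fix \<Sigma> \<tau> h assume h: "specialization s \<Sigma> \<tau> h" "peval \<tau> (c2 * d3) \<noteq> 0"
    have "keys \<alpha> \<inter> range S = {}" using series_overD(2)[OF disc \<alpha>] V(5) by blast
    then have "mcoeff (map_series s h (discriminant G)) \<alpha> = mcoeff (fract_value s h (mcoeff (discriminant G) \<alpha>)) 0"
      by (subst specialization.mcoeff_map_series[OF h(1)])
        (simp add: part_zero part_id disjoint_eq_subset_Compl)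
    then show "map_series s h (discriminant G) \<noteq> 0" using d3(3)[OF h] by auto
  qed
qed

section \<open>The three conditions\<close>

text \<open>The variables \<open>S i\<close> are reserved for the expansion and join the parameters
  only as \<open>\<Sigma>\<close>.\<close>

definition admissible :: "var set \<Rightarrow> bool" where
  "admissible Ps \<longleftrightarrow> parameters Ps \<and> Ps \<inter> range S = {}"

lemma admissibleD:
  assumes "admissible Ps"
  shows "parameters Ps" "finite (xvars n \<union> Ps)" "(xvars n \<union> Ps) \<inter> range S = {}" "X (Suc n) \<notin> xvars n \<union> Ps"
  using assms by (auto simp: admissible_def parameters_def xvars_def)

context specialization
begin

lemma chain_step:
  assumes Ps: "admissible Ps" and F: "weierstrass_form L (xvars n) (xvars n \<union> Ps) (X (Suc n)) F P"
    and G: "G \<in> poly_over (series_over L (xvars n \<union> Ps))" "monic_radical P G" "\<Phi> (discriminant G) \<noteq> 0"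
  shows "weierstrass_form UNIV (xvars n) (xvars n \<union> (Ps \<union> \<Sigma>)) (X (Suc n)) (\<Phi> F) (map_poly \<Phi> P)"
    "map_poly \<Phi> G \<in> poly_over (series_over UNIV (xvars n \<union> (Ps \<union> \<Sigma>)))"
    "monic_radical (map_poly \<Phi> P) (map_poly \<Phi> G)"
    "discriminant (map_poly \<Phi> G) = \<Phi> (discriminant G)"
proof -
  note V = admissibleD(3)[OF Ps, of n]
  have P: "P \<in> poly_over (series_over L (xvars n \<union> Ps))" "lead_coeff P = 1" using F by (auto simp: weierstrass_form_def)
  have G1: "lead_coeff G = 1" using G(2) by (simp add: monic_radical_def)
  show "weierstrass_form UNIV (xvars n) (xvars n \<union> (Ps \<union> \<Sigma>)) (X (Suc n)) (\<Phi> F) (map_poly \<Phi> P)"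
    using map_weierstrass_form[OF V _ F] by (auto simp: Un_assoc)
  show "map_poly \<Phi> G \<in> poly_over (series_over UNIV (xvars n \<union> (Ps \<union> \<Sigma>)))"
    using map_poly_series_closed[OF V G(1)] by (simp add: Un_assoc)
  show "monic_radical (map_poly \<Phi> P) (map_poly \<Phi> G)"
    by (rule monic_radical_hom[OF partial_hom_series[OF V] P(1) G(1) P(2) G(2,3)])
  show "discriminant (map_poly \<Phi> G) = \<Phi> (discriminant G)"
    by (rule discriminant_hom[OF partial_hom_series[OF V] G(1) G1])
qed

lemma mcoeff_map_series_0: "keys m \<inter> range S = {} \<Longrightarrow> mcoeff (\<Phi> F) m = mcoeff (\<phi> (mcoeff F m)) 0"
  by (simp add: mcoeff_map_series part_zero part_id disjoint_eq_subset_Compl)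

text \<open>If the value of \<open>p / q\<close> is a unit, its inverse is a value of
  \<open>q / p\<close>.\<close>

lemma value_unit:
  assumes "a \<in> L" "mcoeff (\<phi> a) 0 \<noteq> 0"
  shows "\<exists>b\<in>L. a * b = 1"
proof -
  have "series_unit UNIV \<Sigma> (\<phi> a)"
    unfolding series_unit_def using value_closed[OF assms(1)] assms(2)
    by (auto intro!: exI[of _ "inverse (mcoeff (\<phi> a) 0)"])
  then obtain w where w: "series_unit UNIV \<Sigma> w" "\<phi> a * w = 1"
    using series_unit_inverse[OF unital_subring_UNIV] by blast
  obtain p q where p: "p \<in> tau_polys s" "q \<in> tau_polys s" "h q \<noteq> 0" "q \<noteq> 0" "a = Fract p q" "h p = h q * \<phi> a" "\<phi> a \<in> KS"
    using assms(1) by (rule localizationE)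
  have hp: "h p \<noteq> 0" using p(3,6) assms(2) by auto
  then have p0: "p \<noteq> 0" using h_zero by auto
  have "h p * w = h q * (\<phi> a * w)" unfolding p(6) by (simp only: mult.assoc)
  then have eq: "h q = h p * w" using w(2) by simp
  have "w \<in> KS" using w(1) by (simp add: series_unit_def)
  then have "Fract q p \<in> L" by (rule localizationI[OF p(2,1) hp eq])
  moreover have "a * Fract q p = 1" using p0 p(4) by (simp add: p(5) One_fract_def eq_fract mult_ac)
  ultimately show ?thesis by blast
qed

text \<open>The chain of the expansion is pulled back stage by stage, keeping the series over
  \<open>L\<close>. Regularity descends because \<open>\<phi>\<close> is injective and units of
  values come from units of \<open>L\<close>, so there is a Weierstrass polynomial \<open>P\<close>
  over \<open>L\<close> with image \<open>P'\<close>. Its radical \<open>G\<close> exists over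
  \<open>k(\<tau>)\<close>; a multiple \<open>l * G\<close> over \<open>L\<close> has the image of
  \<open>l\<close> times \<open>G'\<close> as its image, and descent of quotients brings
  \<open>G\<close> into \<open>L\<close> with image \<open>G'\<close>.\<close>

lemma chain_descent:
  assumes inj: "\<And>p. p \<in> tau_polys s \<Longrightarrow> p \<noteq> 0 \<Longrightarrow> h p \<noteq> 0" and fin: "finite \<Sigma>" and Ps: "admissible Ps"
  shows "F \<in> series_over L (xvars n \<union> Ps) \<Longrightarrow> discriminant_chain UNIV (Ps \<union> \<Sigma>) n (\<Phi> F) \<Longrightarrow>
    discriminant_chain (tau_ratfuns s) Ps n F"
proof (induction n arbitrary: F)
  case 0
  have "mcoeff (\<Phi> F) 0 \<noteq> 0" using 0(2) by (auto simp: series_unit_def)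
  then have "mcoeff F 0 \<noteq> 0" by (auto simp: mcoeff_map_series_0 localization_0)
  moreover have "F \<in> series_over (tau_ratfuns s) Ps"
    using 0(1) series_over_mono[of L "tau_ratfuns s" Ps Ps] localization_ratfun by auto
  ultimately show ?case by (simp add: series_unit_subfield[OF subfield_tau_ratfuns])
next
  case (Suc n)
  let ?W = "xvars n" and ?V = "xvars n \<union> Ps" and ?v = "X (Suc n)" and ?V' = "xvars n \<union> (Ps \<union> \<Sigma>)"
  note VS = admissibleD(3)[OF Ps, of n]
  have Ps': "parameters (Ps \<union> \<Sigma>)" using admissibleD(1)[OF Ps] fin Sig by (auto simp: parameters_def)
  interpret wU: weierstrass "UNIV :: 'k set" ?W ?V' ?v by (rule weierstrass_xvars[OF unital_subring_UNIV Ps'])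
  interpret wL: weierstrass L ?W ?V ?v by (rule weierstrass_xvars[OF subring_L admissibleD(1)[OF Ps]])
  have ins: "insert ?v ?V = xvars (Suc n) \<union> Ps" by (simp add: xvars_Suc)
  have FL: "F \<in> series_over L (insert ?v ?V)" using Suc.prems(1) by (simp add: ins)
  have FD: "F \<in> D" using series_D[OF _ FL] VS by auto
  obtain P' G' where P': "weierstrass_form UNIV ?W ?V' ?v (\<Phi> F) P'"
    and G': "G' \<in> poly_over (series_over UNIV ?V')" "monic_radical P' G'" "discriminant_chain UNIV (Ps \<union> \<Sigma>) n (discriminant G')"
    using Suc.prems(2) by auto
  note reg = wU.regular_if_weierstrass_form[OF P', unfolded regular_at_def]
  have "regular_at L ?W ?v (degree P') F"
    unfolding regular_at_def
  proof (intro conjI allI impI)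
    fix m assume m: "keys m \<inter> ?W = {} \<and> lookup m ?v < degree P'"
    show "mcoeff F m = 0"
    proof (cases "keys m \<inter> range S = {}")
      case True
      \<comment> \<open>A factor in the variables \<open>S i\<close> affects neither the exponents
        on \<open>?W\<close> nor that of \<open>?v\<close>, so the vanishing reaches all
        coefficients above \<open>m\<close>.\<close>
      have "s_coeff (\<Phi> F) m = 0"
      proof (rule mps_eqI)
        fix \<beta>
        have "mcoeff (\<Phi> F) (m + \<beta>) = 0" if \<beta>: "keys \<beta> \<subseteq> range S"
        proof -
          have "keys (m + \<beta>) \<inter> ?W = {}" using m \<beta> keys_add[of m \<beta>] VS by blast
          moreover have "?v \<notin> keys \<beta>" using \<beta> by auto
          then have "lookup (m + \<beta>) ?v < degree P'" using m by (simp add: lookup_add in_keys_iff)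
          ultimately show ?thesis using reg by blast
        qed
        then show "mcoeff (s_coeff (\<Phi> F) m) \<beta> = mcoeff 0 \<beta>" by (simp add: mcoeff_s_coeff)
      qed
      then have "\<phi> (mcoeff F m) = 0" using s_coeff_map_series[OF FD True] by simp
      from value_injective[OF inj series_overD(1)[OF FD] this] show ?thesis .
    next
      case False
      then show ?thesis using series_overD(2)[OF FD, of m] by blast
    qed
  next
    let ?m = "Poly_Mapping.single ?v (degree P')"
    have "mcoeff (\<Phi> F) ?m \<noteq> 0" using reg by auto
    moreover have "keys ?m \<inter> range S = {}" by auto
    ultimately show "\<exists>a\<in>L. mcoeff F ?m * a = 1"
      using value_unit[OF series_overD(1)[OF FD]] by (simp add: mcoeff_map_series_0)
  qed
  then obtain P where P: "weierstrass_form L ?W ?V ?v F P" using wL.weierstrass_exists[OF FL] by blast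
  have "weierstrass_form UNIV ?W ?V' ?v (\<Phi> F) (map_poly \<Phi> P)"
    using map_weierstrass_form[OF VS _ P] by (auto simp: Un_assoc)
  then have PP': "map_poly \<Phi> P = P'" by (rule wU.weierstrass_form_unique[OF _ P'])
  have Lsub: "L \<subseteq> tau_ratfuns s" using localization_ratfun by blast
  have PK: "weierstrass_form (tau_ratfuns s) ?W ?V ?v F P" by (rule weierstrass_form_mono[OF P Lsub])
  have PR: "P \<in> poly_over (series_over L ?V)" "lead_coeff P = 1" using P by (auto simp: weierstrass_form_def)
  obtain G where G: "G \<in> poly_over (series_over (tau_ratfuns s) ?V)" "monic_radical P G"
    using radical_over_series[OF subfield_tau_ratfuns admissibleD(2)[OF Ps]] PK unfolding weierstrass_form_def by metis
  have injS: "F = 0" if "F \<in> series_over L ?V" "\<Phi> F = 0" for F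
    using map_series_injective[OF inj series_D[OF VS that(1)] that(2)] by blast
  obtain l where l: "l \<in> series_over L ?V" "l \<noteq> 0" "smult l G \<in> poly_over (series_over L ?V)"
    "map_poly \<Phi> (smult l G) = smult (\<Phi> l) G'"
    using monic_radical_denominator[OF partial_hom_series[OF VS] injS PR G(2), of G'] G'(2) PP' by blast
  interpret RU: unital_subring "series_over UNIV ?V' :: (var, 'k) mps set" by (rule wU.subring_SV)
  interpret RK: unital_subring "series_over (tau_ratfuns s) ?V :: (var, 'k taupoly fract) mps set"
    by (rule unital_subring_series_over[OF subfield_setD(1)[OF subfield_tau_ratfuns]])
  interpret RL: partial_hom "series_over L ?V" \<Phi> by (rule partial_hom_series[OF VS])
  have co: "coeff G i \<in> series_over L ?V \<and> \<Phi> (coeff G i) = coeff G' i" for i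
  proof (rule series_quotient_descent[OF inj admissibleD(2)[OF Ps] VS l(1,2)])
    show "coeff G i \<in> series_over (tau_ratfuns s) ?V" using G(1) by blast
    show "l * coeff G i \<in> series_over L ?V" using RL.coeff_closed[OF l(3), of i] by simp
    show "coeff G' i \<in> series_over UNIV (?V \<union> \<Sigma>)" using RU.coeff_closed[OF G'(1)] by (simp add: Un_assoc)
    show "\<Phi> (l * coeff G i) = \<Phi> l * coeff G' i"
      using arg_cong[OF l(4), of "\<lambda>p. coeff p i"] by simp
  qed
  then have GL: "G \<in> poly_over (series_over L ?V)" by (simp add: RL.poly_over_iff)
  have GG': "map_poly \<Phi> G = G'" by (rule poly_eqI) (simp add: co)
  have G1: "lead_coeff G = 1" using G(2) by (simp add: monic_radical_def)
  have "discriminant G' = \<Phi> (discriminant G)"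
    using discriminant_hom[OF partial_hom_series[OF VS] GL G1] GG' by simp
  then have "discriminant_chain (tau_ratfuns s) Ps n (discriminant G)"
    using Suc.IH[OF discriminant_in[OF wL.subring_SV GL]] G'(3) by simp
  then show ?case using PK G by auto
qed

end

text \<open>Every stage enlarges the denominator by finitely many factors, collected in
  \<open>d\<close>. Because \<open>d\<close> is chosen before the homomorphism, it serves
  specialization and expansion alike.\<close>

lemma chain_localize:
  fixes F :: "(var, 'k::field_char_0 taupoly fract) mps"
  assumes Ps: "admissible Ps"
  shows "discriminant_chain (tau_ratfuns s) Ps n F \<Longrightarrow> c \<in> tau_polys s \<Longrightarrow> c \<noteq> 0 \<Longrightarrow>
    F \<in> series_over (localized s c) (xvars n \<union> Ps) \<Longrightarrow>
    \<exists>d\<in>tau_polys s. d \<noteq> 0 \<and> (\<forall>\<Sigma> \<tau> h. specialization s \<Sigma> \<tau> h \<longrightarrow> peval \<tau> (c * d) \<noteq> 0 \<longrightarrow>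
      discriminant_chain UNIV (Ps \<union> \<Sigma>) n (map_series s h F))"
proof (induction n arbitrary: F c)
  case 0
  have F0: "mcoeff F 0 \<noteq> 0" using 0(1) by (auto simp: series_unit_def)
  obtain d b where d: "d \<in> tau_polys s" "d \<noteq> 0" "b \<in> localized s (c * d)" "mcoeff F 0 * b = 1"
    by (rule localized_unit[OF series_overD(1)[OF 0(4)] F0 0(2,3)]) (rule that; assumption)
  have FS: "F \<in> series_over (localized s (c * d)) Ps"
    using 0(4) series_over_mono[OF localized_mono[OF 0(3) d(1,2)] order_refl, of Ps] by auto
  have "discriminant_chain UNIV (Ps \<union> \<Sigma>) 0 (map_series s h F)" if h: "specialization s \<Sigma> \<tau> h" "peval \<tau> (c * d) \<noteq> 0" for \<Sigma> \<tau> h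
  proof -
    interpret specialization s \<Sigma> \<tau> h by fact
    interpret tp: unital_subring "tau_polys s :: 'k taupoly set" by (rule unital_subring_tau_polys)
    have "localized s (c * d) \<subseteq> localization s \<Sigma> h" using localized_subset[OF _ h(2)] 0(2) d(1) by blast
    then have "series_unit (localization s \<Sigma> h) Ps F"
      using FS d(3,4) series_over_mono[of "localized s (c * d)" "localization s \<Sigma> h" Ps Ps] unfolding series_unit_def by blast
    then show ?thesis using map_series_unit[of Ps F] Ps by (simp add: admissible_def)
  qed
  then show ?case using d(1,2) by blast
next
  case (Suc n)
  interpret tp: unital_subring "tau_polys s :: 'k taupoly set" by (rule unital_subring_tau_polys)
  obtain P G where P: "weierstrass_form (tau_ratfuns s) (xvars n) (xvars n \<union> Ps) (X (Suc n)) F P"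
    and G: "G \<in> poly_over (series_over (tau_ratfuns s) (xvars n \<union> Ps))" "monic_radical P G"
      "discriminant_chain (tau_ratfuns s) Ps n (discriminant G)"
    using Suc.prems(1) by auto
  have F: "F \<in> series_over (localized s c) (insert (X (Suc n)) (xvars n \<union> Ps))" using Suc.prems(4) by (simp add: xvars_Suc)
  obtain d where d: "d \<in> tau_polys s" "d \<noteq> 0"
    "weierstrass_form (localized s (c * d)) (xvars n) (xvars n \<union> Ps) (X (Suc n)) F P"
    "G \<in> poly_over (series_over (localized s (c * d)) (xvars n \<union> Ps))"
    "\<And>\<Sigma> \<tau> h. specialization s \<Sigma> \<tau> h \<Longrightarrow> peval \<tau> (c * d) \<noteq> 0 \<Longrightarrow> map_series s h (discriminant G) \<noteq> 0"
    by (rule generic_localization[OF Suc.prems(2,3) admissibleD(2)[OF Ps] finite_xvars Un_upper1 admissibleD(4,3)[OF Ps] F P G(1,2)])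
      (rule that; assumption)
  have cd: "c * d \<in> tau_polys s" "c * d \<noteq> 0" using Suc.prems(2,3) d(1,2) by auto
  have "discriminant G \<in> series_over (localized s (c * d)) (xvars n \<union> Ps)"
    by (rule discriminant_in[OF unital_subring_series_over[OF unital_subring_localized[OF cd]] d(4)])
  from Suc.IH[OF G(3) cd this] obtain e where e: "e \<in> tau_polys s" "e \<noteq> 0"
    "\<And>\<Sigma> \<tau> h. specialization s \<Sigma> \<tau> h \<Longrightarrow> peval \<tau> (c * d * e) \<noteq> 0 \<Longrightarrow>
      discriminant_chain UNIV (Ps \<union> \<Sigma>) n (map_series s h (discriminant G))" by blast
  have "discriminant_chain UNIV (Ps \<union> \<Sigma>) (Suc n) (map_series s h F)"
    if h: "specialization s \<Sigma> \<tau> h" "peval \<tau> (c * (d * e)) \<noteq> 0" for \<Sigma> \<tau> h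
  proof -
    interpret specialization s \<Sigma> \<tau> h by fact
    have cde: "peval \<tau> (c * d) \<noteq> 0" "peval \<tau> (c * d * e) \<noteq> 0" using h(2) by (auto simp: peval_simps)
    have sub: "localized s (c * d) \<subseteq> localization s \<Sigma> h" by (rule localized_subset[OF cd(1) cde(1)])
    have "G \<in> poly_over (series_over (localization s \<Sigma> h) (xvars n \<union> Ps))"
      using d(4) poly_over_mono[OF series_over_mono[OF sub order_refl]] by blast
    note step = chain_step[OF Ps weierstrass_form_mono[OF d(3) sub] this G(2) d(5)[OF h(1) cde(1)]]
    have "discriminant_chain UNIV (Ps \<union> \<Sigma>) n (discriminant (map_poly (map_series s h) G))"
      unfolding step(4) by (rule e(3)[OF h(1) cde(2)])
    then show ?thesis using step(1-3) by auto
  qed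
  then show ?case using tp.mult_closed[OF d(1) e(1)] d(2) e(2) by (intro bexI[of _ "d * e"]) auto
qed

definition evaluation :: "(nat \<Rightarrow> 'k::field) \<Rightarrow> 'k taupoly \<Rightarrow> (var, 'k) mps" where
  "evaluation \<tau> p = mconst (peval \<tau> p)"

lemma specialization_evaluation: "specialization s {} (\<tau> :: nat \<Rightarrow> 'k::field_char_0) (evaluation \<tau>)"
  by standard (auto simp: evaluation_def peval_simps mconst_hom mcoeff_mconst intro: mconst_closed)

text \<open>The given chains at different points are unrelated to each other, and their orders in
  \<open>x_i\<close> might vary. The order over \<open>k(\<tau>)\<close> is attained at a suitable
  point, where regularity yields the pure power needed over \<open>k(\<tau>)\<close>. The
  Weierstrass polynomial and radical constructed there specialize to the given ones by uniqueness;
  replacing \<open>c\<close> by a multiple is harmless, as the chains are assumed at all points with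
  \<open>c\<close> nonzero.\<close>

lemma chain_generic:
  fixes F :: "(var, 'k::field_char_0 taupoly fract) mps"
  assumes Ps: "admissible Ps"
  shows "c \<in> tau_polys s \<Longrightarrow> c \<noteq> 0 \<Longrightarrow> F \<in> series_over (localized s c) (xvars n \<union> Ps) \<Longrightarrow>
    (\<And>\<tau>. \<tau> \<in> affine_space s \<Longrightarrow> peval \<tau> c \<noteq> 0 \<Longrightarrow> discriminant_chain UNIV Ps n (map_series s (evaluation \<tau>) F)) \<Longrightarrow>
    discriminant_chain (tau_ratfuns s) Ps n F"
proof (induction n arbitrary: F c)
  case 0
  obtain \<tau> where \<tau>: "\<tau> \<in> affine_space s" "peval \<tau> c \<noteq> 0" using nonvanishing_point[OF 0(1,2)] by blast
  interpret specialization s "{}" \<tau> "evaluation \<tau>" by (rule specialization_evaluation)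
  have "mcoeff (\<Phi> F) 0 \<noteq> 0" using 0(4)[OF \<tau>] by (auto simp: series_unit_def)
  then have "mcoeff F 0 \<noteq> 0" by (auto simp: mcoeff_map_series_0 localization_0)
  moreover have "F \<in> series_over (tau_ratfuns s) Ps"
    using 0(3) series_over_mono[OF localized_subset_ratfuns[OF 0(1,2)] order_refl, of Ps] by auto
  ultimately show ?case by (simp add: series_unit_subfield[OF subfield_tau_ratfuns])
next
  case (Suc n)
  let ?W = "xvars n" and ?V = "xvars n \<union> Ps" and ?v = "X (Suc n)" and ?K = "tau_ratfuns s :: 'k taupoly fract set"
  interpret tp: unital_subring "tau_polys s :: 'k taupoly set" by (rule unital_subring_tau_polys)
  note VS = admissibleD(3)[OF Ps, of n]
  interpret wU: weierstrass "UNIV :: 'k set" ?W ?V ?v by (rule weierstrass_xvars[OF unital_subring_UNIV admissibleD(1)[OF Ps]])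
  interpret wK: weierstrass ?K ?W ?V ?v
    by (rule weierstrass_xvars[OF subfield_setD(1)[OF subfield_tau_ratfuns] admissibleD(1)[OF Ps]])
  have F: "F \<in> series_over (localized s c) (insert ?v ?V)" using Suc.prems(3) by (simp add: xvars_Suc)
  have FK: "F \<in> series_over ?K (insert ?v ?V)"
    using F series_over_mono[OF localized_subset_ratfuns[OF Suc.prems(1,2)] order_refl] by blast
  \<comment> \<open>The exponents of \<open>?v\<close> that occur in \<open>F\<close> on the zero
    set of \<open>?W\<close>, with parameters allowed. Regularity over \<open>k(\<tau>)\<close>
    requires that the least of them is realized by a pure power of \<open>?v\<close>.\<close>
  define C where "C = (\<lambda>e. \<exists>m. keys m \<inter> ?W = {} \<and> lookup m ?v = e \<and> mcoeff F m \<noteq> 0)"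
  have regular: "\<exists>e. regular_at UNIV ?W ?v e (map_series s (evaluation \<tau>) F) \<and> mcoeff F (Poly_Mapping.single ?v e) \<noteq> 0"
    if \<tau>: "\<tau> \<in> affine_space s" "peval \<tau> c \<noteq> 0" for \<tau>
  proof -
    interpret specialization s "{}" \<tau> "evaluation \<tau>" by (rule specialization_evaluation)
    obtain P' where "weierstrass_form UNIV ?W ?V ?v (\<Phi> F) P'" using Suc.prems(4)[OF \<tau>] by auto
    then have reg: "regular_at UNIV ?W ?v (degree P') (\<Phi> F)" by (rule wU.regular_if_weierstrass_form)
    then have "mcoeff (\<Phi> F) (Poly_Mapping.single ?v (degree P')) \<noteq> 0" by (auto simp: regular_at_def)
    moreover have "keys (Poly_Mapping.single ?v (degree P')) \<inter> range S = {}" by auto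
    ultimately have "mcoeff F (Poly_Mapping.single ?v (degree P')) \<noteq> 0" by (auto simp: mcoeff_map_series_0 localization_0)
    then show ?thesis using reg by blast
  qed
  have Csingle: "C e" if "mcoeff F (Poly_Mapping.single ?v e) \<noteq> 0" for e
    unfolding C_def by (rule exI[of _ "Poly_Mapping.single ?v e"]) (use that wK.v_W in auto)
  obtain \<tau>0 where \<tau>0: "\<tau>0 \<in> affine_space s" "peval \<tau>0 c \<noteq> 0" using nonvanishing_point[OF Suc.prems(1,2)] by blast
  have "\<exists>e. C e" using regular[OF \<tau>0] Csingle by blast
  then have Cd: "C (LEAST e. C e)" by (rule LeastI_ex)
  define d where "d = (LEAST e. C e)"
  obtain m where m: "keys m \<inter> ?W = {}" "lookup m ?v = d" "mcoeff F m \<noteq> 0" using Cd by (auto simp: C_def d_def)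
  obtain d1 where d1: "d1 \<in> tau_polys s" "d1 \<noteq> 0"
    "\<And>\<Sigma> \<tau> h. specialization s \<Sigma> \<tau> h \<Longrightarrow> peval \<tau> (c * d1) \<noteq> 0 \<Longrightarrow> mcoeff (fract_value s h (mcoeff F m)) 0 \<noteq> 0"
    by (rule localized_unit[OF series_overD(1)[OF F] m(3) Suc.prems(1,2)]) (rule that; assumption)
  have cd1: "c * d1 \<in> tau_polys s" "c * d1 \<noteq> 0" using Suc.prems(1,2) d1(1,2) by auto
  \<comment> \<open>At this point the coefficient at \<open>m\<close> survives, which bounds the
    order there by \<open>d\<close>. It is at least \<open>d\<close>, because a pure power of
    \<open>?v\<close> that survives specialization occurs in \<open>F\<close>.\<close>
  obtain \<tau>1 where \<tau>1: "\<tau>1 \<in> affine_space s" "peval \<tau>1 (c * d1) \<noteq> 0" using nonvanishing_point[OF cd1] by blast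
  have c\<tau>1: "peval \<tau>1 c \<noteq> 0" using \<tau>1(2) by (auto simp: peval_simps)
  obtain e where e: "regular_at UNIV ?W ?v e (map_series s (evaluation \<tau>1) F)" "mcoeff F (Poly_Mapping.single ?v e) \<noteq> 0"
    using regular[OF \<tau>1(1) c\<tau>1] by blast
  have "d \<le> e" unfolding d_def by (rule Least_le) (rule Csingle[OF e(2)])
  moreover have "e \<le> d"
  proof (rule ccontr)
    assume "\<not> ?thesis"
    then have "mcoeff (map_series s (evaluation \<tau>1) F) m = 0" using e(1) m(1,2) by (simp add: regular_at_def)
    moreover have "keys m \<inter> range S = {}" using series_overD(2)[OF F m(3)] VS by blast
    ultimately show False
      using d1(3)[OF specialization_evaluation \<tau>1(2)]
      by (simp add: specialization.mcoeff_map_series_0[OF specialization_evaluation])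
  qed
  ultimately have Fd: "mcoeff F (Poly_Mapping.single ?v d) \<noteq> 0" using e(2) by simp
  have "regular_at ?K ?W ?v d F"
    unfolding regular_at_def
  proof (intro conjI allI impI)
    fix k assume k: "keys k \<inter> ?W = {} \<and> lookup k ?v < d"
    show "mcoeff F k = 0"
    proof (rule ccontr)
      assume "mcoeff F k \<noteq> 0"
      then have "C (lookup k ?v)" unfolding C_def using k by blast
      then have "d \<le> lookup k ?v" unfolding d_def by (rule Least_le)
      then show False using k by simp
    qed
  qed (use subfield_setD(2)[OF subfield_tau_ratfuns] series_overD(1)[OF FK] Fd in blast)
  then obtain P where P: "weierstrass_form ?K ?W ?V ?v F P" using wK.weierstrass_exists[OF FK] by blast
  obtain G where G: "G \<in> poly_over (series_over ?K ?V)" "monic_radical P G"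
    using radical_over_series[OF subfield_tau_ratfuns admissibleD(2)[OF Ps]] P unfolding weierstrass_form_def by metis
  obtain d2 where d2: "d2 \<in> tau_polys s" "d2 \<noteq> 0" "weierstrass_form (localized s (c * d2)) ?W ?V ?v F P"
    "G \<in> poly_over (series_over (localized s (c * d2)) ?V)"
    "\<And>\<Sigma> \<tau> h. specialization s \<Sigma> \<tau> h \<Longrightarrow> peval \<tau> (c * d2) \<noteq> 0 \<Longrightarrow> map_series s h (discriminant G) \<noteq> 0"
    by (rule generic_localization[OF Suc.prems(1,2) admissibleD(2)[OF Ps] finite_xvars Un_upper1 admissibleD(4,3)[OF Ps] F P G])
      (rule that; assumption)
  have cd2: "c * d2 \<in> tau_polys s" "c * d2 \<noteq> 0" using Suc.prems(1,2) d2(1,2) by auto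
  have disc: "discriminant G \<in> series_over (localized s (c * d2)) ?V"
    by (rule discriminant_in[OF unital_subring_series_over[OF unital_subring_localized[OF cd2]] d2(4)])
  have "discriminant_chain ?K Ps n (discriminant G)"
  proof (rule Suc.IH[OF cd2 disc])
    fix \<tau> :: "nat \<Rightarrow> 'k" assume \<tau>: "\<tau> \<in> affine_space s" "peval \<tau> (c * d2) \<noteq> 0"
    interpret specialization s "{}" \<tau> "evaluation \<tau>" by (rule specialization_evaluation)
    have c\<tau>: "peval \<tau> c \<noteq> 0" using \<tau>(2) by (auto simp: peval_simps)
    have sub: "localized s (c * d2) \<subseteq> L" by (rule localized_subset[OF cd2(1) \<tau>(2)])
    have "G \<in> poly_over (series_over L ?V)"
      using d2(4) poly_over_mono[OF series_over_mono[OF sub order_refl]] by blast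
    note step = chain_step[OF Ps weierstrass_form_mono[OF d2(3) sub] this G(2) d2(5)[OF specialization_evaluation \<tau>(2)], unfolded Un_empty_right]
    \<comment> \<open>Uniqueness of Weierstrass polynomials and radicals identifies the given stage
      at \<open>\<tau>\<close> with the image of \<open>P\<close> and \<open>G\<close>.\<close>
    obtain P' G' where P': "weierstrass_form UNIV ?W ?V ?v (\<Phi> F) P'" "monic_radical P' G'"
      "discriminant_chain UNIV Ps n (discriminant G')" using Suc.prems(4)[OF \<tau>(1) c\<tau>] by auto
    have "P' = map_poly \<Phi> P" using wU.weierstrass_form_unique[OF P'(1) step(1)] .
    then have "G' = map_poly \<Phi> G" using monic_radical_unique P'(2) step(3) by blast
    then show "discriminant_chain UNIV Ps n (\<Phi> (discriminant G))" using P'(3) step(4) by simp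
  qed
  then show ?case using P G by auto
qed

section \<open>The series of conditions (2) and (3) as images of the given one\<close>

lemma specialization_taylor: "specialization s (svars s) (\<tau> :: nat \<Rightarrow> 'k::field_char_0) (taylor \<tau>)"
proof
  show "svars s \<subseteq> range S" by (auto simp: svars_def)
  show "taylor \<tau> (p + q) = taylor \<tau> p + taylor \<tau> q" "taylor \<tau> (p * q) = taylor \<tau> p * taylor \<tau> q" "taylor \<tau> 1 = 1" for p q
    unfolding taylor_def
    by (simp_all only: coefficient_hom.eval_hom_add[OF mconst_coefficient_hom]
        coefficient_hom.eval_hom_mult[OF mconst_coefficient_hom] coefficient_hom.eval_hom_one[OF mconst_coefficient_hom])
  show "mcoeff (taylor \<tau> p) 0 = peval \<tau> p" for p by (rule mcoeff_taylor_0)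
  fix p :: "'k taupoly" assume p: "p \<in> tau_polys s"
  interpret KS: unital_subring "series_over UNIV (svars s) :: (var, 'k) mps set"
    by (rule unital_subring_series_over[OF unital_subring_UNIV])
  have c: "mconst a \<in> (series_over UNIV (svars s) :: (var, 'k) mps set)" for a by (rule mconst_closed) auto
  have v: "mvar (S i) \<in> (series_over UNIV (svars s) :: (var, 'k) mps set)" if "i \<in> {1..s}" for i
    by (rule mvar_closed[OF unital_subring_UNIV]) (use that in \<open>simp add: svars_def\<close>)
  show "taylor \<tau> p \<in> series_over UNIV (svars s)"
    unfolding taylor_def eval_hom_def
  proof (intro KS.sum_closed KS.mult_closed KS.prod_closed KS.power_closed KS.add_closed c)
    fix m i assume "m \<in> keys p" "i \<in> keys m"
    then show "mvar (S i) \<in> (series_over UNIV (svars s) :: (var, 'k) mps set)"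
      using p unfolding tau_polys_def by (intro v) blast
  qed
qed

lemma map_series_evaluation:
  assumes rat: "uniformly_rational_by s f b c" and c: "peval \<tau> c \<noteq> (0 :: 'k::field_char_0)"
    and f: "f \<in> series_over K V" "V \<inter> range S = {}"
  shows "map_series s (evaluation \<tau>) f = specialize b c \<tau>"
proof (rule mps_eqI)
  fix m
  interpret specialization s "{}" \<tau> "evaluation \<tau>" by (rule specialization_evaluation)
  have cs: "c \<in> tau_polys s" "c \<noteq> 0" and b: "\<And>\<alpha>. b \<alpha> \<in> tau_polys s" "\<And>\<alpha>. mcoeff f \<alpha> = Fract (b \<alpha>) (c ^ mdeg \<alpha>)"
    using rat by (auto simp: uniformly_rational_by_def)
  have val: "mcoeff (\<phi> (mcoeff f \<alpha>)) 0 = peval \<tau> (b \<alpha>) / peval \<tau> c ^ mdeg \<alpha>" for \<alpha>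
    using localized_value(3)[OF cs(1) c b(1)] by (simp add: b(2))
  show "mcoeff (map_series s (evaluation \<tau>) f) m = mcoeff (specialize b c \<tau>) m"
  proof (cases "keys m \<inter> range S = {}")
    case True
    then show ?thesis by (simp add: mcoeff_map_series_0 val specialize_def)
  next
    case False
    \<comment> \<open>\<open>specialize\<close> is defined at all monomials, so those containing
      some \<open>S i\<close> have to be checked: \<open>f\<close> has none, and the values of
      \<open>\<phi>\<close> are constants.\<close>
    have "mcoeff f m = 0" using series_overD(2)[OF f(1), of m] f(2) False by blast
    then have "b m = 0" using b(2)[of m] cs(2) by (simp add: Zero_fract_def eq_fract)
    then have r: "mcoeff (specialize b c \<tau>) m = 0" by (simp add: specialize_def peval_simps)
    have "\<not> keys (part (range S) m) \<subseteq> {}" using False by (simp add: keys_part)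
    moreover have "mcoeff f (part (- range S) m) \<in> L"
      using localized_value(1)[OF cs(1) c b(1)] by (simp add: b(2))
    ultimately have "mcoeff (\<phi> (mcoeff f (part (- range S) m))) (part (range S) m) = 0"
      using series_overD(2)[OF value_closed] by blast
    then show ?thesis by (simp add: r mcoeff_map_series)
  qed
qed

lemma s_coeff_eq_0:
  assumes "g \<in> series_over K (V \<union> \<Sigma>)" "\<Sigma> \<subseteq> range S" "keys \<alpha> \<inter> range S = {}" "\<not> keys \<alpha> \<subseteq> V"
  shows "s_coeff g \<alpha> = 0"
proof (rule mps_eqI, rule ccontr)
  fix \<beta> assume "mcoeff (s_coeff g \<alpha>) \<beta> \<noteq> mcoeff 0 \<beta>"
  then have "keys (\<alpha> + \<beta>) \<subseteq> V \<union> \<Sigma>" using series_overD(2)[OF assms(1)] by (auto simp: mcoeff_s_coeff split: if_splits)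
  then show False using assms(2-4) keys_subset_add_left[of \<alpha> \<beta>] by blast
qed

text \<open>A power of \<open>taylor \<tau> c\<close> can be cancelled, so the defining relations
  determine every coefficient over \<open>k[[S]]\<close>, and \<open>g\<close> with them.\<close>

lemma expansion_at_iff:
  fixes \<tau> :: "nat \<Rightarrow> 'k::field_char_0"
  assumes rat: "uniformly_rational_by s f b c" and c: "peval \<tau> c \<noteq> 0"
    and f: "f \<in> series_over K (xvars (r + 1) \<union> tvars l)"
  shows "expansion_at r l s b c \<tau> g \<longleftrightarrow> g = map_series s (taylor \<tau>) f"
proof -
  interpret specialization s "svars s" \<tau> "taylor \<tau>" by (rule specialization_taylor)
  let ?V = "xvars (r + 1) \<union> tvars l"
  have VS: "?V \<inter> range S = {}" by (auto simp: xvars_def tvars_def)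
  have cs: "c \<in> tau_polys s" "c \<noteq> 0" and b: "\<And>\<alpha>. b \<alpha> \<in> tau_polys s" "\<And>\<alpha>. mcoeff f \<alpha> = Fract (b \<alpha>) (c ^ mdeg \<alpha>)"
    using rat by (auto simp: uniformly_rational_by_def)
  have fL: "f \<in> series_over L ?V"
    using series_overD(2)[OF f] localized_value(1)[OF cs(1) c b(1)] by (intro series_overI) (auto simp: b(2))
  have val: "taylor \<tau> (b \<alpha>) = taylor \<tau> c ^ mdeg \<alpha> * \<phi> (mcoeff f \<alpha>)" for \<alpha>
    using localized_value(2)[OF cs(1) c b(1)] by (simp add: b(2))
  have c0: "taylor \<tau> c \<noteq> 0" using c by (metis mcoeff_taylor_0 mcoeff_zero)
  have sc: "s_coeff (\<Phi> f) \<alpha> = \<phi> (mcoeff f \<alpha>)" if "keys \<alpha> \<inter> range S = {}" for \<alpha>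
    by (rule s_coeff_map_series[OF series_D[OF VS fL] that])
  have \<Phi>f: "\<Phi> f \<in> series_over UNIV (?V \<union> svars s)" by (rule map_series_closed[OF VS fL])
  show ?thesis
  proof
    assume g: "expansion_at r l s b c \<tau> g"
    show "g = \<Phi> f"
    proof (rule s_coeff_eqI)
      fix \<alpha> :: "var \<Rightarrow>\<^sub>0 nat" assume \<alpha>: "keys \<alpha> \<inter> range S = {}"
      show "s_coeff g \<alpha> = s_coeff (\<Phi> f) \<alpha>"
      proof (cases "keys \<alpha> \<subseteq> ?V")
        case True
        then have "s_coeff g \<alpha> * taylor \<tau> c ^ mdeg \<alpha> = taylor \<tau> c ^ mdeg \<alpha> * s_coeff (\<Phi> f) \<alpha>"
          using g val sc[OF \<alpha>] by (simp add: expansion_at_def)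
        then show ?thesis using c0 by (simp add: mult.commute)
      next
        case False
        then show ?thesis
          using g \<alpha> s_coeff_eq_0[OF \<Phi>f Sig \<alpha>] s_coeff_eq_0[of g UNIV ?V "svars s" \<alpha>] Sig by (simp add: expansion_at_def)
      qed
    qed
  next
    assume g: "g = \<Phi> f"
    have "s_coeff (\<Phi> f) \<alpha> * taylor \<tau> c ^ mdeg \<alpha> = taylor \<tau> (b \<alpha>)" if "keys \<alpha> \<subseteq> ?V" for \<alpha>
    proof -
      have "keys \<alpha> \<inter> range S = {}" using that VS by blast
      then show ?thesis by (simp add: sc val mult.commute)
    qed
    then show "expansion_at r l s b c \<tau> g" using \<Phi>f unfolding g expansion_at_def by blast
  qed
qed

theorem proposition3p7:
  fixes f :: "(var, 'k::{alg_closed_field, field_char_0} taupoly fract) mps"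
    and b :: "(var \<Rightarrow>\<^sub>0 nat) \<Rightarrow> 'k taupoly" and c :: "'k taupoly"
    and r l s :: nat
  assumes series: "f \<in> series_over (tau_ratfuns s) (xvars (r + 1) \<union> tvars l)"
    and rational: "uniformly_rational_by s f b c"
    and vanishes: "vanishes_on_zero (xvars (r + 1)) f"
    and regular: "\<exists>n. mcoeff f (Poly_Mapping.single (X (r + 1)) n) \<noteq> 0"
  shows "let
      cond1 = zariski_equisingular (tau_ratfuns s) r (tvars l) f;
      cond2 = (\<exists>U. zariski_open s U \<and> U \<noteq> {} \<and>
                 (\<forall>\<tau>\<in>U. peval \<tau> c \<noteq> 0 \<and>
                    zariski_equisingular UNIV r (tvars l) (specialize b c \<tau>)));
      cond3 = (\<exists>\<tau>0\<in>affine_space s. peval \<tau>0 c \<noteq> 0 \<and>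
                 (\<exists>g. expansion_at r l s b c \<tau>0 g \<and>
                    zariski_equisingular UNIV r (tvars l \<union> svars s) g))
    in (cond1 \<longleftrightarrow> cond2) \<and> (cond2 \<longleftrightarrow> cond3)"
proof -
  let ?V = "xvars (Suc r) \<union> tvars l" and ?K = "tau_ratfuns s :: 'k taupoly fract set"
  interpret tp: unital_subring "tau_polys s :: 'k taupoly set" by (rule unital_subring_tau_polys)
  have c: "c \<in> tau_polys s" "c \<noteq> 0" and b: "\<And>\<alpha>. b \<alpha> \<in> tau_polys s" "\<And>\<alpha>. mcoeff f \<alpha> = Fract (b \<alpha>) (c ^ mdeg \<alpha>)"
    using rational by (auto simp: uniformly_rational_by_def)
  have f: "f \<in> series_over ?K ?V" using series by simp
  have fc: "f \<in> series_over (localized s c) ?V"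
  proof (rule series_overI)
    show "mcoeff f \<alpha> \<in> localized s c" for \<alpha> unfolding b(2) by (rule localizedI[OF b(1)])
  qed (rule series_overD(2)[OF f])
  have Ps: "admissible (tvars l)" by (auto simp: admissible_def parameters_def tvars_def)
  have Ps': "parameters (tvars l \<union> svars s)" by (auto simp: parameters_def tvars_def svars_def)
  have VS: "?V \<inter> range S = {}" by (auto simp: xvars_def tvars_def)
  have U: "subfield_set (UNIV :: 'k set)" by (simp add: subfield_set_def unital_subring_UNIV)
  define cond1 where "cond1 \<longleftrightarrow> zariski_equisingular ?K r (tvars l) f"
  define cond2 where "cond2 \<longleftrightarrow> (\<exists>U. zariski_open s U \<and> U \<noteq> {} \<and>
    (\<forall>\<tau>\<in>U. peval \<tau> c \<noteq> 0 \<and> zariski_equisingular UNIV r (tvars l) (specialize b c \<tau>)))"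
  define cond3 where "cond3 \<longleftrightarrow> (\<exists>\<tau>0\<in>affine_space s. peval \<tau>0 c \<noteq> 0 \<and>
    (\<exists>g. expansion_at r l s b c \<tau>0 g \<and> zariski_equisingular UNIV r (tvars l \<union> svars s) g))"
  have z1: "cond1 \<longleftrightarrow> discriminant_chain ?K (tvars l) (Suc r) f"
    unfolding cond1_def by (rule zariski_equisingular_iff_chain[OF subfield_tau_ratfuns admissibleD(1)[OF Ps]])
  have z2: "zariski_equisingular UNIV r (tvars l) (specialize b c \<tau>) \<longleftrightarrow>
      discriminant_chain UNIV (tvars l) (Suc r) (map_series s (evaluation \<tau>) f)" if "peval \<tau> c \<noteq> 0" for \<tau>
    using zariski_equisingular_iff_chain[OF U admissibleD(1)[OF Ps]] map_series_evaluation[OF rational that f VS] by simp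
  have z3: "(\<exists>g. expansion_at r l s b c \<tau> g \<and> zariski_equisingular UNIV r (tvars l \<union> svars s) g) \<longleftrightarrow>
      discriminant_chain UNIV (tvars l \<union> svars s) (Suc r) (map_series s (taylor \<tau>) f)" if "peval \<tau> c \<noteq> 0" for \<tau>
    unfolding expansion_at_iff[OF rational that series] zariski_equisingular_iff_chain[OF U Ps'] by blast
  have "cond2 \<and> cond3" if 1: cond1
  proof -
    \<comment> \<open>One \<open>d\<close> serves both conditions: (2) holds on the open set where
      \<open>c * d\<close> is nonzero, and (3) at any point of it.\<close>
    obtain d where d: "d \<in> tau_polys s" "d \<noteq> 0"
      "\<And>\<Sigma> \<tau> h. specialization s \<Sigma> \<tau> h \<Longrightarrow> peval \<tau> (c * d) \<noteq> 0 \<Longrightarrow>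
        discriminant_chain UNIV (tvars l \<union> \<Sigma>) (Suc r) (map_series s h f)"
      using chain_localize[OF Ps 1[unfolded z1] c fc] by blast
    have cd: "c * d \<in> tau_polys s" "c * d \<noteq> 0" using c d by auto
    obtain \<tau>0 where \<tau>0: "\<tau>0 \<in> affine_space s" "peval \<tau>0 (c * d) \<noteq> 0" using nonvanishing_point[OF cd] by blast
    have pc: "peval \<tau> c \<noteq> 0" if "peval \<tau> (c * d) \<noteq> 0" for \<tau> using that by (auto simp: peval_simps)
    have cond3
      unfolding cond3_def using \<tau>0 pc z3[OF pc[OF \<tau>0(2)]] d(3)[OF specialization_taylor \<tau>0(2)] by blast
    moreover have cond2
      unfolding cond2_def
    proof (intro exI conjI ballI)
      let ?U = "{\<tau> \<in> affine_space s. \<exists>p\<in>{c * d}. peval \<tau> p \<noteq> 0}"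
      show "zariski_open s ?U" unfolding zariski_open_def using cd by (intro exI[of _ "{c * d}"]) simp
      show "?U \<noteq> {}" using \<tau>0 by auto
      fix \<tau> assume "\<tau> \<in> ?U"
      then have \<tau>: "peval \<tau> (c * d) \<noteq> 0" by simp
      show "peval \<tau> c \<noteq> 0" by (rule pc[OF \<tau>])
      show "zariski_equisingular UNIV r (tvars l) (specialize b c \<tau>)"
        using z2[OF pc[OF \<tau>]] d(3)[OF specialization_evaluation \<tau>] by simp
    qed
    ultimately show ?thesis by simp
  qed
  moreover have cond1 if 2: cond2
  proof -
    obtain A where A: "A \<subseteq> tau_polys s" "{\<tau> \<in> affine_space s. \<exists>p\<in>A. peval \<tau> p \<noteq> 0} \<noteq> {}"
      "\<And>\<tau>. \<tau> \<in> {\<tau> \<in> affine_space s. \<exists>p\<in>A. peval \<tau> p \<noteq> 0} \<Longrightarrow>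
        peval \<tau> c \<noteq> 0 \<and> zariski_equisingular UNIV r (tvars l) (specialize b c \<tau>)"
      using 2 unfolding cond2_def zariski_open_def by blast
    \<comment> \<open>One polynomial of \<open>A\<close> is enough: the points with
      \<open>c * p\<close> nonzero form a nonempty principal open subset of the given open
      set.\<close>
    then obtain p \<tau>1 where p: "p \<in> A" "peval \<tau>1 p \<noteq> 0" by blast
    have pt: "p \<in> tau_polys s" "p \<noteq> 0" using A(1) p by (auto simp: peval_simps)
    have cp: "c * p \<in> tau_polys s" "c * p \<noteq> 0" using c pt by auto
    have "discriminant_chain ?K (tvars l) (Suc r) f"
    proof (rule chain_generic[OF Ps cp])
      show "f \<in> series_over (localized s (c * p)) ?V"
        using fc series_over_mono[OF localized_mono[OF c(2) pt] order_refl] by blast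
      fix \<tau> :: "nat \<Rightarrow> 'k" assume \<tau>: "\<tau> \<in> affine_space s" "peval \<tau> (c * p) \<noteq> 0"
      then have "peval \<tau> p \<noteq> 0" by (auto simp: peval_simps)
      then have "\<tau> \<in> {\<tau> \<in> affine_space s. \<exists>p\<in>A. peval \<tau> p \<noteq> 0}" using \<tau>(1) p(1) by blast
      then show "discriminant_chain UNIV (tvars l) (Suc r) (map_series s (evaluation \<tau>) f)"
        using A(3) z2 by blast
    qed
    then show ?thesis using z1 by simp
  qed
  moreover have cond1 if 3: cond3
  proof -
    obtain \<tau> where \<tau>: "peval \<tau> c \<noteq> 0"
      "discriminant_chain UNIV (tvars l \<union> svars s) (Suc r) (map_series s (taylor \<tau>) f)"
      using 3 z3 unfolding cond3_def by blast
    interpret specialization s "svars s" \<tau> "taylor \<tau>" by (rule specialization_taylor)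
    have fL: "f \<in> series_over L ?V"
      using fc series_over_mono[OF localized_subset[OF c(1) \<tau>(1)] order_refl] by blast
    have "finite (svars s)" by (simp add: svars_def)
    from chain_descent[OF taylor_injective this Ps fL \<tau>(2)]
    have "discriminant_chain ?K (tvars l) (Suc r) f" .
    then show ?thesis using z1 by simp
  qed
  ultimately show ?thesis
    unfolding Let_def cond1_def[symmetric] cond2_def[symmetric] cond3_def[symmetric] by blast
qed

end
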